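(* Let $\mu>0$. For $0<q<1$ put $z=q^\mu$, let $\zeta_t=P^+_t-P^-_t$ where $P^+,P^-$ are independent Poisson processes with intensities $1$ and $z$ respectively, let $I^{(q,z)}=\int_0^\infty q^{\zeta_s}\,ds$, and let $$W^{(q,\mu)}_t=\frac{-\log q}{2}\,\zeta_{\frac{2t}{(1-q)^2}},\qquad t\ge0 .$$ For $x\in D_\infty$ let $I(x)=2\int_0^\infty e^{-2x(s)}\,ds\in\mathbb{R}\sqcup\{\infty\}$. Then $$(1-q)^2 I^{(q,z)}=I\left(W^{(q,\mu)}\right),$$ and, as $q\to1^-$, one has the weak convergence on $\left(D_\infty\times\mathbb{R}_+,\ \mathcal{D}\otimes \mathrm{Bor}(\mathbb{R}_+)\right)$ $$\left(W^{(q,\mu)},I\left(W^{(q,\mu)}\right)\right)\longrightarrow\left(W^{(\mu)},I\left(W^{(\mu)}\right)\right),$$ where $W^{(\mu)}$ is a standard Brownian motion on $\mathbb{R}$ with drift $\mu$.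
   Context: $D_\infty$ is the set of càdlàg functions $f:\mathbb{R}_+\to\mathbb{R}$, equipped with the local uniform distance $d(x,y)=\sum_{n\ge1}2^{-n}\left(1\wedge d_n(x,y)\right)$, where $d_n(x,y)=\sup_{0\le t\le n}|x(t)-y(t)|$; this metrizes uniform convergence on compact sets (and is not separable). $\mathcal{D}$ is the ball $\sigma$-field on $(D_\infty,d)$ (generated by the open balls of $d$), equivalently the Borel $\sigma$-field of the usual Skorohod topology on $D_\infty$. $\mathrm{Bor}(\mathbb{R}_+)$ is the Borel $\sigma$-field of $\mathbb{R}_+$. Weak convergence on $\left(D_\infty\times\mathbb{R}_+,\mathcal{D}\otimes\mathrm{Bor}(\mathbb{R}_+)\right)$ means convergence of $\mathbb{E}\left(F(\cdot)\right)$ for every bounded function $F:D_\infty\times\mathbb{R}_+\to\mathbb{R}$ that is continuous for the product of the topology of $d$ with the usual topology and measurable for $\mathcal{D}\otimes\mathrm{Bor}(\mathbb{R}_+)$. The functionals $I(W^{(q,\mu)})$ and $I(W^{(\mu)})$ are almost surely finite and regarded as $\mathbb{R}_+$-valued random variables. *)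

theory Defs
  imports "HOL-Probability.Probability"
begin

section \<open>Cadlag paths with the local uniform distance\<close>

text \<open>Functions on the half-line are represented by members of \<^term>\<open>extensional {0..}\<close>,
  that is, by functions with the fixed value \<^term>\<open>undefined\<close> at negative times, so that two
  paths are equal iff they agree on the half-line.\<close>

definition cadlag_space :: "(real \<Rightarrow> real) set" where
  "cadlag_space = {x \<in> extensional {0..}.
     (\<forall>t\<ge>0. (x \<longlongrightarrow> x t) (at_right t)) \<and> (\<forall>t>0. \<exists>l. (x \<longlongrightarrow> l) (at_left t))}"

text \<open>The supremum is taken in the extended half-line, where it exists without a boundedness
  condition (for cadlag paths it is finite).\<close>

definition unif_dist :: "nat \<Rightarrow> (real \<Rightarrow> real) \<Rightarrow> (real \<Rightarrow> real) \<Rightarrow> ennreal" where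
  "unif_dist n x y = (SUP t\<in>{0..real n}. ennreal \<bar>x t - y t\<bar>)"

text \<open>The sum over \<open>n \<ge> 1\<close> is indexed from 0, hence the \<^const>\<open>Suc\<close>.\<close>

definition loc_unif_dist :: "(real \<Rightarrow> real) \<Rightarrow> (real \<Rightarrow> real) \<Rightarrow> real" where
  "loc_unif_dist x y = (\<Sum>n. (1/2) ^ Suc n * enn2real (min 1 (unif_dist (Suc n) x y)))"

lemma enn2real_min_le_1: "enn2real (min 1 u) \<le> 1"
  by (rule enn2real_leI) auto

lemma unif_dist_triangle: "unif_dist n x z \<le> unif_dist n x y + unif_dist n y z"
  unfolding unif_dist_def[of n x z]
proof (rule SUP_least)
  fix t assume t: "t \<in> {0..real n}"
  have "ennreal \<bar>x t - z t\<bar> \<le> ennreal (\<bar>x t - y t\<bar> + \<bar>y t - z t\<bar>)"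
    by (rule ennreal_leI) linarith
  also have "\<dots> = ennreal \<bar>x t - y t\<bar> + ennreal \<bar>y t - z t\<bar>"
    by simp
  also have "\<dots> \<le> unif_dist n x y + unif_dist n y z"
    unfolding unif_dist_def using t by (intro add_mono SUP_upper)
  finally show "ennreal \<bar>x t - z t\<bar> \<le> unif_dist n x y + unif_dist n y z" .
qed

lemma min_1_less_top: "min 1 u < (top::ennreal)"
  by (rule le_less_trans[OF min.cobounded1]) simp

lemma enn2real_min_triangle:
  assumes "u \<le> v + w"
  shows "enn2real (min 1 u) \<le> enn2real (min 1 v) + enn2real (min 1 w)"
proof -
  have "min 1 u \<le> min 1 v + min 1 w"
  proof (cases "v \<le> 1 \<and> w \<le> 1")
    case True
    with assms show ?thesis by (simp add: min_absorb2 min.coboundedI2)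
  next
    case False
    then consider "min 1 v = 1" | "min 1 w = 1" by (auto simp: min_def)
    then show ?thesis
    proof cases
      case 1
      have "min 1 u \<le> 1 + 0" by simp
      also have "\<dots> \<le> min 1 v + min 1 w" unfolding 1 by (rule add_left_mono) simp
      finally show ?thesis .
    next
      case 2
      have "min 1 u \<le> 0 + 1" by simp
      also have "\<dots> \<le> min 1 v + min 1 w" unfolding 2 by (rule add_right_mono) simp
      finally show ?thesis .
    qed
  qed
  then have "enn2real (min 1 u) \<le> enn2real (min 1 v + min 1 w)"
    by (rule enn2real_mono) (simp add: min_1_less_top)
  also have "\<dots> = enn2real (min 1 v) + enn2real (min 1 w)"
    by (rule enn2real_plus) (simp_all add: min_1_less_top)
  finally show ?thesis .
qed

lemma summable_loc_unif_dist:
  "summable (\<lambda>n. (1/2::real) ^ Suc n * enn2real (min 1 (unif_dist (Suc n) x y)))"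
proof (rule summable_comparison_test'[where N = 0])
  show "summable (\<lambda>n. (1/2::real) ^ Suc n)"
    by (subst summable_Suc_iff) (simp add: summable_geometric)
  fix n :: nat
  show "norm ((1/2::real) ^ Suc n * enn2real (min 1 (unif_dist (Suc n) x y))) \<le> (1/2) ^ Suc n"
    using enn2real_min_le_1[of "unif_dist (Suc n) x y"] by (simp add: abs_mult)
qed

lemma Metric_space_cadlag: "Metric_space cadlag_space loc_unif_dist"
proof
  fix x y z :: "real \<Rightarrow> real"
  show "0 \<le> loc_unif_dist x y"
    unfolding loc_unif_dist_def by (rule suminf_nonneg[OF summable_loc_unif_dist]) simp
  show "loc_unif_dist x y = loc_unif_dist y x"
    by (simp add: loc_unif_dist_def unif_dist_def abs_minus_commute)
  show "loc_unif_dist x z \<le> loc_unif_dist x y + loc_unif_dist y z"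
    unfolding loc_unif_dist_def
    by (subst suminf_add[OF summable_loc_unif_dist summable_loc_unif_dist])
      (intro suminf_le summable_add summable_loc_unif_dist,
        use enn2real_min_triangle[OF unif_dist_triangle] in
          \<open>simp add: distrib_left[symmetric] del: power_Suc\<close>)
  assume xy: "x \<in> cadlag_space" "y \<in> cadlag_space"
  show "loc_unif_dist x y = 0 \<longleftrightarrow> x = y"
  proof
    assume "loc_unif_dist x y = 0"
    then have zero: "(1/2::real) ^ Suc n * enn2real (min 1 (unif_dist (Suc n) x y)) = 0" for n
      unfolding loc_unif_dist_def
      using suminf_eq_zero_iff[OF summable_loc_unif_dist[of x y]] by auto
    have "x t = y t" if t: "0 \<le> t" for t
    proof -
      obtain n where n: "t \<le> real n" using real_arch_simple by blast
      have "unif_dist (Suc n) x y = 0"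
        using zero[of n] by (auto simp: enn2real_eq_0_iff min_def split: if_splits)
      moreover have "ennreal \<bar>x t - y t\<bar> \<le> unif_dist (Suc n) x y"
        unfolding unif_dist_def using t n by (intro SUP_upper) auto
      ultimately show ?thesis by (simp add: ennreal_eq_0_iff)
    qed
    with xy show "x = y"
      by (intro extensionalityI[of _ "{0..}"]) (auto simp: cadlag_space_def)
  qed (simp add: loc_unif_dist_def unif_dist_def)
qed

interpretation cadlag: Metric_space cadlag_space loc_unif_dist
  by (rule Metric_space_cadlag)

definition cadlag_ball_sigma :: "(real \<Rightarrow> real) measure" where
  "cadlag_ball_sigma = sigma cadlag_space {cadlag.mball x r | x r. x \<in> cadlag_space}"

section \<open>Weak convergence\<close>

text \<open>Convergence in law of random elements \<open>X i\<close>, possibly living on different probability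
  spaces, of a set with a topology \<open>T\<close> and a sigma-field \<open>S\<close>. The latter may be strictly smaller
  than the Borel sigma-field of \<open>T\<close>, so test functions have to be both continuous and
  measurable.\<close>

definition weakly_converges ::
  "'x topology \<Rightarrow> 'x measure \<Rightarrow> ('i \<Rightarrow> 'a measure) \<Rightarrow> ('i \<Rightarrow> 'a \<Rightarrow> 'x) \<Rightarrow> 'i filter
    \<Rightarrow> 'b measure \<Rightarrow> ('b \<Rightarrow> 'x) \<Rightarrow> bool" where
  "weakly_converges T S M X F N Y \<longleftrightarrow>
     (\<forall>\<^sub>F i in F. prob_space (M i) \<and> X i \<in> measurable (M i) S) \<and>
     prob_space N \<and> Y \<in> measurable N S \<and>
     (\<forall>f :: 'x \<Rightarrow> real. continuous_map T euclideanreal f \<longrightarrow> f \<in> borel_measurable S \<longrightarrow>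
        bounded (f ` space S) \<longrightarrow>
        ((\<lambda>i. \<integral>\<omega>. f (X i \<omega>) \<partial>M i) \<longlongrightarrow> (\<integral>\<omega>. f (Y \<omega>) \<partial>N)) F)"

section \<open>Poisson processes and Brownian motion\<close>

definition indep_increments :: "'a measure \<Rightarrow> (real \<Rightarrow> 'a \<Rightarrow> real) \<Rightarrow> bool" where
  "indep_increments M X \<longleftrightarrow>
     (\<forall>(n::nat) (t :: nat \<Rightarrow> real). 0 \<le> t 0 \<longrightarrow> strict_mono_on {..n} t \<longrightarrow>
        prob_space.indep_vars M (\<lambda>_. borel) (\<lambda>i \<omega>. X (t (Suc i)) \<omega> - X (t i) \<omega>) {..<n})"

text \<open>Only times \<open>t \<ge> 0\<close> matter. The path properties are required of every sample path, so that
  the process is a random element of a path space. The natural number subtraction does not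
  truncate, as the paths are nondecreasing.\<close>

definition poisson_process :: "'a measure \<Rightarrow> real \<Rightarrow> (real \<Rightarrow> 'a \<Rightarrow> nat) \<Rightarrow> bool" where
  "poisson_process M rate P \<longleftrightarrow> prob_space M \<and>
     (\<forall>t\<ge>0. P t \<in> measurable M (count_space UNIV)) \<and>
     (\<forall>\<omega>\<in>space M. P 0 \<omega> = 0 \<and> mono_on {0..} (\<lambda>t. P t \<omega>) \<and>
        (\<forall>t\<ge>0. ((\<lambda>s. real (P s \<omega>)) \<longlongrightarrow> real (P t \<omega>)) (at_right t))) \<and>
     indep_increments M (\<lambda>t \<omega>. real (P t \<omega>)) \<and>
     (\<forall>s t. 0 \<le> s \<longrightarrow> s < t \<longrightarrow>
        distr M (count_space UNIV) (\<lambda>\<omega>. P t \<omega> - P s \<omega>) = measure_pmf (poisson_pmf (rate * (t - s))))"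

definition indep_counting_processes ::
  "'a measure \<Rightarrow> (real \<Rightarrow> 'a \<Rightarrow> nat) \<Rightarrow> (real \<Rightarrow> 'a \<Rightarrow> nat) \<Rightarrow> bool" where
  "indep_counting_processes M P Q \<longleftrightarrow>
     prob_space.indep_var M
       (\<Pi>\<^sub>M t\<in>{0..}. count_space UNIV) (\<lambda>\<omega>. \<lambda>t\<in>{0..}. P t \<omega>)
       (\<Pi>\<^sub>M t\<in>{0..}. count_space UNIV) (\<lambda>\<omega>. \<lambda>t\<in>{0..}. Q t \<omega>)"

definition standard_brownian_motion :: "'a measure \<Rightarrow> (real \<Rightarrow> 'a \<Rightarrow> real) \<Rightarrow> bool" where
  "standard_brownian_motion M B \<longleftrightarrow> prob_space M \<and>
     (\<forall>t\<ge>0. B t \<in> borel_measurable M) \<and>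
     (\<forall>\<omega>\<in>space M. B 0 \<omega> = 0 \<and> continuous_on {0..} (\<lambda>t. B t \<omega>)) \<and>
     indep_increments M B \<and>
     (\<forall>s t. 0 \<le> s \<longrightarrow> s < t \<longrightarrow>
        distributed M lborel (\<lambda>\<omega>. B t \<omega> - B s \<omega>) (normal_density 0 (sqrt (t - s))))"

section \<open>The paths and functionals\<close>

definition zeta :: "(real \<Rightarrow> 'a \<Rightarrow> nat) \<Rightarrow> (real \<Rightarrow> 'a \<Rightarrow> nat) \<Rightarrow> 'a \<Rightarrow> real \<Rightarrow> real" where
  "zeta P Q \<omega> t = real (P t \<omega>) - real (Q t \<omega>)"

definition I_q :: "real \<Rightarrow> (real \<Rightarrow> real) \<Rightarrow> ennreal" where
  "I_q q \<zeta> = (\<integral>\<^sup>+s\<in>{0..}. ennreal (q powr \<zeta> s) \<partial>lborel)"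

definition W_q :: "real \<Rightarrow> (real \<Rightarrow> real) \<Rightarrow> real \<Rightarrow> real" where
  "W_q q \<zeta> = (\<lambda>t\<in>{0..}. - ln q / 2 * \<zeta> (2 * t / (1 - q)\<^sup>2))"

definition W_drift :: "real \<Rightarrow> (real \<Rightarrow> 'a \<Rightarrow> real) \<Rightarrow> 'a \<Rightarrow> real \<Rightarrow> real" where
  "W_drift \<mu> B \<omega> = (\<lambda>t\<in>{0..}. B t \<omega> + \<mu> * t)"

definition exp_functional :: "(real \<Rightarrow> real) \<Rightarrow> ennreal" where
  "exp_functional x = 2 * (\<integral>\<^sup>+s\<in>{0..}. ennreal (exp (- 2 * x s)) \<partial>lborel)"

end

theory Submission
  imports Defs "HOL-Real_Asymp.Real_Asymp"
begin

text \<open>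
  Both the rescaled difference of Poisson processes and Brownian motion with drift have independent
  increments whose mean is proportional to the elapsed time and whose variance is at most
  proportional to it; the locale \<open>drift_process\<close> captures this. Ottaviani's inequality, carried from grids to real time by right-continuity,
  bounds the oscillation of such a process by its increments. Applied to the second moment on dyadic
  time blocks it shows that a process with drift \<open>m > 0\<close> stays above \<open>m s / 2 - C\<close> for
  all times \<open>s\<close> with a probability that tends to 1 as \<open>C\<close> grows, uniformly in the process
  (\<open>linear_lower_bound\<close>). In particular the exponential functional is finite almost surely, and its
  mass at late times is negligible uniformly in \<open>q\<close>. That is the point of the proposition, since
  \<open>I\<close> itself is discontinuous for locally uniform convergence.

  A path can therefore be replaced by the step path through its values on a grid of width \<open>1/j\<close>, and
  its functional by a Riemann sum up to a time \<open>T\<close>, with an error that is small with high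
  probability, uniformly for \<open>q\<close> near 1 (\<open>discretisation_close\<close>). The oscillation within a grid cell
  is controlled through the limit law of one increment: a normal variable of variance \<open>1/j\<close> has
  fourth moment \<open>3/j\<^sup>2\<close>, and the sum over the \<open>T j\<close> cells vanishes as \<open>j\<close> grows.
  The discretised pair is a continuous function of the sequence of grid increments.
  These are independent and converge in law one by one, because the characteristic functions of
  Poisson variables converge (\<open>scaled_zeta_weak_limit\<close>); Skorohod's representation of each
  coordinate on a common product space then gives convergence in law of the sequence
  (\<open>indep_sequence_weak_limit\<close>).

  Finally a bounded continuous test function \<open>F\<close> has to be handled on a space that is not
  separable, with a sigma-field smaller than the Borel one, so that functions built from \<open>F\<close> by infima
  may fail to be measurable. The largest \<open>k\<close>-Lipschitz minorant \<open>F\<^sub>k\<close> of \<open>F\<close> is therefore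
  evaluated only at discretised paths, where it depends continuously on the increments. It bounds
  \<open>F\<close> at the true path from below up to \<open>k\<close> times the discretisation error, and it recovers \<open>F\<close>
  along the discretisations of the limit. Using this for \<open>F\<close> and for \<open>-F\<close> gives
  the convergence of expectations (\<open>expectation_tendsto_by_approximation\<close>).
\<close>

section \<open>Maximal inequalities for processes with independent increments\<close>

text \<open>At the first time \<open>k\<close> at which the walk is farther than \<open>2 l\<close> from its start, the remaining
increment is independent of the past and at most \<open>l\<close> with probability at least \<open>1/2\<close>; if it is,
the walk also ends farther than \<open>l\<close> away. Unlike a bound through the variance alone, the right
hand side keeps the tail of the final position, which makes fourth moments available later.\<close>

lemma (in prob_space) ottaviani_inequality:
  fixes S :: "nat \<Rightarrow> 'a \<Rightarrow> real"
  assumes ind: "indep_vars (\<lambda>_. borel) (\<lambda>i \<omega>. S (Suc i) \<omega> - S i \<omega>) {..<n}"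
    and meas: "\<And>k. k \<le> n \<Longrightarrow> S k \<in> borel_measurable M"
    and half: "\<And>k. k \<le> n \<Longrightarrow> prob {\<omega>\<in>space M. \<bar>S n \<omega> - S k \<omega>\<bar> > l} \<le> 1/2"
  shows "prob {\<omega>\<in>space M. \<exists>k\<le>n. \<bar>S k \<omega> - S 0 \<omega>\<bar> > 2 * l}
    \<le> 2 * prob {\<omega>\<in>space M. \<bar>S n \<omega> - S 0 \<omega>\<bar> > l}"
proof -
  define X where "X i \<omega> = S (Suc i) \<omega> - S i \<omega>" for i \<omega>
  \<comment> \<open>first passage at time k\<close>
  define A where "A k = {\<omega>\<in>space M. \<bar>S k \<omega> - S 0 \<omega>\<bar> > 2 * l \<and> (\<forall>j<k. \<bar>S j \<omega> - S 0 \<omega>\<bar> \<le> 2 * l)}" for k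
  define B where "B k = {\<omega>\<in>space M. \<bar>S n \<omega> - S k \<omega>\<bar> \<le> l}" for k
  have [measurable]: "S k \<in> borel_measurable M" if "k \<le> n" for k using meas that by blast
  have tele: "S k \<omega> - S j \<omega> = (\<Sum>i\<in>{j..<k}. X i \<omega>)" if "j \<le> k" for j k \<omega>
    unfolding X_def using sum_Suc_diff'[OF that, of "\<lambda>i. S i \<omega>"] by simp
  have A_sets[measurable]: "A k \<in> sets M" if k: "k \<le> n" for k
  proof -
    have [measurable]: "S j \<in> borel_measurable M" if "j < k" for j using k that by simp
    have "A k = {\<omega>\<in>space M. \<bar>S k \<omega> - S 0 \<omega>\<bar> > 2 * l} \<inter>
        {\<omega>\<in>space M. \<forall>j\<in>{..<k}. \<bar>S j \<omega> - S 0 \<omega>\<bar> \<le> 2 * l}" by (auto simp: A_def)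
    also have "\<dots> \<in> sets M"
      using k by (intro sets.Int sets.sets_Collect_finite_All) auto
    finally show ?thesis .
  qed
  have B_sets[measurable]: "B k \<in> sets M" if "k \<le> n" for k unfolding B_def using that by measurable
  have indepAB: "prob (A k \<inter> B k) = prob (A k) * prob (B k)" if k: "k \<le> n" for k
  proof -
    let ?RA = "\<lambda>\<omega>. restrict (\<lambda>i. X i \<omega>) {..<k}" and ?RB = "\<lambda>\<omega>. restrict (\<lambda>i. X i \<omega>) {k..<n}"
    let ?PA = "Pi\<^sub>M {..<k} (\<lambda>_. borel :: real measure)" and ?PB = "Pi\<^sub>M {k..<n} (\<lambda>_. borel :: real measure)"
    have iv: "indep_var ?PA ?RA ?PB ?RB"
      using ind k unfolding X_def[symmetric] by (intro indep_var_restrict[where I="{..<n}"]) auto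
    let ?XA = "{x\<in>space ?PA. \<bar>\<Sum>i\<in>{0..<k}. x i\<bar> > 2 * l \<and> (\<forall>j\<in>{..<k}. \<bar>\<Sum>i\<in>{0..<j}. x i\<bar> \<le> 2 * l)}"
    let ?XB = "{x\<in>space ?PB. \<bar>\<Sum>i\<in>{k..<n}. x i\<bar> \<le> l}"
    have XA: "?XA \<in> sets ?PA"
    proof -
      have "(\<lambda>x. \<Sum>i\<in>{0..<j}. x i) \<in> borel_measurable ?PA" if "j \<le> k" for j
        using that by (intro borel_measurable_sum) (auto intro!: measurable_component_singleton)
      then have [measurable]: "(\<lambda>x. \<Sum>i\<in>{0..<k}. x i) \<in> borel_measurable ?PA"
          "\<And>j. j \<in> {..<k} \<Longrightarrow> (\<lambda>x. \<Sum>i\<in>{0..<j}. x i) \<in> borel_measurable ?PA" by auto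
      show ?thesis by (intro sets.sets_Collect_conj sets.sets_Collect_finite_All) measurable
    qed
    have XB: "?XB \<in> sets ?PB"
    proof -
      have [measurable]: "(\<lambda>x. \<Sum>i\<in>{k..<n}. x i) \<in> borel_measurable ?PB"
        by (intro borel_measurable_sum) (auto intro!: measurable_component_singleton)
      show ?thesis by measurable
    qed
    have "?RA -` ?XA \<inter> space M = A k"
      unfolding A_def using tele[of 0] by (auto simp: space_PiM)
    moreover have "?RB -` ?XB \<inter> space M = B k"
      unfolding B_def using tele[of k n] k by (auto simp: space_PiM)
    moreover have "(\<lambda>x. (?RA x, ?RB x)) -` (?XA \<times> ?XB) \<inter> space M
        = (?RA -` ?XA \<inter> space M) \<inter> (?RB -` ?XB \<inter> space M)" by auto
    ultimately show ?thesis using indep_varD[OF iv XA XB] by simp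
  qed
  have Bhalf: "prob (B k) \<ge> 1/2" if k: "k \<le> n" for k
  proof -
    have "prob (B k) = 1 - prob (space M - B k)"
      using prob_compl[OF B_sets[OF k]] by simp
    also have "space M - B k = {\<omega>\<in>space M. \<bar>S n \<omega> - S k \<omega>\<bar> > l}" by (auto simp: B_def)
    finally show ?thesis using half[OF k] by simp
  qed
  have disj: "disjoint_family_on A {..n}"
    unfolding disjoint_family_on_def A_def by clarsimp (smt (verit) Int_emptyI linorder_neqE_nat mem_Collect_eq)
  have eq: "{\<omega>\<in>space M. \<exists>k\<le>n. \<bar>S k \<omega> - S 0 \<omega>\<bar> > 2 * l} = (\<Union>k\<in>{..n}. A k)"
  proof (intro equalityI subsetI)
    fix \<omega> assume w: "\<omega> \<in> {\<omega>\<in>space M. \<exists>k\<le>n. \<bar>S k \<omega> - S 0 \<omega>\<bar> > 2 * l}"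
    define k where "k = (LEAST k. \<bar>S k \<omega> - S 0 \<omega>\<bar> > 2 * l)"
    obtain i where i: "i \<le> n" "\<bar>S i \<omega> - S 0 \<omega>\<bar> > 2 * l" using w by auto
    have "\<bar>S k \<omega> - S 0 \<omega>\<bar> > 2 * l" "k \<le> n"
      using LeastI[of "\<lambda>k. \<bar>S k \<omega> - S 0 \<omega>\<bar> > 2 * l", OF i(2)] Least_le[of "\<lambda>k. \<bar>S k \<omega> - S 0 \<omega>\<bar> > 2 * l", OF i(2)] i(1)
      unfolding k_def by auto
    moreover have "\<bar>S j \<omega> - S 0 \<omega>\<bar> \<le> 2 * l" if "j < k" for j
      using not_less_Least[of j "\<lambda>k. \<bar>S k \<omega> - S 0 \<omega>\<bar> > 2 * l"] that unfolding k_def by auto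
    ultimately show "\<omega> \<in> (\<Union>k\<in>{..n}. A k)" using w by (auto simp: A_def)
  qed (auto simp: A_def)
  have "prob (\<Union>k\<in>{..n}. A k) = (\<Sum>k\<le>n. prob (A k))"
    using disj by (intro finite_measure_finite_Union) auto
  also have "\<dots> \<le> (\<Sum>k\<le>n. 2 * prob (A k \<inter> B k))"
  proof (rule sum_mono)
    fix k assume "k \<in> {..n}"
    then show "prob (A k) \<le> 2 * prob (A k \<inter> B k)"
      using mult_left_mono[OF Bhalf[of k], of "2 * prob (A k)"] by (simp add: indepAB)
  qed
  also have "\<dots> = 2 * prob (\<Union>k\<in>{..n}. A k \<inter> B k)"
    using disj by (subst finite_measure_finite_Union) (auto simp: sum_distrib_left disjoint_family_on_def)
  also have "\<dots> \<le> 2 * prob {\<omega>\<in>space M. \<bar>S n \<omega> - S 0 \<omega>\<bar> > l}"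
    by (intro mult_left_mono finite_measure_mono) (auto simp: A_def B_def)
  finally show ?thesis unfolding eq .
qed

text \<open>The right endpoint belongs to every grid; any earlier exceedance persists to the right for a
while and is hence seen by a fine grid. The inequality has to be strict for this.\<close>

lemma exceedance_iff_dyadic:
  fixes y :: "real \<Rightarrow> real"
  assumes rc: "\<And>t. a \<le> t \<Longrightarrow> (y \<longlongrightarrow> y t) (at_right t)" and h: "0 < h"
  shows "(\<exists>s\<in>{a..a+h}. \<bar>y s - c\<bar> > l) \<longleftrightarrow> (\<exists>p::nat. \<exists>k\<le>2^p. \<bar>y (a + h * real k / 2^p) - c\<bar> > l)"
proof
  assume "\<exists>s\<in>{a..a+h}. \<bar>y s - c\<bar> > l"
  then obtain s where s: "a \<le> s" "s \<le> a + h" "\<bar>y s - c\<bar> > l" by auto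
  show "\<exists>p::nat. \<exists>k\<le>2^p. \<bar>y (a + h * real k / 2^p) - c\<bar> > l"
  proof (cases "s = a + h")
    case True then show ?thesis using s by (intro exI[of _ 0] exI[of _ 1]) auto
  next
    case False
    then have sh: "s < a + h" using s by simp
    have "((\<lambda>u. \<bar>y u - c\<bar>) \<longlongrightarrow> \<bar>y s - c\<bar>) (at_right s)" by (intro tendsto_intros rc s)
    then have "eventually (\<lambda>u. \<bar>y u - c\<bar> > l) (at_right s)" using s(3) by (rule order_tendstoD)
    then obtain b where b: "b > s" "\<And>u. s < u \<Longrightarrow> u < b \<Longrightarrow> \<bar>y u - c\<bar> > l"
      by (auto simp: eventually_at_right_field)
    define e where "e = min (b - s) (a + h - s)"
    have e: "e > 0" using b sh by (auto simp: e_def)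
    obtain p where p: "h / e < 2 ^ p" using real_arch_pow[of 2 "h / e"] by auto
    have p': "h / 2 ^ p < e" using p e by (simp add: field_simps)
    define k where "k = nat \<lfloor>(s - a) * 2^p / h\<rfloor> + 1"
    have z: "0 \<le> (s - a) * 2^p / h" using s h by simp
    have k1: "real k \<le> (s - a) * 2^p / h + 1" "(s - a) * 2^p / h < real k"
      unfolding k_def using z by (auto simp: of_nat_floor le_of_int_ceiling) linarith
    have u1: "a + h * real k / 2^p \<le> s + h / 2^p" 
    proof -
      have "h / 2^p * real k \<le> h / 2^p * ((s - a) * 2^p / h + 1)" using k1(1) h by (intro mult_left_mono) auto
      also have "\<dots> = s - a + h / 2^p" using h by (simp add: distrib_left)
      finally show ?thesis by simp
    qed
    have u2: "s < a + h * real k / 2^p"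
    proof -
      have "s - a = h / 2^p * ((s - a) * 2^p / h)" using h by simp
      also have "\<dots> < h / 2^p * real k" using k1(2) h by (intro mult_strict_left_mono) auto
      finally show ?thesis by simp
    qed
    have u3: "a + h * real k / 2^p < b" "a + h * real k / 2^p < a + h" using u1 p' by (auto simp: e_def)
    have "k \<le> 2^p" using u3(2) h by (simp add: field_simps)
    then show ?thesis using b(2)[OF u2 u3(1)] by blast
  qed
next
  assume "\<exists>p::nat. \<exists>k\<le>2^p. \<bar>y (a + h * real k / 2^p) - c\<bar> > l"
  then obtain p k :: nat where pk: "k \<le> 2^p" "\<bar>y (a + h * real k / 2^p) - c\<bar> > l" by blast
  have "real k \<le> 2^p" using pk(1) by (metis of_nat_le_iff of_nat_numeral of_nat_power)
  then have "h * real k / 2^p \<le> h" "0 \<le> h * real k / 2^p" using h by (simp_all add: field_simps)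
  then show "\<exists>s\<in>{a..a+h}. \<bar>y s - c\<bar> > l" using pk(2) by (intro bexI[of _ "a + h * real k / 2^p"]) auto
qed

text \<open>The value at negative times is \<^const>\<open>undefined\<close>, as required of members of \<^const>\<open>cadlag_space\<close>.\<close>

definition half_line_path :: "(real \<Rightarrow> 'a \<Rightarrow> real) \<Rightarrow> 'a \<Rightarrow> real \<Rightarrow> real" where
  "half_line_path X \<omega> = (\<lambda>t\<in>{0..}. X t \<omega>)"

lemma half_line_path_tendsto_right:
  assumes "0 \<le> t"
  shows "(half_line_path X \<omega> \<longlongrightarrow> l) (at_right t) \<longleftrightarrow> ((\<lambda>s. X s \<omega>) \<longlongrightarrow> l) (at_right t)"
proof (rule tendsto_cong)
  show "eventually (\<lambda>s. half_line_path X \<omega> s = X s \<omega>) (at_right t)"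
    unfolding eventually_at_right_field half_line_path_def using assms by (intro exI[of _ "t + 1"]) auto
qed

lemma half_line_path_tendsto_left:
  assumes "0 < t"
  shows "(half_line_path X \<omega> \<longlongrightarrow> l) (at_left t) \<longleftrightarrow> ((\<lambda>s. X s \<omega>) \<longlongrightarrow> l) (at_left t)"
proof (rule tendsto_cong)
  show "eventually (\<lambda>s. half_line_path X \<omega> s = X s \<omega>) (at_left t)"
    unfolding eventually_at_left_field half_line_path_def using assms by (intro exI[of _ 0]) auto
qed

lemma half_line_path_cadlag_iff:
  "half_line_path X \<omega> \<in> cadlag_space \<longleftrightarrow>
    (\<forall>t\<ge>0. ((\<lambda>s. X s \<omega>) \<longlongrightarrow> X t \<omega>) (at_right t)) \<and> (\<forall>t>0. \<exists>l. ((\<lambda>s. X s \<omega>) \<longlongrightarrow> l) (at_left t))"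
proof -
  have "half_line_path X \<omega> \<in> extensional {0..}" "\<And>t. 0 \<le> t \<Longrightarrow> half_line_path X \<omega> t = X t \<omega>"
    by (auto simp: half_line_path_def)
  then show ?thesis
    by (simp add: cadlag_space_def half_line_path_tendsto_right half_line_path_tendsto_left)
qed

text \<open>Cadlag processes with independent increments, drift \<open>m\<close> and variance at most \<open>v\<close> per unit of time.
The variance is bounded, not prescribed, so that one \<open>v\<close> serves a whole sequence of processes.\<close>

locale drift_process = prob_space M for M :: "'a measure" +
  fixes X :: "real \<Rightarrow> 'a \<Rightarrow> real" and m v :: real
  assumes X_measurable: "\<And>t. 0 \<le> t \<Longrightarrow> X t \<in> borel_measurable M"
    and X_0: "\<And>\<omega>. \<omega> \<in> space M \<Longrightarrow> X 0 \<omega> = 0"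
    and path_cadlag: "\<And>\<omega>. \<omega> \<in> space M \<Longrightarrow> half_line_path X \<omega> \<in> cadlag_space"
    and indep_incr: "indep_increments M X"
    and sq_integrable: "\<And>s t. 0 \<le> s \<Longrightarrow> s < t \<Longrightarrow> integrable M (\<lambda>\<omega>. (X t \<omega> - X s \<omega> - m * (t - s))\<^sup>2)"
    and sq_le: "\<And>s t. 0 \<le> s \<Longrightarrow> s < t \<Longrightarrow> expectation (\<lambda>\<omega>. (X t \<omega> - X s \<omega> - m * (t - s))\<^sup>2) \<le> v * (t - s)"
begin

lemma right_cont:
  assumes "\<omega> \<in> space M" "0 \<le> t"
  shows "((\<lambda>s. X s \<omega>) \<longlongrightarrow> X t \<omega>) (at_right t)"
  using path_cadlag[OF assms(1)] assms(2) by (simp add: half_line_path_cadlag_iff)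

definition centred :: "real \<Rightarrow> 'a \<Rightarrow> real" where
  "centred t \<omega> = X t \<omega> - m * t"

lemma centred_measurable: "0 \<le> t \<Longrightarrow> centred t \<in> borel_measurable M"
  unfolding centred_def using X_measurable by measurable

lemma v_nonneg: "0 \<le> v"
proof -
  have "0 \<le> expectation (\<lambda>\<omega>. (X 1 \<omega> - X 0 \<omega> - m * (1 - 0))\<^sup>2)" by simp
  also have "\<dots> \<le> v * (1 - 0)" by (rule sq_le) auto
  finally show ?thesis by simp
qed

lemma centred_chebyshev:
  assumes st: "0 \<le> s" "s \<le> t" and l: "0 < l"
  shows "prob {\<omega>\<in>space M. \<bar>centred t \<omega> - centred s \<omega>\<bar> > l} \<le> v * (t - s) / l\<^sup>2"
proof (cases "s = t")
  case True then show ?thesis using l by auto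
next
  case False
  then have st': "s < t" using st by simp
  have "prob {\<omega>\<in>space M. \<bar>centred t \<omega> - centred s \<omega>\<bar> > l}
    \<le> prob {\<omega>\<in>space M. (X t \<omega> - X s \<omega> - m * (t - s))\<^sup>2 \<ge> l\<^sup>2}"
  proof (intro finite_measure_mono)
    have [measurable]: "X s \<in> borel_measurable M" "X t \<in> borel_measurable M" using X_measurable st by auto
    show "{\<omega> \<in> space M. l\<^sup>2 \<le> (X t \<omega> - X s \<omega> - m * (t - s))\<^sup>2} \<in> sets M" by measurable
    have "l\<^sup>2 \<le> x\<^sup>2" if "\<bar>x\<bar> > l" for x :: real using that l by (simp add: abs_le_square_iff[symmetric])
    then show "{\<omega> \<in> space M. l < \<bar>centred t \<omega> - centred s \<omega>\<bar>} \<subseteq> {\<omega> \<in> space M. l\<^sup>2 \<le> (X t \<omega> - X s \<omega> - m * (t - s))\<^sup>2}"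
      by (auto simp: centred_def algebra_simps)
  qed
  also have "\<dots> \<le> expectation (\<lambda>\<omega>. (X t \<omega> - X s \<omega> - m * (t - s))\<^sup>2) / l\<^sup>2"
    using integral_Markov_inequality_measure[OF sq_integrable[OF st(1) st'], of "space M" "l\<^sup>2"] l by simp
  also have "\<dots> \<le> v * (t - s) / l\<^sup>2" using sq_le[OF st(1) st'] l by (intro divide_right_mono) auto
  finally show ?thesis .
qed

lemma centred_indep:
  assumes "0 \<le> t (0::nat)" "strict_mono_on {..n} t"
  shows "indep_vars (\<lambda>_. borel) (\<lambda>i \<omega>. centred (t (Suc i)) \<omega> - centred (t i) \<omega>) {..<n}"
proof -
  have "indep_vars (\<lambda>_. borel) (\<lambda>i \<omega>. X (t (Suc i)) \<omega> - X (t i) \<omega>) {..<n}"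
    using indep_incr assms unfolding indep_increments_def by blast
  from indep_vars_compose2[OF this, of "\<lambda>i x. x - m * (t (Suc i) - t i)" "\<lambda>_. borel"]
  show ?thesis by (simp add: centred_def algebra_simps)
qed

lemma centred_grid_maximal:
  fixes p :: nat
  assumes a: "0 \<le> a" and h: "0 < h" and l: "0 < l" and vh: "2 * v * h \<le> l\<^sup>2"
  shows "prob {\<omega>\<in>space M. \<exists>k\<le>2^p. \<bar>centred (a + h * real k / 2^p) \<omega> - centred a \<omega>\<bar> > 2 * l}
    \<le> 2 * prob {\<omega>\<in>space M. \<bar>centred (a + h) \<omega> - centred a \<omega>\<bar> > l}"
proof -
  let ?t = "\<lambda>k::nat. a + h * real k / 2^p"
  have sm: "strict_mono_on {..2^p} ?t" using h
    by (intro strict_mono_onI) (simp add: divide_strict_right_mono)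
  have nn: "0 \<le> ?t k" for k using a h by simp
  have "prob {\<omega>\<in>space M. \<bar>centred (?t (2^p)) \<omega> - centred (?t k) \<omega>\<bar> > l} \<le> 1/2" if k: "k \<le> 2^p" for k
  proof -
    have hk: "?t k \<le> ?t (2^p)" using k h by (simp add: field_simps)
    have "prob {\<omega>\<in>space M. \<bar>centred (?t (2^p)) \<omega> - centred (?t k) \<omega>\<bar> > l} \<le> v * (?t (2^p) - ?t k) / l\<^sup>2"
      using centred_chebyshev[OF nn[of k] hk l] .
    also have "\<dots> \<le> v * h / l\<^sup>2"
      using h v_nonneg l by (intro divide_right_mono mult_left_mono) auto
    also have "\<dots> \<le> 1/2" using vh l by (simp add: field_simps)
    finally show ?thesis .
  qed
  from ottaviani_inequality[of "\<lambda>k. centred (?t k)" "2^p", OF centred_indep[of ?t "2^p", OF nn sm] centred_measurable[OF nn] this]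
  show ?thesis by simp
qed

lemma centred_right_cont:
  assumes "\<omega> \<in> space M" "0 \<le> t"
  shows "((\<lambda>s. centred s \<omega>) \<longlongrightarrow> centred t \<omega>) (at_right t)"
  unfolding centred_def by (intro tendsto_intros right_cont assms)

text \<open>The dyadic grids are nested, so the exceedance events on them increase to the one in real time,
and the grid bound passes to the limit.\<close>

lemma centred_maximal:
  assumes a: "0 \<le> a" and h: "0 < h" and l: "0 < l" and vh: "2 * v * h \<le> l\<^sup>2"
  shows "{\<omega>\<in>space M. \<exists>s\<in>{a..a+h}. \<bar>centred s \<omega> - centred a \<omega>\<bar> > 2 * l} \<in> sets M" (is "?E \<in> _")
    and "prob {\<omega>\<in>space M. \<exists>s\<in>{a..a+h}. \<bar>centred s \<omega> - centred a \<omega>\<bar> > 2 * l}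
      \<le> 2 * prob {\<omega>\<in>space M. \<bar>centred (a + h) \<omega> - centred a \<omega>\<bar> > l}"
proof -
  define G where "G p = {\<omega>\<in>space M. \<exists>k\<in>{..2^p}. \<bar>centred (a + h * real k / 2^p) \<omega> - centred a \<omega>\<bar> > 2 * l}" for p :: nat
  have E: "?E = (\<Union>p. G p)"
  proof -
    have "(\<exists>s\<in>{a..a+h}. \<bar>centred s \<omega> - centred a \<omega>\<bar> > 2 * l) \<longleftrightarrow> (\<exists>p::nat. \<exists>k\<le>2^p. \<bar>centred (a + h * real k / 2^p) \<omega> - centred a \<omega>\<bar> > 2 * l)"
      if "\<omega> \<in> space M" for \<omega>
      using a by (intro exceedance_iff_dyadic centred_right_cont that h) auto
    then show ?thesis unfolding G_def Bex_def[of "{..2^p}" for p] atMost_iff by blast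
  qed
  have G[measurable]: "G p \<in> sets M" for p
  proof -
    have "a + h * real k / 2^p \<ge> 0" for k using a h by simp
    note [measurable] = centred_measurable[OF this] centred_measurable[OF a]
    show ?thesis unfolding G_def by (intro sets.sets_Collect_finite_Ex) auto
  qed
  have "incseq G"
  proof (rule incseq_SucI)
    fix p show "G p \<le> G (Suc p)"
    proof
      fix \<omega> assume "\<omega> \<in> G p"
      then obtain k where k: "\<omega> \<in> space M" "k \<le> 2^p" "\<bar>centred (a + h * real k / 2^p) \<omega> - centred a \<omega>\<bar> > 2 * l"
        by (auto simp: G_def)
      have "h * real (2 * k) / 2^Suc p = h * real k / 2^p" by simp
      then show "\<omega> \<in> G (Suc p)" using k unfolding G_def by (auto intro!: bexI[of _ "2 * k"])
    qed
  qed
  then have "(\<lambda>p. prob (G p)) \<longlonglongrightarrow> prob ?E" unfolding E by (intro finite_Lim_measure_incseq) auto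
  then show "prob ?E \<le> 2 * prob {\<omega>\<in>space M. \<bar>centred (a + h) \<omega> - centred a \<omega>\<bar> > l}"
    using centred_grid_maximal[OF a h l vh] unfolding G_def
    by (elim LIMSEQ_le_const2) (auto simp: Bex_def)
  show "?E \<in> sets M" unfolding E by auto
qed

text \<open>Where the hypothesis of the maximal inequality on \<open>h\<close> and \<open>l\<close> fails, the claimed bound exceeds 1.\<close>

lemma centred_kolmogorov:
  assumes h: "0 < h" and l: "0 < l"
  obtains E where "E \<in> sets M" "prob E \<le> 2 * v * h / l\<^sup>2"
    "\<And>\<omega> s. \<omega> \<in> space M \<Longrightarrow> \<omega> \<notin> E \<Longrightarrow> 0 \<le> s \<Longrightarrow> s \<le> h \<Longrightarrow> \<bar>centred s \<omega>\<bar> \<le> 2 * l"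
proof (cases "2 * v * h \<le> l\<^sup>2")
  case True
  let ?E = "{\<omega>\<in>space M. \<exists>s\<in>{0..0+h}. \<bar>centred s \<omega> - centred 0 \<omega>\<bar> > 2 * l}"
  have Y0: "centred 0 \<omega> = 0" if "\<omega> \<in> space M" for \<omega> using X_0[OF that] by (simp add: centred_def)
  have "prob ?E \<le> 2 * prob {\<omega>\<in>space M. \<bar>centred (0 + h) \<omega> - centred 0 \<omega>\<bar> > l}"
    by (rule centred_maximal[OF _ h l True]) simp
  also have "\<dots> \<le> 2 * (v * h / l\<^sup>2)" using centred_chebyshev[of 0 "0+h" l] h l by (intro mult_left_mono) auto
  finally show ?thesis using centred_maximal(1)[OF _ h l True, of 0] Y0
    by (intro that[of ?E]) (auto simp: not_less)
next
  case False
  then have "1 \<le> 2 * v * h / l\<^sup>2" using l by (simp add: field_simps)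
  then show ?thesis using prob_space by (intro that[of "space M"]) auto
qed

text \<open>On \<open>[0, C]\<close> the centred process is at least \<open>- C\<close>, and on the block
\<open>[2\<^sup>k C, 2\<^sup>k\<^sup>+\<^sup>1 C]\<close> its modulus is at most \<open>m 2\<^sup>k C / 2 \<le> m s / 2\<close>. The exceptional
probabilities of the blocks are of order \<open>2\<^sup>-\<^sup>k / C\<close>, hence summable.\<close>

lemma linear_lower_bound:
  assumes m: "0 < m" and C: "0 < C"
  obtains E where "E \<in> sets M" "prob E \<le> (8 + 128 / m\<^sup>2) * v / C"
    "\<And>\<omega> s. \<omega> \<in> space M \<Longrightarrow> \<omega> \<notin> E \<Longrightarrow> 0 \<le> s \<Longrightarrow> m * s / 2 - C \<le> X s \<omega>"
proof -
  obtain E0 where E0: "E0 \<in> sets M" "prob E0 \<le> 2 * v * C / (C/2)\<^sup>2"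
    "\<And>\<omega> s. \<omega> \<in> space M \<Longrightarrow> \<omega> \<notin> E0 \<Longrightarrow> 0 \<le> s \<Longrightarrow> s \<le> C \<Longrightarrow> \<bar>centred s \<omega>\<bar> \<le> 2 * (C/2)"
    using centred_kolmogorov[of C "C/2"] C by auto
  have "\<exists>E. E \<in> sets M \<and> prob E \<le> 2 * v * (2^Suc k * C) / (m * 2^k * C / 4)\<^sup>2 \<and>
    (\<forall>\<omega>\<in>space M. \<forall>s. \<omega> \<notin> E \<longrightarrow> 0 \<le> s \<longrightarrow> s \<le> 2^Suc k * C \<longrightarrow> \<bar>centred s \<omega>\<bar> \<le> 2 * (m * 2^k * C / 4))" for k :: nat
    using centred_kolmogorov[of "2^Suc k * C" "m * 2^k * C / 4"] C m by (metis mult_pos_pos zero_less_divide_iff zero_less_numeral zero_less_power)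
  then obtain F where F: "\<And>k. F k \<in> sets M" "\<And>k. prob (F k) \<le> 2 * v * (2^Suc k * C) / (m * 2^k * C / 4)\<^sup>2"
    "\<And>k \<omega> s. \<omega> \<in> space M \<Longrightarrow> \<omega> \<notin> F k \<Longrightarrow> 0 \<le> s \<Longrightarrow> s \<le> 2^Suc k * C \<Longrightarrow> \<bar>centred s \<omega>\<bar> \<le> 2 * (m * 2^k * C / 4)"
    by metis
  have Fb: "prob (F k) \<le> 64 * v / (m\<^sup>2 * C) * (1/2)^k" for k
  proof -
    have "2 * v * (2^Suc k * C) / (m * 2^k * C / 4)\<^sup>2 = 64 * v / (m\<^sup>2 * C) * (1/2)^k"
      using C m by (simp add: field_simps power2_eq_square)
    then show ?thesis using F(2)[of k] by simp
  qed
  have sF: "summable (\<lambda>k. 64 * v / (m\<^sup>2 * C) * (1/2::real)^k)"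
    by (intro summable_mult summable_geometric) simp
  have sumF: "summable (\<lambda>k. prob (F k))"
    using Fb by (intro summable_comparison_test[OF _ sF]) auto
  have "prob (\<Union>k. F k) \<le> (\<Sum>k. prob (F k))"
    using F(1) sumF by (intro finite_measure_subadditive_countably) auto
  also have "\<dots> \<le> (\<Sum>k. 64 * v / (m\<^sup>2 * C) * (1/2)^k)" by (intro suminf_le Fb sumF sF)
  also have "\<dots> = 128 * v / (m\<^sup>2 * C)"
    by (subst suminf_mult) (auto simp: suminf_geometric)
  finally have UF: "prob (\<Union>k. F k) \<le> 128 * v / (m\<^sup>2 * C)" .
  have "prob (E0 \<union> (\<Union>k. F k)) \<le> prob E0 + prob (\<Union>k. F k)"
    using E0 F by (intro measure_Un_le) auto
  also have "\<dots> \<le> 2 * v * C / (C/2)\<^sup>2 + 128 * v / (m\<^sup>2 * C)" using E0 UF by simp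
  also have "\<dots> = (8 + 128 / m\<^sup>2) * v / C" using C m by (simp add: field_simps power2_eq_square)
  finally have P: "prob (E0 \<union> (\<Union>k. F k)) \<le> (8 + 128 / m\<^sup>2) * v / C" .
  show ?thesis
  proof (rule that[OF _ P])
    show "E0 \<union> (\<Union>k. F k) \<in> sets M" using E0 F by auto
    fix \<omega> s assume w: "\<omega> \<in> space M" "\<omega> \<notin> E0 \<union> (\<Union>k. F k)" and s: "0 \<le> (s::real)"
    show "m * s / 2 - C \<le> X s \<omega>"
    proof (cases "s \<le> C")
      case True
      then have "\<bar>centred s \<omega>\<bar> \<le> C" using E0(3)[OF w(1) _ s True] w by auto
      moreover have "m * s / 2 \<le> m * s" using m s by simp
      ultimately show ?thesis unfolding centred_def by linarith
    next
      case False
      have ex: "\<exists>k. s \<le> 2^Suc k * C"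
      proof -
        obtain k where "s / C < 2^k" using real_arch_pow[of 2 "s / C"] by auto
        then have "s \<le> 2^k * C" using C by (simp add: field_simps)
        also have "\<dots> \<le> 2^Suc k * C" using C by simp
        finally show ?thesis by blast
      qed
      define k where "k = (LEAST k. s \<le> 2^Suc k * C)"
      have k: "s \<le> 2^Suc k * C" unfolding k_def by (rule LeastI_ex[OF ex])
      have k2: "2^k * C \<le> s"
      proof (cases k)
        case 0 then show ?thesis using False by simp
      next
        case (Suc j)
        then have "\<not> s \<le> 2^Suc j * C" using not_less_Least[of j "\<lambda>k. s \<le> 2^Suc k * C"] unfolding k_def by auto
        then show ?thesis using Suc by simp
      qed
      have "\<bar>centred s \<omega>\<bar> \<le> 2 * (m * 2^k * C / 4)" using F(3)[OF w(1) _ s k] w by auto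
      also have "\<dots> \<le> m * s / 2" using mult_left_mono[OF k2, of "m / 2"] m by (simp add: field_simps)
      finally show ?thesis using C unfolding centred_def by linarith
    qed
  qed
qed

end

section \<open>Lipschitz minorants and convergence of expectations\<close>

context Metric_space
begin

text \<open>For \<open>f \<ge> 0\<close> this is the largest \<open>L\<close>-Lipschitz function below \<open>f\<close>
(Moreau, Pasch and Hausdorff).\<close>

definition lip_minorant :: "real \<Rightarrow> ('a \<Rightarrow> real) \<Rightarrow> 'a \<Rightarrow> real" where
  "lip_minorant L f x = (INF y\<in>M. f y + L * d x y)"

context
  fixes f :: "'a \<Rightarrow> real" and L :: real
  assumes f_nonneg: "\<And>y. y \<in> M \<Longrightarrow> 0 \<le> f y" and L_nonneg: "0 \<le> L"
begin

lemma lip_minorant_bdd: "bdd_below ((\<lambda>y. f y + L * d x y) ` M)"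
  using f_nonneg L_nonneg by (intro bdd_belowI2[of _ 0]) simp

lemma lip_minorant_le_at: "y \<in> M \<Longrightarrow> lip_minorant L f x \<le> f y + L * d x y"
  unfolding lip_minorant_def by (intro cINF_lower lip_minorant_bdd)

lemma lip_minorant_le: "x \<in> M \<Longrightarrow> lip_minorant L f x \<le> f x"
  using lip_minorant_le_at[of x x] by simp

lemma lip_minorant_nonneg: "x \<in> M \<Longrightarrow> 0 \<le> lip_minorant L f x"
  unfolding lip_minorant_def using f_nonneg L_nonneg by (intro cINF_greatest) auto

lemma lip_minorant_step:
  assumes "x \<in> M" "y \<in> M" shows "lip_minorant L f x \<le> lip_minorant L f y + L * d x y"
proof -
  have "lip_minorant L f x - L * d x y \<le> lip_minorant L f y"
    unfolding lip_minorant_def[of L f y]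
  proof (rule cINF_greatest)
    fix z assume z: "z \<in> M"
    have "L * d x z \<le> L * (d x y + d y z)" using triangle[OF assms z] L_nonneg by (intro mult_left_mono) auto
    then show "lip_minorant L f x - L * d x y \<le> f z + L * d y z"
      using lip_minorant_le_at[OF z, of x] by (simp add: algebra_simps)
  qed (use assms in auto)
  then show ?thesis by simp
qed

lemma lip_minorant_lipschitz:
  assumes "x \<in> M" "y \<in> M" shows "\<bar>lip_minorant L f x - lip_minorant L f y\<bar> \<le> L * d x y"
  using lip_minorant_step[OF assms] lip_minorant_step[OF assms(2,1)] commute[of x y] by (simp add: abs_le_iff)

end

text \<open>In the infimum that defines the minorant at \<open>x\<close>, points of a small ball around \<open>x\<close> contribute nearly
\<open>f x\<close> by continuity, and outside the ball the penalty \<open>k * d x y\<close> alone exceeds \<open>f x\<close> once \<open>k\<close> is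
large. The
points \<open>z k\<close> have to approach \<open>x\<close> faster than \<open>1 / k\<close>, as the \<open>k\<close>-th minorant is only
\<open>k\<close>-Lipschitz.\<close>

lemma lip_minorant_tendsto:
  assumes f: "continuous_map mtopology euclideanreal f" and nn: "\<And>y. y \<in> M \<Longrightarrow> 0 \<le> f y"
    and x: "x \<in> M" and z: "\<And>k. z k \<in> M" and lim: "(\<lambda>k. real k * d x (z k)) \<longlonglongrightarrow> 0"
  shows "(\<lambda>k. lip_minorant (real k) f (z k)) \<longlonglongrightarrow> f x"
proof (rule LIMSEQ_I)
  fix e :: real assume e: "0 < e"
  have "f ` M \<subseteq> UNIV \<and> (\<forall>a\<in>M. \<forall>e>0. \<exists>r>0. \<forall>y. y \<in> M \<and> d a y < r \<longrightarrow> dist (f a) (f y) < e)"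
    using f metric_continuous_map[OF Met_TC.Metric_space_axioms, of f] by simp
  then obtain r where r: "0 < r" "\<And>y. y \<in> M \<Longrightarrow> d x y < r \<Longrightarrow> \<bar>f x - f y\<bar> < e / 2"
    using x e unfolding dist_real_def by (meson half_gt_zero)
  have "eventually (\<lambda>k. real k * d x (z k) < e / 2) sequentially" "eventually (\<lambda>k. real k * d x (z k) < r) sequentially"
    using order_tendstoD(2)[OF lim, of "e / 2"] order_tendstoD(2)[OF lim, of r] e r(1) by auto
  moreover have "eventually (\<lambda>k. f x / r \<le> real k) sequentially" "eventually (\<lambda>k. k \<ge> (1::nat)) sequentially"
    using eventually_ge_at_top filterlim_real_sequentially unfolding filterlim_at_top by blast+
  ultimately have "eventually (\<lambda>k. \<bar>lip_minorant (real k) f (z k) - f x\<bar> < e) sequentially"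
  proof eventually_elim
    fix k :: nat assume k: "real k * d x (z k) < e / 2" "real k * d x (z k) < r" "f x / r \<le> real k" "1 \<le> k"
    have "d x (z k) \<le> real k * d x (z k)" using k(4) nonneg[of x "z k"] mult_right_mono[of 1 "real k" "d x (z k)"] by simp
    then have dz: "d x (z k) < r" using k by simp
    have "lip_minorant (real k) f (z k) \<le> f (z k)" by (intro lip_minorant_le nn z) auto
    also have "\<dots> < f x + e / 2" using r(2)[OF z dz] by linarith
    finally have up: "lip_minorant (real k) f (z k) < f x + e / 2" .
    have "f x - e / 2 \<le> lip_minorant (real k) f x"
      unfolding lip_minorant_def
    proof (rule cINF_greatest)
      fix y assume y: "y \<in> M"
      show "f x - e / 2 \<le> f y + real k * d x y"
      proof (cases "d x y < r")
        case True
        have "0 \<le> real k * d x y" by simp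
        then show ?thesis using r(2)[OF y True] by linarith
      next
        case False
        have "f x \<le> real k * r" using k(3) r(1) by (simp add: field_simps)
        also have "\<dots> \<le> real k * d x y" using False by (intro mult_left_mono) auto
        finally show ?thesis using nn[OF y] e by simp
      qed
    qed (use x in auto)
    moreover have "lip_minorant (real k) f x \<le> lip_minorant (real k) f (z k) + real k * d x (z k)"
      by (intro lip_minorant_step nn x z) auto
    ultimately show "\<bar>lip_minorant (real k) f (z k) - f x\<bar> < e" using up k(1) e by linarith
  qed
  then show "\<exists>no. \<forall>n\<ge>no. norm (lip_minorant (real n) f (z n) - f x) < e"
    by (simp add: eventually_sequentially)
qed

text \<open>Weak convergence of approximations \<open>A k n\<close> to \<open>A' k\<close>, tested on Lipschitz functions, transfers to the
approximated elements \<open>Z n\<close> and \<open>Z'\<close>. The minorants are composed with the approximations only,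
where they are measurable, and the Borel-Cantelli lemma makes the approximations of the limit converge almost
surely. Exceptional events are given
existentially, because the distance of \<open>Z n\<close> from \<open>A k n\<close> need not be measurable.\<close>

lemma expectation_liminf_by_approximation:
  fixes P :: "nat \<Rightarrow> 'w measure" and P' :: "'v measure"
    and A :: "nat \<Rightarrow> nat \<Rightarrow> 'w \<Rightarrow> 'a" and A' :: "nat \<Rightarrow> 'v \<Rightarrow> 'a"
  assumes P: "\<And>n. prob_space (P n)" and P': "prob_space P'"
    and Z: "\<And>n \<omega>. \<omega> \<in> space (P n) \<Longrightarrow> Z n \<omega> \<in> M" and Z': "\<And>\<omega>. \<omega> \<in> space P' \<Longrightarrow> Z' \<omega> \<in> M"
    and A: "\<And>k n \<omega>. \<omega> \<in> space (P n) \<Longrightarrow> A k n \<omega> \<in> M" and A': "\<And>k \<omega>. \<omega> \<in> space P' \<Longrightarrow> A' k \<omega> \<in> M"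
    and Lip: "\<And>k g L B. (\<And>x y. x \<in> M \<Longrightarrow> y \<in> M \<Longrightarrow> \<bar>g x - g y\<bar> \<le> L * d x y) \<Longrightarrow> (\<And>x. x \<in> M \<Longrightarrow> \<bar>g x\<bar> \<le> B) \<Longrightarrow>
        (\<forall>n. (\<lambda>\<omega>. g (A k n \<omega>)) \<in> borel_measurable (P n)) \<and> (\<lambda>\<omega>. g (A' k \<omega>)) \<in> borel_measurable P' \<and>
        (\<lambda>n. \<integral>\<omega>. g (A k n \<omega>) \<partial>P n) \<longlonglongrightarrow> (\<integral>\<omega>. (g (A' k \<omega>) :: real) \<partial>P')"
    and near: "\<And>k. \<forall>\<^sub>F n in sequentially. \<exists>E\<in>sets (P n). measure (P n) E \<le> (1/2)^k \<and>
        (\<forall>\<omega>\<in>space (P n) - E. d (Z n \<omega>) (A k n \<omega>) \<le> (1/2)^k)"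
    and near': "\<And>k. \<exists>E\<in>sets P'. measure P' E \<le> (1/2)^k \<and> (\<forall>\<omega>\<in>space P' - E. d (Z' \<omega>) (A' k \<omega>) \<le> (1/2)^k)"
    and f: "continuous_map mtopology euclideanreal f"
    and fZ: "\<And>n. (\<lambda>\<omega>. f (Z n \<omega>)) \<in> borel_measurable (P n)" and fZ': "(\<lambda>\<omega>. f (Z' \<omega>)) \<in> borel_measurable P'"
    and f_nonneg: "\<And>x. x \<in> M \<Longrightarrow> 0 \<le> f x" and f_le: "\<And>x. x \<in> M \<Longrightarrow> f x \<le> B"
    and e: "0 < e"
  shows "\<forall>\<^sub>F n in sequentially. (\<integral>\<omega>. f (Z' \<omega>) \<partial>P') - e < (\<integral>\<omega>. f (Z n \<omega>) \<partial>P n)"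
proof -
  interpret P': prob_space P' by (rule P')
  \<comment> \<open>The approximation error \<open>(1/2)^k\<close> beats the Lipschitz constant \<open>k\<close>.\<close>
  define F where "F k = lip_minorant (real k) f" for k :: nat
  have F_nonneg: "0 \<le> F k x" and F_le_f: "F k x \<le> f x" if "x \<in> M" for k x
    unfolding F_def using that f_nonneg by (auto intro: lip_minorant_nonneg lip_minorant_le)
  have F_le: "F k x \<le> B" if "x \<in> M" for k x using F_le_f[OF that] f_le[OF that] by (rule order_trans)
  have F_lip: "\<bar>F k x - F k y\<bar> \<le> real k * d x y" if "x \<in> M" "y \<in> M" for k x y
    unfolding F_def using that f_nonneg by (auto intro: lip_minorant_lipschitz)
  have "\<bar>F k x\<bar> \<le> B" if "x \<in> M" for k x using F_nonneg[OF that] F_le[OF that] by simp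
  note FL = Lip[of "F k" "real k" B for k, OF F_lip this]
  have FA: "(\<lambda>\<omega>. F k (A k n \<omega>)) \<in> borel_measurable (P n)" and FA': "(\<lambda>\<omega>. F k (A' k \<omega>)) \<in> borel_measurable P'"
    and Flim: "(\<lambda>n. \<integral>\<omega>. F k (A k n \<omega>) \<partial>P n) \<longlonglongrightarrow> (\<integral>\<omega>. F k (A' k \<omega>) \<partial>P')" for k n
    using FL by auto
  have pow0: "(\<lambda>k. real k * (1/2)^k) \<longlonglongrightarrow> 0"
    using powser_times_n_limit_0[of "1/2::real"] by simp
  have c: "(\<lambda>k. \<integral>\<omega>. F k (A' k \<omega>) \<partial>P') \<longlonglongrightarrow> (\<integral>\<omega>. f (Z' \<omega>) \<partial>P')"
  proof (rule integral_dominated_convergence[where w="\<lambda>_. B"])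
    obtain E where E: "\<And>k. E k \<in> sets P'" "\<And>k. measure P' (E k) \<le> (1/2)^k"
      "\<And>k \<omega>. \<omega> \<in> space P' - E k \<Longrightarrow> d (Z' \<omega>) (A' k \<omega>) \<le> (1/2)^k"
      using near' by metis
    have "AE \<omega> in P'. eventually (\<lambda>k. \<omega> \<in> space P' - E k) sequentially"
    proof (rule borel_cantelli_AE1[OF E(1)])
      show "summable (\<lambda>k. measure P' (E k))"
        using E(2) by (intro summable_comparison_test[OF _ summable_geometric[of "1/2::real"]]) auto
    qed (simp add: P'.emeasure_eq_measure)
    then show "AE \<omega> in P'. (\<lambda>k. F k (A' k \<omega>)) \<longlonglongrightarrow> f (Z' \<omega>)"
    proof (rule AE_mp, intro AE_I2 impI)
      fix \<omega> assume w: "\<omega> \<in> space P'" and ev: "eventually (\<lambda>k. \<omega> \<in> space P' - E k) sequentially"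
      have "eventually (\<lambda>k. real k * d (Z' \<omega>) (A' k \<omega>) \<le> real k * (1/2)^k) sequentially"
        using ev by eventually_elim (intro mult_left_mono E(3), auto)
      then have "(\<lambda>k. real k * d (Z' \<omega>) (A' k \<omega>)) \<longlonglongrightarrow> 0"
        by (intro tendsto_sandwich[OF _ _ tendsto_const pow0]) auto
      then show "(\<lambda>k. F k (A' k \<omega>)) \<longlonglongrightarrow> f (Z' \<omega>)"
        unfolding F_def using Z'[OF w] A'[OF w] by (intro lip_minorant_tendsto f f_nonneg)
    qed
  qed (use fZ' FA' F_nonneg F_le A' in auto)
  have "(\<lambda>k. real k * (1/2)^k + B * (1/2)^k) \<longlonglongrightarrow> 0 + B * 0"
    by (intro tendsto_intros pow0) auto
  then have "eventually (\<lambda>k. real k * (1/2)^k + B * (1/2)^k < e / 3) sequentially"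
    using e by (intro order_tendstoD(2)[where y=0]) auto
  moreover have "eventually (\<lambda>k. (\<integral>\<omega>. f (Z' \<omega>) \<partial>P') - e / 3 < (\<integral>\<omega>. F k (A' k \<omega>) \<partial>P')) sequentially"
    using e by (intro order_tendstoD(1)[OF c]) auto
  ultimately have "eventually (\<lambda>k. real k * (1/2)^k + B * (1/2)^k < e / 3 \<and>
      (\<integral>\<omega>. f (Z' \<omega>) \<partial>P') - e / 3 < (\<integral>\<omega>. F k (A' k \<omega>) \<partial>P')) sequentially" by eventually_elim simp
  then obtain k where k: "real k * (1/2)^k + B * (1/2)^k < e / 3"
      "(\<integral>\<omega>. f (Z' \<omega>) \<partial>P') - e / 3 < (\<integral>\<omega>. F k (A' k \<omega>) \<partial>P')"
    by (auto simp: eventually_sequentially)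
  have "eventually (\<lambda>n. (\<integral>\<omega>. F k (A' k \<omega>) \<partial>P') - e / 3 < (\<integral>\<omega>. F k (A k n \<omega>) \<partial>P n)) sequentially"
    using e by (intro order_tendstoD(1)[OF Flim]) auto
  with near[of k] show ?thesis
  proof eventually_elim
    case (elim n)
    interpret Pn: prob_space "P n" by (rule P)
    obtain E where E: "E \<in> sets (P n)" "measure (P n) E \<le> (1/2)^k"
      "\<And>\<omega>. \<omega> \<in> space (P n) - E \<Longrightarrow> d (Z n \<omega>) (A k n \<omega>) \<le> (1/2)^k" using elim(1) by blast
    have B: "0 \<le> B"
    proof -
      obtain \<omega> where "\<omega> \<in> space P'" using P'.not_empty by blast
      then show ?thesis using f_nonneg[OF Z'] f_le[OF Z'] by (blast intro: order_trans)
    qed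
    have iF: "integrable (P n) (\<lambda>\<omega>. F k (A k n \<omega>))"
      using F_nonneg[OF A] F_le[OF A] by (intro Pn.integrable_const_bound[of _ B] FA) (auto simp: abs_le_iff)
    have if': "integrable (P n) (\<lambda>\<omega>. f (Z n \<omega>))"
      using f_nonneg[OF Z] f_le[OF Z] by (intro Pn.integrable_const_bound[of _ B] fZ) (auto simp: abs_le_iff)
    have iE: "integrable (P n) (\<lambda>\<omega>. B * indicator E \<omega>)"
      using E(1) by (intro integrable_mult_right integrable_real_indicator) (auto simp: Pn.emeasure_eq_measure)
    have "(\<integral>\<omega>. F k (A k n \<omega>) \<partial>P n) - real k * (1/2)^k - B * measure (P n) E
      = (\<integral>\<omega>. F k (A k n \<omega>) - real k * (1/2)^k - B * indicator E \<omega> \<partial>P n)"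
      using iF iE E(1) by (simp add: Pn.prob_space)
    also have "\<dots> \<le> (\<integral>\<omega>. f (Z n \<omega>) \<partial>P n)"
    proof (rule integral_mono)
      fix \<omega> assume w: "\<omega> \<in> space (P n)"
      show "F k (A k n \<omega>) - real k * (1/2)^k - B * indicator E \<omega> \<le> f (Z n \<omega>)"
      proof (cases "\<omega> \<in> E")
        case True
        have "0 \<le> real k * (1/2)^k" by simp
        moreover have "B * indicator E \<omega> = B" using True by simp
        ultimately show ?thesis using F_le[OF A[OF w], of k k] f_nonneg[OF Z[OF w]] by linarith
      next
        case False
        have "real k * d (Z n \<omega>) (A k n \<omega>) \<le> real k * (1/2)^k" using E(3) w False by (intro mult_left_mono) auto
        then show ?thesis using False F_lip[OF Z[OF w] A[OF w], of k k] F_le_f[OF Z[OF w], of k] by (simp add: abs_le_iff)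
      qed
    qed (use iF iE if' in auto)
    finally have 1: "(\<integral>\<omega>. F k (A k n \<omega>) \<partial>P n) - real k * (1/2)^k - B * measure (P n) E \<le> (\<integral>\<omega>. f (Z n \<omega>) \<partial>P n)" .
    have "B * measure (P n) E \<le> B * (1/2)^k" using E(2) B by (intro mult_left_mono) auto
    then show ?case using 1 k elim(2) by linarith
  qed
qed

text \<open>The one-sided bound is applied to \<open>f + B\<close> and to \<open>B - f\<close>.\<close>

lemma expectation_tendsto_by_approximation:
  fixes P :: "nat \<Rightarrow> 'w measure" and P' :: "'v measure"
    and A :: "nat \<Rightarrow> nat \<Rightarrow> 'w \<Rightarrow> 'a" and A' :: "nat \<Rightarrow> 'v \<Rightarrow> 'a"
  assumes P: "\<And>n. prob_space (P n)" and P': "prob_space P'"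
    and Z: "\<And>n \<omega>. \<omega> \<in> space (P n) \<Longrightarrow> Z n \<omega> \<in> M" and Z': "\<And>\<omega>. \<omega> \<in> space P' \<Longrightarrow> Z' \<omega> \<in> M"
    and A: "\<And>k n \<omega>. \<omega> \<in> space (P n) \<Longrightarrow> A k n \<omega> \<in> M" and A': "\<And>k \<omega>. \<omega> \<in> space P' \<Longrightarrow> A' k \<omega> \<in> M"
    and Lip: "\<And>k g L B. (\<And>x y. x \<in> M \<Longrightarrow> y \<in> M \<Longrightarrow> \<bar>g x - g y\<bar> \<le> L * d x y) \<Longrightarrow> (\<And>x. x \<in> M \<Longrightarrow> \<bar>g x\<bar> \<le> B) \<Longrightarrow>
        (\<forall>n. (\<lambda>\<omega>. g (A k n \<omega>)) \<in> borel_measurable (P n)) \<and> (\<lambda>\<omega>. g (A' k \<omega>)) \<in> borel_measurable P' \<and>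
        (\<lambda>n. \<integral>\<omega>. g (A k n \<omega>) \<partial>P n) \<longlonglongrightarrow> (\<integral>\<omega>. (g (A' k \<omega>) :: real) \<partial>P')"
    and near: "\<And>k. \<forall>\<^sub>F n in sequentially. \<exists>E\<in>sets (P n). measure (P n) E \<le> (1/2)^k \<and>
        (\<forall>\<omega>\<in>space (P n) - E. d (Z n \<omega>) (A k n \<omega>) \<le> (1/2)^k)"
    and near': "\<And>k. \<exists>E\<in>sets P'. measure P' E \<le> (1/2)^k \<and> (\<forall>\<omega>\<in>space P' - E. d (Z' \<omega>) (A' k \<omega>) \<le> (1/2)^k)"
    and f: "continuous_map mtopology euclideanreal f"
    and fZ: "\<And>n. (\<lambda>\<omega>. f (Z n \<omega>)) \<in> borel_measurable (P n)" and fZ': "(\<lambda>\<omega>. f (Z' \<omega>)) \<in> borel_measurable P'"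
    and bdd: "bounded (f ` M)"
  shows "(\<lambda>n. \<integral>\<omega>. f (Z n \<omega>) \<partial>P n) \<longlonglongrightarrow> (\<integral>\<omega>. f (Z' \<omega>) \<partial>P')"
proof -
  obtain B where B: "\<And>x. x \<in> M \<Longrightarrow> \<bar>f x\<bar> \<le> B" using bdd by (auto simp: bounded_iff)
  have one_sided: "\<forall>\<^sub>F n in sequentially. (\<integral>\<omega>. h (Z' \<omega>) \<partial>P') - e < (\<integral>\<omega>. h (Z n \<omega>) \<partial>P n)"
    if "continuous_map mtopology euclideanreal h" "\<And>n. (\<lambda>\<omega>. h (Z n \<omega>)) \<in> borel_measurable (P n)"
      "(\<lambda>\<omega>. h (Z' \<omega>)) \<in> borel_measurable P'" "\<And>x. x \<in> M \<Longrightarrow> 0 \<le> h x" "\<And>x. x \<in> M \<Longrightarrow> h x \<le> 2 * B" "0 < e"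
    for h e
    by (rule expectation_liminf_by_approximation[where A=A and A'=A' and Z=Z and Z'=Z' and P=P and P'=P',
      OF P P' Z Z' A A' Lip near near' that])
  interpret P': prob_space P' by (rule P')
  have int: "integrable (P n) (\<lambda>\<omega>. f (Z n \<omega>))" for n
  proof -
    interpret Pn: prob_space "P n" by (rule P)
    show ?thesis using B[OF Z] by (intro Pn.integrable_const_bound[of _ B] fZ) auto
  qed
  have int': "integrable P' (\<lambda>\<omega>. f (Z' \<omega>))"
    using B[OF Z'] by (intro P'.integrable_const_bound[of _ B] fZ') auto
  have one: "(\<integral>\<omega>. (c::real) \<partial>P n) = c" "(\<integral>\<omega>. (c::real) \<partial>P') = c" for n c
    using prob_space.prob_space[OF P[of n]] P'.prob_space by auto
  have intc: "integrable (P n) (\<lambda>\<omega>. B)" "integrable P' (\<lambda>\<omega>. B)" for n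
    using prob_space.finite_measure[OF P[of n]] by (auto intro!: finite_measure.integrable_const P'.finite_measure_axioms)
  have lower: "\<forall>\<^sub>F n in sequentially. (\<integral>\<omega>. f (Z' \<omega>) \<partial>P') - e < (\<integral>\<omega>. f (Z n \<omega>) \<partial>P n)" if "0 < e" for e
  proof -
    have "\<forall>\<^sub>F n in sequentially. (\<integral>\<omega>. f (Z' \<omega>) + B \<partial>P') - e < (\<integral>\<omega>. f (Z n \<omega>) + B \<partial>P n)"
      using B that by (intro one_sided continuous_map_add f borel_measurable_add fZ fZ')
        (fastforce simp: abs_le_iff)+
    then show ?thesis by (simp add: int int' one intc P'.prob_space prob_space.prob_space[OF P])
  qed
  have upper: "\<forall>\<^sub>F n in sequentially. (\<integral>\<omega>. f (Z n \<omega>) \<partial>P n) < (\<integral>\<omega>. f (Z' \<omega>) \<partial>P') + e" if "0 < e" for e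
  proof -
    have "\<forall>\<^sub>F n in sequentially. (\<integral>\<omega>. B - f (Z' \<omega>) \<partial>P') - e < (\<integral>\<omega>. B - f (Z n \<omega>) \<partial>P n)"
      using B that by (intro one_sided continuous_map_diff f borel_measurable_diff fZ fZ')
        (fastforce simp: abs_le_iff)+
    then show ?thesis by (simp add: int int' one intc P'.prob_space prob_space.prob_space[OF P] algebra_simps)
  qed
  show ?thesis
  proof (rule order_tendstoI)
    fix a assume "a < (\<integral>\<omega>. f (Z' \<omega>) \<partial>P')"
    then show "\<forall>\<^sub>F n in sequentially. a < (\<integral>\<omega>. f (Z n \<omega>) \<partial>P n)"
      using lower[of "(\<integral>\<omega>. f (Z' \<omega>) \<partial>P') - a"] by simp
  next
    fix a assume "(\<integral>\<omega>. f (Z' \<omega>) \<partial>P') < a"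
    then show "\<forall>\<^sub>F n in sequentially. (\<integral>\<omega>. f (Z n \<omega>) \<partial>P n) < a"
      using upper[of "a - (\<integral>\<omega>. f (Z' \<omega>) \<partial>P')"] by simp
  qed
qed

end

section \<open>Independent sequences converging in law\<close>

lemma (in prob_space) indep_vars_nat:
  assumes "\<And>n. indep_vars M' X {..<n::nat}"
  shows "indep_vars M' X UNIV"
  unfolding indep_vars_def2
proof (intro conjI ballI)
  show "random_variable (M' i) (X i)" for i using assms[of "Suc i"] unfolding indep_vars_def2 by auto
  show "indep_sets (\<lambda>i. {X i -` A \<inter> space M |A. A \<in> sets (M' i)}) UNIV"
    unfolding indep_sets_finite_index_sets[of _ UNIV]
  proof (intro allI impI)
    fix J :: "nat set" assume "finite J"
    then obtain n where "J \<subseteq> {..<n}" using finite_nat_iff_bounded by blast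
    then show "indep_sets (\<lambda>i. {X i -` A \<inter> space M |A. A \<in> sets (M' i)}) J"
      using assms[of n] unfolding indep_vars_def2 by (blast intro: indep_sets_mono_index)
  qed
qed

lemma (in prob_space) expectation_of_indep_sequence:
  fixes X :: "nat \<Rightarrow> 'a \<Rightarrow> real" and g :: "(nat \<Rightarrow> real) \<Rightarrow> real"
  assumes ind: "indep_vars (\<lambda>_. borel) X UNIV" and g: "g \<in> borel_measurable borel"
  shows "expectation (\<lambda>\<omega>. g (\<lambda>i. X i \<omega>)) = integral\<^sup>L (Pi\<^sub>M UNIV (\<lambda>i. distr M borel (X i))) g"
proof -
  have X: "X i \<in> borel_measurable M" for i using ind unfolding indep_vars_def by auto
  have "distr M (Pi\<^sub>M UNIV (\<lambda>_. borel)) (\<lambda>\<omega> i. X i \<omega>) = Pi\<^sub>M UNIV (\<lambda>i. distr M borel (X i))"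
    using indep_vars_iff_distr_eq_PiM[where I=UNIV and M'="\<lambda>_. borel" and X=X] ind X by (simp add: restrict_UNIV)
  moreover have "g \<in> borel_measurable (Pi\<^sub>M UNIV (\<lambda>_. borel))"
    using g sets_PiM_equal_borel measurable_cong_sets by blast
  moreover have "(\<lambda>\<omega> i. X i \<omega>) \<in> measurable M (Pi\<^sub>M UNIV (\<lambda>_. borel))"
    by (intro measurable_PiM_single') (auto simp: X)
  ultimately show ?thesis by (metis integral_distr)
qed

text \<open>By Skorohod's theorem each coordinate can be realised on its own probability space so that it
converges pointwise. On the product of these spaces the coordinates are independent, hence the
sequences have the given laws, and they converge pointwise, that is, in the product topology of
\<^typ>\<open>nat \<Rightarrow> real\<close>. Continuity of \<open>g\<close> and dominated convergence conclude.\<close>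

lemma indep_sequence_weak_limit:
  fixes P :: "nat \<Rightarrow> 'w measure" and P' :: "'v measure"
    and U :: "nat \<Rightarrow> nat \<Rightarrow> 'w \<Rightarrow> real" and U' :: "nat \<Rightarrow> 'v \<Rightarrow> real" and g :: "(nat \<Rightarrow> real) \<Rightarrow> real"
  assumes P: "\<And>n. prob_space (P n)" and P': "prob_space P'"
    and ind: "\<And>n. prob_space.indep_vars (P n) (\<lambda>_. borel) (U n) UNIV"
    and ind': "prob_space.indep_vars P' (\<lambda>_. borel) U' UNIV"
    and wc: "\<And>i. weak_conv_m (\<lambda>n. distr (P n) borel (U n i)) (distr P' borel (U' i))"
    and g: "continuous_on UNIV g" and B: "\<And>u. \<bar>g u\<bar> \<le> B"
  shows "(\<lambda>n. \<integral>\<omega>. g (\<lambda>i. U n i \<omega>) \<partial>P n) \<longlonglongrightarrow> (\<integral>\<omega>. g (\<lambda>i. U' i \<omega>) \<partial>P')"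
proof -
  have U: "U n i \<in> borel_measurable (P n)" for n i
    using ind[of n] unfolding prob_space.indep_vars_def2[OF P] by simp
  have U': "U' i \<in> borel_measurable P'" for i
    using ind' unfolding prob_space.indep_vars_def2[OF P'] by simp
  have gm: "g \<in> borel_measurable borel" by (rule borel_measurable_continuous_onI[OF g])
  have "\<exists>(\<Omega> :: real measure) Y Y'. prob_space \<Omega> \<and> (\<forall>n. Y n \<in> borel_measurable \<Omega>) \<and>
     (\<forall>n. distr \<Omega> borel (Y n) = distr (P n) borel (U n i)) \<and> Y' \<in> borel_measurable \<Omega> \<and>
     distr \<Omega> borel Y' = distr P' borel (U' i) \<and> (\<forall>x\<in>space \<Omega>. (\<lambda>n. Y n x) \<longlonglongrightarrow> Y' x)" for i
    using Skorohod[of "\<lambda>n. distr (P n) borel (U n i)" "distr P' borel (U' i)", OF _ _ wc]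
      prob_space.real_distribution_distr[OF P U] prob_space.real_distribution_distr[OF P' U']
    by (simp add: measurable_lborel1 cong: measurable_cong_sets)
  then obtain \<Omega> :: "nat \<Rightarrow> real measure" and Y Y' where \<Omega>: "\<And>i. prob_space (\<Omega> i)"
    and Y[measurable]: "\<And>n i. Y i n \<in> borel_measurable (\<Omega> i)"
    and dY: "\<And>n i. distr (\<Omega> i) borel (Y i n) = distr (P n) borel (U n i)"
    and Y'[measurable]: "\<And>i. Y' i \<in> borel_measurable (\<Omega> i)"
    and dY': "\<And>i. distr (\<Omega> i) borel (Y' i) = distr P' borel (U' i)"
    and conv: "\<And>i x. x \<in> space (\<Omega> i) \<Longrightarrow> (\<lambda>n. Y i n x) \<longlonglongrightarrow> Y' i x" by metis
  interpret \<Omega>: product_prob_space \<Omega> UNIV by (rule product_prob_spaceI[OF \<Omega>])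
  define Q where "Q = Pi\<^sub>M UNIV \<Omega>"
  interpret Q: prob_space Q unfolding Q_def by (rule \<Omega>.P.prob_space_axioms)
  have coord[measurable]: "(\<lambda>x. x i) \<in> measurable Q (\<Omega> i)" for i
    unfolding Q_def by (rule measurable_component_singleton) simp
  have marg: "distr Q (\<Omega> i) (\<lambda>x. x i) = \<Omega> i" for i
    unfolding Q_def by (rule \<Omega>.PiM_component) simp
  have coord_indep: "Q.indep_vars \<Omega> (\<lambda>i x. x i) UNIV"
    by (subst Q.indep_vars_iff_distr_eq_PiM) (simp_all add: marg restrict_UNIV, simp add: Q_def distr_id2)
  have QV: "(\<integral>x. g (\<lambda>i. V i (x i)) \<partial>Q) = integral\<^sup>L (Pi\<^sub>M UNIV (\<lambda>i. distr (\<Omega> i) borel (V i))) g"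
    if [measurable]: "\<And>i. V i \<in> borel_measurable (\<Omega> i)" for V
  proof -
    have "Q.indep_vars (\<lambda>_. borel) (\<lambda>i x. V i (x i)) UNIV"
      using Q.indep_vars_compose2[OF coord_indep, of V "\<lambda>_. borel"] by simp
    moreover have "distr Q borel (\<lambda>x. V i (x i)) = distr (\<Omega> i) borel (V i)" for i
      using distr_distr[of "V i" "\<Omega> i" borel "\<lambda>x. x i" Q] by (simp add: marg comp_def)
    ultimately show ?thesis using Q.expectation_of_indep_sequence[OF _ gm] by simp
  qed
  have "(\<lambda>n. \<integral>x. g (\<lambda>i. Y i n (x i)) \<partial>Q) \<longlonglongrightarrow> (\<integral>x. g (\<lambda>i. Y' i (x i)) \<partial>Q)"
  proof (rule integral_dominated_convergence[where w="\<lambda>_. B"])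
    show "AE x in Q. (\<lambda>n. g (\<lambda>i. Y i n (x i))) \<longlonglongrightarrow> g (\<lambda>i. Y' i (x i))"
    proof (rule AE_I2)
      fix x assume "x \<in> space Q"
      then have "x i \<in> space (\<Omega> i)" for i by (auto simp: Q_def space_PiM)
      then have "(\<lambda>n i. Y i n (x i)) \<longlonglongrightarrow> (\<lambda>i. Y' i (x i))"
        using conv limitin_componentwise[of "\<lambda>_. euclidean" UNIV "\<lambda>n i. Y i n (x i)" "\<lambda>i. Y' i (x i)" sequentially]
        by (simp add: euclidean_product_topology)
      then show "(\<lambda>n. g (\<lambda>i. Y i n (x i))) \<longlonglongrightarrow> g (\<lambda>i. Y' i (x i))"
        by (rule continuous_on_tendsto_compose[OF g]) auto
    qed
    show "(\<lambda>x. g (\<lambda>i. Y' i (x i))) \<in> borel_measurable Q" "\<And>n. (\<lambda>x. g (\<lambda>i. Y i n (x i))) \<in> borel_measurable Q"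
      by (auto intro!: measurable_compose[OF _ gm] measurable_coordinatewise_then_product)
  qed (auto simp: B)
  then have "(\<lambda>n. integral\<^sup>L (Pi\<^sub>M UNIV (\<lambda>i. distr (P n) borel (U n i))) g) \<longlonglongrightarrow>
      integral\<^sup>L (Pi\<^sub>M UNIV (\<lambda>i. distr P' borel (U' i))) g"
    using QV[of Y'] QV[of "\<lambda>i. Y i n" for n] by (simp add: dY dY')
  then show ?thesis
    using prob_space.expectation_of_indep_sequence[OF P ind gm] prob_space.expectation_of_indep_sequence[OF P' ind' gm]
    by simp
qed

section \<open>Step paths, measurability and the exponential functional\<close>

text \<open>Paths that are close up to time \<open>T\<close> are close, since later times have a total weight that is
exponentially small in \<open>T\<close>. The grid cells before \<open>T\<close> cover \<open>[0, T)\<close> only. Hence the supremum over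
\<open>[0, T]\<close>, which has weight \<open>2\<^sup>-\<^sup>T\<close>, is not controlled, and the exponent is \<open>T - 1\<close>.\<close>

lemma loc_unif_dist_le:
  assumes le: "\<And>t. 0 \<le> t \<Longrightarrow> t < real T \<Longrightarrow> \<bar>x t - y t\<bar> \<le> \<eta>" and \<eta>: "0 \<le> \<eta>"
  shows "loc_unif_dist x y \<le> \<eta> + (1/2) ^ (T - 1)"
proof -
  let ?a = "\<lambda>n. (1/2::real) ^ Suc n * enn2real (min 1 (unif_dist (Suc n) x y))"
  have sg: "summable (\<lambda>n. (1/2::real) ^ Suc n)"
    by (subst summable_Suc_iff) (simp add: summable_geometric)
  have a_le: "?a n \<le> (1/2) ^ Suc n" for n
    using enn2real_min_le_1[of "unif_dist (Suc n) x y"] by simp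
  have a_le': "?a n \<le> \<eta> * (1/2) ^ Suc n" if "Suc n < T" for n
  proof -
    have "unif_dist (Suc n) x y \<le> ennreal \<eta>"
      unfolding unif_dist_def using that le by (intro SUP_least ennreal_leI) auto
    then have "enn2real (min 1 (unif_dist (Suc n) x y)) \<le> \<eta>"
      using \<eta> by (intro enn2real_leI) (auto intro: min.coboundedI2)
    then show ?thesis by (simp add: mult.commute mult_right_mono)
  qed
  have tail: "(\<Sum>n. (1/2::real) ^ Suc (n + (T - 1))) = (1/2) ^ (T - 1)"
  proof -
    have "(\<lambda>n. (1/2) ^ (T - 1) * (1/2::real) ^ Suc n) sums ((1/2) ^ (T - 1) * 1)"
      by (intro sums_mult power_half_series)
    then show ?thesis by (simp add: sums_iff power_add mult_ac)
  qed
  have "loc_unif_dist x y = (\<Sum>n. ?a (n + (T - 1))) + (\<Sum>n<T - 1. ?a n)"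
    unfolding loc_unif_dist_def by (rule suminf_split_initial_segment[OF summable_loc_unif_dist])
  also have "(\<Sum>n. ?a (n + (T - 1))) \<le> (1/2) ^ (T - 1)"
    unfolding tail[symmetric]
    by (intro suminf_le a_le summable_ignore_initial_segment[OF summable_loc_unif_dist, where k="T - 1"]
        summable_ignore_initial_segment[OF sg, where k="T - 1"])
  also have "(\<Sum>n<T - 1. ?a n) \<le> (\<Sum>n<T - 1. \<eta> * (1/2) ^ Suc n)"
    by (intro sum_mono a_le') auto
  also have "\<dots> = \<eta> * (\<Sum>n<T - 1. (1/2) ^ Suc n)" by (simp add: sum_distrib_left)
  also have "\<dots> \<le> \<eta> * 1"
  proof (intro mult_left_mono \<eta>)
    have "(\<Sum>n<T - 1. (1/2::real) ^ Suc n) \<le> (\<Sum>n. (1/2) ^ Suc n)" by (intro sum_le_suminf sg) auto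
    also have "\<dots> = 1" using power_half_series by (simp add: sums_iff)
    finally show "(\<Sum>n<T - 1. (1/2::real) ^ Suc n) \<le> 1" .
  qed
  finally show ?thesis by simp
qed

text \<open>The path that starts at 0 and has the \<open>i\<close>-th increment \<open>u i\<close> at time \<open>(i + 1) / j\<close>.\<close>

definition step_path :: "nat \<Rightarrow> (nat \<Rightarrow> real) \<Rightarrow> real \<Rightarrow> real" where
  "step_path j u = (\<lambda>t\<in>{0..}. \<Sum>i<nat \<lfloor>t * real j\<rfloor>. u i)"

lemma step_path_cadlag:
  assumes j: "0 < j" shows "step_path j u \<in> cadlag_space"
  unfolding cadlag_space_def
proof (intro CollectI conjI allI impI)
  show "step_path j u \<in> extensional {0..}" by (simp add: step_path_def)
next
  fix t :: real assume t: "0 \<le> t"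
  let ?b = "(real_of_int \<lfloor>t * real j\<rfloor> + 1) / real j"
  have tb: "t < ?b" using j floor_correct[of "t * real j"] by (simp add: pos_less_divide_eq)
  have "step_path j u s = step_path j u t" if s: "t < s" "s < ?b" for s
  proof -
    have "s * real j < real_of_int \<lfloor>t * real j\<rfloor> + 1" using s(2) j by (simp add: pos_less_divide_eq)
    moreover have "t * real j \<le> s * real j" using s by (intro mult_right_mono) auto
    ultimately have "\<lfloor>s * real j\<rfloor> = \<lfloor>t * real j\<rfloor>" by linarith
    then show ?thesis using t s by (simp add: step_path_def)
  qed
  then have "eventually (\<lambda>s. step_path j u s = step_path j u t) (at_right t)"
    unfolding eventually_at_right_field using tb by blast
  then show "(step_path j u \<longlongrightarrow> step_path j u t) (at_right t)" by (rule tendsto_eventually)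
next
  fix t :: real assume t: "0 < t"
  let ?c = "real_of_int (\<lceil>t * real j\<rceil> - 1)"
  have c0: "0 \<le> ?c" using t j by (simp add: le_ceiling_iff Suc_le_eq)
  have ct: "?c / real j < t" using j ceiling_correct[of "t * real j"] by (simp add: pos_divide_less_eq)
  have "step_path j u s = (\<Sum>i<nat (\<lceil>t * real j\<rceil> - 1). u i)" if s: "?c / real j < s" "s < t" for s
  proof -
    have "?c < s * real j" using s(1) j by (simp add: pos_divide_less_eq)
    moreover have "s * real j < t * real j" using s j by simp
    ultimately have "\<lfloor>s * real j\<rfloor> = \<lceil>t * real j\<rceil> - 1" by linarith
    moreover have "0 \<le> s" using c0 s(1) j by (meson divide_nonneg_nonneg of_nat_0_le_iff order_trans less_imp_le)
    ultimately show ?thesis by (simp add: step_path_def)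
  qed
  then have "eventually (\<lambda>s. step_path j u s = (\<Sum>i<nat (\<lceil>t * real j\<rceil> - 1). u i)) (at_left t)"
    unfolding eventually_at_left_field using ct by blast
  then show "\<exists>l. (step_path j u \<longlongrightarrow> l) (at_left t)" using tendsto_eventually by blast
qed

lemma coordinate_tendsto:
  fixes u :: "nat \<Rightarrow> real" shows "((\<lambda>w. w i) \<longlongrightarrow> u i) (at u)"
  by (metis UNIV_I continuous_on_product_coordinates continuous_on)

text \<open>Up to time \<open>T\<close> a step path involves finitely many partial sums of \<open>u\<close>. Hence pointwise convergence
of the increments, which is the topology of \<^typ>\<open>nat \<Rightarrow> real\<close>, is enough.\<close>

lemma step_path_tendsto:
  "((\<lambda>w. loc_unif_dist (step_path j w) (step_path j u)) \<longlongrightarrow> 0) (at u)"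
proof (rule tendstoI)
  fix e :: real assume e: "0 < e"
  obtain k where k: "(1/2::real) ^ k < e / 2" using real_arch_pow_inv[of "e/2" "1/2"] e by auto
  define T where "T = Suc k"
  have "((\<lambda>w. \<Sum>i<k. w i) \<longlongrightarrow> (\<Sum>i<k. u i)) (at u)" for k
    by (intro tendsto_sum coordinate_tendsto)
  then have "eventually (\<lambda>w. dist (\<Sum>i<k. w i) (\<Sum>i<k. u i) < e / 2) (at u)" for k
    using e by (intro tendstoD) auto
  then have "eventually (\<lambda>w. \<forall>k\<in>{..T * j}. dist (\<Sum>i<k. w i) (\<Sum>i<k. u i) < e / 2) (at u)"
    by (intro eventually_ball_finite) auto
  then show "eventually (\<lambda>w. dist (loc_unif_dist (step_path j w) (step_path j u)) 0 < e) (at u)"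
  proof eventually_elim
    case (elim w)
    have "loc_unif_dist (step_path j w) (step_path j u) \<le> e / 2 + (1/2) ^ (T - 1)"
    proof (rule loc_unif_dist_le)
      fix t :: real assume t: "0 \<le> t" "t < real T"
      have "t * real j \<le> real (T * j)" using t by (simp add: mult_right_mono)
      then have "nat \<lfloor>t * real j\<rfloor> \<le> T * j" by (metis floor_mono floor_of_nat nat_int nat_mono)
      then have "dist (\<Sum>i<nat \<lfloor>t * real j\<rfloor>. w i) (\<Sum>i<nat \<lfloor>t * real j\<rfloor>. u i) < e / 2" using elim by blast
      then show "\<bar>step_path j w t - step_path j u t\<bar> \<le> e / 2" using t by (simp add: step_path_def dist_real_def)
    qed (use e in auto)
    moreover have "0 \<le> loc_unif_dist (step_path j w) (step_path j u)" by simp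
    ultimately show ?case using k by (simp add: T_def)
  qed
qed

text \<open>The exponential functional of the step path with increments \<open>u\<close>, cut off at time \<open>T\<close>. The cutoff
makes it continuous in \<open>u\<close>.\<close>

definition riemann_functional :: "nat \<Rightarrow> nat \<Rightarrow> (nat \<Rightarrow> real) \<Rightarrow> real" where
  "riemann_functional j T u = 2 / real j * (\<Sum>k<T * j. exp (- 2 * (\<Sum>i<k. u i)))"

lemma riemann_functional_tendsto: "((\<lambda>w. riemann_functional j T w) \<longlongrightarrow> riemann_functional j T u) (at u)"
  unfolding riemann_functional_def by (intro tendsto_intros coordinate_tendsto)

text \<open>The product metric is used because Lipschitz minorants need a metric; it induces the product
topology.\<close>

interpretation cadlag_half_line: Metric_space12 cadlag_space loc_unif_dist "{0::real..}" dist
  by unfold_locales (auto simp: dist_commute intro: dist_triangle)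

lemma mtopology_cadlag_half_line:
  "cadlag_half_line.Prod_metric.mtopology = prod_topology cadlag.mtopology (top_of_set {0..})"
proof -
  interpret S: Submetric UNIV "dist :: real \<Rightarrow> _" "{0..}" by unfold_locales auto
  show ?thesis using S.mtopology_submetric cadlag_half_line.mtopology_prod_metric by simp
qed

lemma lipschitz_step_continuous:
  assumes j: "0 < j"
    and g: "\<And>x y. x \<in> cadlag_space \<times> {0..} \<Longrightarrow> y \<in> cadlag_space \<times> {0..} \<Longrightarrow>
        \<bar>g x - g y\<bar> \<le> L * prod_dist loc_unif_dist dist x y"
  shows "continuous_on UNIV (\<lambda>u. g (step_path j u, riemann_functional j T u) :: real)"
  unfolding continuous_on_def
proof
  fix u :: "nat \<Rightarrow> real"
  let ?A = "\<lambda>u. (step_path j u, riemann_functional j T u)"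
  have A: "?A u \<in> cadlag_space \<times> {0..}" for u
    using step_path_cadlag[OF j] by (auto simp: riemann_functional_def intro!: divide_nonneg_nonneg mult_nonneg_nonneg sum_nonneg)
  have bound: "\<bar>g (?A w) - g (?A u)\<bar> \<le> \<bar>L\<bar> * (loc_unif_dist (step_path j w) (step_path j u) +
      dist (riemann_functional j T w) (riemann_functional j T u))" for w
  proof -
    have "\<bar>g (?A w) - g (?A u)\<bar> \<le> L * prod_dist loc_unif_dist dist (?A w) (?A u)" by (rule g[OF A A])
    also have "\<dots> \<le> \<bar>L\<bar> * prod_dist loc_unif_dist dist (?A w) (?A u)"
      by (intro mult_right_mono cadlag_half_line.Prod_metric.nonneg) auto
    also have "\<dots> \<le> \<bar>L\<bar> * (loc_unif_dist (step_path j w) (step_path j u) +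
      dist (riemann_functional j T w) (riemann_functional j T u))"
      by (intro mult_left_mono cadlag_half_line.prod_metric_le_components) (use A in auto)
    finally show ?thesis .
  qed
  have "((\<lambda>w. \<bar>L\<bar> * (loc_unif_dist (step_path j w) (step_path j u) +
      dist (riemann_functional j T w) (riemann_functional j T u))) \<longlongrightarrow>
      \<bar>L\<bar> * (0 + dist (riemann_functional j T u) (riemann_functional j T u))) (at u)"
    by (intro tendsto_intros step_path_tendsto riemann_functional_tendsto)
  then have lim: "((\<lambda>w. \<bar>L\<bar> * (loc_unif_dist (step_path j w) (step_path j u) +
      dist (riemann_functional j T w) (riemann_functional j T u))) \<longlongrightarrow> 0) (at u)" by simp
  have "((\<lambda>w. g (?A w) - g (?A u)) \<longlongrightarrow> 0) (at u)"
    by (rule Lim_null_comparison[OF _ lim]) (rule always_eventually, use bound in \<open>simp only: real_norm_def, blast\<close>)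
  then show "((\<lambda>w. g (?A w)) \<longlongrightarrow> g (?A u)) (at u within UNIV)" by (simp add: LIM_zero_iff)
qed

text \<open>Cadlag paths are determined by their values at rational times, approached from the right; the
endpoint \<open>n\<close> cannot be approached from the right within \<open>[0, n]\<close> and is added.\<close>

lemma unif_dist_countable:
  assumes x: "x \<in> cadlag_space" and y: "y \<in> cadlag_space"
  shows "unif_dist n x y = (SUP t\<in>insert (real n) ({0..real n} \<inter> \<rat>). ennreal \<bar>x t - y t\<bar>)" (is "_ = ?S")
proof (rule antisym)
  show "?S \<le> unif_dist n x y" unfolding unif_dist_def by (intro SUP_subset_mono) auto
  show "unif_dist n x y \<le> ?S"
    unfolding unif_dist_def
  proof (rule SUP_least)
    fix t assume t: "t \<in> {0..real n}"
    show "ennreal \<bar>x t - y t\<bar> \<le> ?S"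
    proof (cases "t = real n")
      case True then show ?thesis by (intro SUP_upper) auto
    next
      case False
      show ?thesis
      proof (rule ccontr)
        assume "\<not> ennreal \<bar>x t - y t\<bar> \<le> ?S"
        then have S: "?S < ennreal \<bar>x t - y t\<bar>" by simp
        have "((\<lambda>s. ennreal \<bar>x s - y s\<bar>) \<longlongrightarrow> ennreal \<bar>x t - y t\<bar>) (at_right t)"
          using x y t by (intro tendsto_ennrealI tendsto_intros) (auto simp: cadlag_space_def)
        from order_tendstoD(1)[OF this S] obtain b where b: "t < b"
          "\<And>s. t < s \<Longrightarrow> s < b \<Longrightarrow> ?S < ennreal \<bar>x s - y s\<bar>" unfolding eventually_at_right_field by blast
        obtain s where s: "s \<in> \<rat>" "t < s" "s < min b (real n)"
          using Rats_dense_in_real[of t "min b (real n)"] b(1) t False by auto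
        have "ennreal \<bar>x s - y s\<bar> \<le> ?S" using s t by (intro SUP_upper) auto
        then show False using b(2)[of s] s by auto
      qed
    qed
  qed
qed

text \<open>The distance of a random path from a fixed one is a series of countable suprema of random variables,
so the preimages of balls are events.\<close>

lemma measurable_cadlag_path:
  assumes meas: "\<And>t. 0 \<le> t \<Longrightarrow> X t \<in> borel_measurable M"
    and cad: "\<And>\<omega>. \<omega> \<in> space M \<Longrightarrow> half_line_path X \<omega> \<in> cadlag_space"
  shows "half_line_path X \<in> measurable M cadlag_ball_sigma"
  unfolding cadlag_ball_sigma_def
proof (rule measurable_measure_of)
  fix B assume "B \<in> {cadlag.mball x r |x r. x \<in> cadlag_space}"
  then obtain x r where B: "B = cadlag.mball x r" and x: "x \<in> cadlag_space" by blast
  let ?W = "half_line_path X"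
  have um: "(\<lambda>\<omega>. unif_dist n x (?W \<omega>)) \<in> borel_measurable M" for n
  proof -
    have "(\<lambda>\<omega>. SUP t\<in>insert (real n) ({0..real n} \<inter> \<rat>). ennreal \<bar>x t - X t \<omega>\<bar>) \<in> borel_measurable M"
    proof (rule borel_measurable_SUP)
      show "countable (insert (real n) ({0..real n} \<inter> \<rat>))" by (auto simp: countable_rat)
      fix t assume "t \<in> insert (real n) ({0..real n} \<inter> \<rat>)"
      then have [measurable]: "X t \<in> borel_measurable M" by (intro meas) auto
      show "(\<lambda>\<omega>. ennreal \<bar>x t - X t \<omega>\<bar>) \<in> borel_measurable M" by measurable
    qed
    moreover have "unif_dist n x (?W \<omega>) = (SUP t\<in>insert (real n) ({0..real n} \<inter> \<rat>). ennreal \<bar>x t - X t \<omega>\<bar>)"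
      if "\<omega> \<in> space M" for \<omega>
      unfolding unif_dist_countable[OF x cad[OF that]] by (intro SUP_cong) (auto simp: half_line_path_def)
    ultimately show ?thesis by (simp cong: measurable_cong)
  qed
  have [measurable]: "(\<lambda>\<omega>. loc_unif_dist x (?W \<omega>)) \<in> borel_measurable M"
    unfolding loc_unif_dist_def
    using um by measurable
  have "?W -` B \<inter> space M = {\<omega>\<in>space M. loc_unif_dist x (?W \<omega>) < r}"
    unfolding B using x cad by (auto simp: cadlag.in_mball)
  also have "\<dots> \<in> sets M" by measurable
  finally show "?W -` B \<inter> space M \<in> sets M" .
qed (use cad in \<open>auto simp: cadlag.in_mball\<close>)

text \<open>The process is the limit of its values at the dyadic times next to the right of \<open>s\<close>. Taking
\<open>max 0 s\<close> extends it to negative times by a constant.\<close>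

lemma right_cont_jointly_measurable:
  fixes X :: "real \<Rightarrow> 'a \<Rightarrow> real"
  assumes meas: "\<And>t. 0 \<le> t \<Longrightarrow> X t \<in> borel_measurable M"
    and rc: "\<And>\<omega> t. \<omega> \<in> space M \<Longrightarrow> 0 \<le> t \<Longrightarrow> ((\<lambda>s. X s \<omega>) \<longlongrightarrow> X t \<omega>) (at_right t)"
  shows "(\<lambda>(\<omega>, s). X (max 0 s) \<omega>) \<in> borel_measurable (M \<Otimes>\<^sub>M borel)"
proof (rule borel_measurable_LIMSEQ_metric)
  let ?t = "\<lambda>n s. (real (nat \<lfloor>max 0 s * (2::real)^n\<rfloor>) + 1) / 2^n"
  show "(\<lambda>(\<omega>, s). X (?t n s) \<omega>) \<in> borel_measurable (M \<Otimes>\<^sub>M borel)" for n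
  proof -
    have "(\<lambda>p. X ((real k + 1) / 2^n) (fst p)) \<in> borel_measurable (M \<Otimes>\<^sub>M borel)" for k
      by (rule measurable_compose[OF measurable_fst meas]) simp
    moreover have "(\<lambda>p. nat \<lfloor>max 0 (snd p) * (2::real)^n\<rfloor>) \<in> measurable (M \<Otimes>\<^sub>M (borel :: real measure)) (count_space UNIV)"
      by measurable
    ultimately have "(\<lambda>p. X ((real (nat \<lfloor>max 0 (snd p) * (2::real)^n\<rfloor>) + 1) / 2^n) (fst p)) \<in> borel_measurable (M \<Otimes>\<^sub>M borel)"
      by (rule measurable_compose_countable)
    then show ?thesis by (simp add: case_prod_beta)
  qed
  fix p assume p: "p \<in> space (M \<Otimes>\<^sub>M (borel :: real measure))"
  obtain \<omega> s where ws: "p = (\<omega>, s)" "\<omega> \<in> space M" using p by (cases p) (auto simp: space_pair_measure)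
  have gt: "max 0 s < ?t n s" and le: "?t n s \<le> max 0 s + 1 / 2^n" for n
  proof -
    have 0: "0 \<le> max 0 s * 2^n" by simp
    have nf: "real (nat \<lfloor>max 0 s * 2^n\<rfloor>) = real_of_int \<lfloor>max 0 s * 2^n\<rfloor>" using 0 by (simp add: of_nat_floor)
    show "max 0 s < ?t n s" unfolding nf using floor_correct[of "max 0 s * 2^n"] by (subst pos_less_divide_eq) auto
    have "?t n s \<le> (max 0 s * 2^n + 1) / 2^n" unfolding nf using floor_correct[of "max 0 s * 2^n"]
      by (intro divide_right_mono) auto
    then show "?t n s \<le> max 0 s + 1 / 2^n" by (simp add: add_divide_distrib)
  qed
  have "(\<lambda>n. ?t n s) \<longlonglongrightarrow> max 0 s"
  proof (rule tendsto_sandwich)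
    show "eventually (\<lambda>n. max 0 s \<le> ?t n s) sequentially" using gt by (intro always_eventually allI less_imp_le)
    show "eventually (\<lambda>n. ?t n s \<le> max 0 s + 1 / 2^n) sequentially" using le by (intro always_eventually allI)
    have "(\<lambda>n. max 0 s + (1/2) ^ n) \<longlonglongrightarrow> max 0 s + 0" by (intro tendsto_intros) auto
    then show "(\<lambda>n. max 0 s + 1 / 2 ^ n) \<longlonglongrightarrow> max 0 s" by (simp add: power_divide)
  qed simp
  then have "filterlim (\<lambda>n. ?t n s) (at_right (max 0 s)) sequentially"
  proof -
    have "eventually (\<lambda>n. ?t n s \<in> {max 0 s<..} \<and> ?t n s \<noteq> max 0 s) sequentially"
      using gt by (intro always_eventually allI) (metis greaterThan_iff less_irrefl)
    then show ?thesis using \<open>(\<lambda>n. ?t n s) \<longlonglongrightarrow> max 0 s\<close> by (simp only: filterlim_at)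
  qed
  from filterlim_compose[OF rc[OF ws(2), of "max 0 s"] this]
  show "(\<lambda>n. case p of (\<omega>, s) \<Rightarrow> X (?t n s) \<omega>) \<longlonglongrightarrow> (case p of (\<omega>, s) \<Rightarrow> X (max 0 s) \<omega>)"
    by (simp add: ws)
qed

lemma exp_functional_measurable:
  fixes X :: "real \<Rightarrow> 'a \<Rightarrow> real"
  assumes "\<And>t. 0 \<le> t \<Longrightarrow> X t \<in> borel_measurable M"
    and "\<And>\<omega> t. \<omega> \<in> space M \<Longrightarrow> 0 \<le> t \<Longrightarrow> ((\<lambda>s. X s \<omega>) \<longlongrightarrow> X t \<omega>) (at_right t)"
  shows "(\<lambda>\<omega>. exp_functional (half_line_path X \<omega>)) \<in> borel_measurable M"
proof -
  have G: "(\<lambda>(\<omega>, s). X (max 0 s) \<omega>) \<in> borel_measurable (M \<Otimes>\<^sub>M lborel)"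
    using right_cont_jointly_measurable[OF assms] by (simp cong: measurable_cong_sets sets_pair_measure_cong)
  have "(\<lambda>p. ennreal (exp (- 2 * (\<lambda>(\<omega>, s). X (max 0 s) \<omega>) p)) * indicator {0..} (snd p)) \<in> borel_measurable (M \<Otimes>\<^sub>M lborel)"
    using G by measurable
  then have "(\<lambda>(\<omega>, s). ennreal (exp (- 2 * X (max 0 s) \<omega>)) * indicator {0..} s) \<in> borel_measurable (M \<Otimes>\<^sub>M lborel)"
    by (simp add: case_prod_beta)
  from lborel.borel_measurable_nn_integral[OF this]
  have "(\<lambda>\<omega>. 2 * (\<integral>\<^sup>+s. ennreal (exp (- 2 * X (max 0 s) \<omega>)) * indicator {0..} s \<partial>lborel)) \<in> borel_measurable M"
    by measurable
  also have "(\<lambda>\<omega>. 2 * (\<integral>\<^sup>+s. ennreal (exp (- 2 * X (max 0 s) \<omega>)) * indicator {0..} s \<partial>lborel)) =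
      (\<lambda>\<omega>. exp_functional (half_line_path X \<omega>))"
    unfolding exp_functional_def half_line_path_def
    by (intro ext arg_cong[where f="\<lambda>x. 2 * x"] nn_integral_cong) (auto split: split_indicator)
  finally show ?thesis .
qed

text \<open>A path is a process on a one-point probability space.\<close>

lemma right_cont_path_measurable:
  fixes x :: "real \<Rightarrow> real"
  assumes "\<And>t. 0 \<le> t \<Longrightarrow> (x \<longlongrightarrow> x t) (at_right t)"
  shows "(\<lambda>s. x (max 0 s)) \<in> borel_measurable borel"
proof -
  have "(\<lambda>(\<omega>::unit, s). x (max 0 s)) \<in> borel_measurable (count_space UNIV \<Otimes>\<^sub>M borel)"
    by (rule right_cont_jointly_measurable) (use assms in auto)
  from measurable_compose[OF measurable_Pair1'[of "()"] this] show ?thesis by simp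
qed

text \<open>The linear lower bound serves twice: it gives \<open>exp (- 2 x)\<close> the integrable majorant
\<open>exp (2 C - m s)\<close>, which controls times after \<open>T\<close>, and it gives \<open>x \<ge> - C\<close>, so that before
\<open>T\<close> an error \<open>\<eta>\<close> in the path changes the integrand by at most \<open>2 \<eta> exp (2 C)\<close>.\<close>

lemma exp_functional_approx:
  fixes x :: "real \<Rightarrow> real" and T j :: nat
  assumes rc: "\<And>t. 0 \<le> t \<Longrightarrow> (x \<longlongrightarrow> x t) (at_right t)" and x0: "x 0 = 0"
    and m: "0 < m" and low: "\<And>s. 0 \<le> s \<Longrightarrow> m * s / 2 - C \<le> x s"
    and j: "0 < j"
  shows "exp_functional (\<lambda>t\<in>{0..}. x t) < \<infinity>"
    and "(\<And>k s. k < T * j \<Longrightarrow> real k / real j \<le> s \<Longrightarrow> s < (real k + 1) / real j \<Longrightarrow> \<bar>x s - x (real k / real j)\<bar> \<le> \<eta>) \<Longrightarrow> 0 \<le> \<eta> \<Longrightarrow>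
      \<bar>enn2real (exp_functional (\<lambda>t\<in>{0..}. x t)) -
       riemann_functional j T (\<lambda>i. x (real (Suc i) / real j) - x (real i / real j))\<bar>
      \<le> 4 * real T * \<eta> * exp (2 * C) + 2 * exp (2 * C) * exp (- m * real T) / m"
proof -
  define f where "f s = indicator {0..} s * exp (- 2 * x (max 0 s))" for s
  note [measurable] = right_cont_path_measurable[OF rc]
  have fm[measurable]: "f \<in> borel_measurable borel" unfolding f_def by measurable
  have f_nn: "0 \<le> f s" for s by (simp add: f_def)
  have f_le: "f s \<le> exp (2 * C) * (exp (- m * s) * indicator {0..} s)" for s
    using low[of s] by (auto simp: f_def exp_add[symmetric] split: split_indicator)
  have tail: "has_bochner_integral lborel (\<lambda>s. exp (- m * s) * indicator {a..} s) (exp (- m * a) / m)" for a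
  proof -
    have "(\<integral>\<^sup>+ s. ennreal (exp (- m * s)) * indicator {a..} s \<partial>lborel) = ennreal (0 - (- exp (- m * a) / m))"
    proof (rule nn_integral_FTC_atLeast)
      show "((\<lambda>s. - exp (- m * s) / m) has_real_derivative exp (- m * s)) (at s)" for s
        using m by (auto intro!: derivative_eq_intros)
      show "((\<lambda>s. - exp (- m * s) / m) \<longlongrightarrow> 0) at_top"
        using m by real_asymp
    qed auto
    then have "(\<integral>\<^sup>+ s. ennreal (exp (- m * s) * indicator {a..} s) \<partial>lborel) = ennreal (exp (- m * a) / m)"
      by (simp add: ennreal_mult' ennreal_indicator)
    then show ?thesis by (intro has_bochner_integral_nn_integral) (use m in auto)
  qed
  have f_int: "integrable lborel f"
    by (rule Bochner_Integration.integrable_bound[OF integrable_mult_right[OF integrable.intros[OF tail[of 0]], of "exp (2 * C)"]])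
      (use f_le f_nn in auto)
  have eI: "exp_functional (\<lambda>t\<in>{0..}. x t) = ennreal (2 * (\<integral>s. f s \<partial>lborel))"
  proof -
    have "(\<integral>\<^sup>+ s\<in>{0..}. ennreal (exp (- 2 * (\<lambda>t\<in>{0..}. x t) s)) \<partial>lborel) = (\<integral>\<^sup>+ s. ennreal (f s) \<partial>lborel)"
      by (intro nn_integral_cong) (auto simp: f_def split: split_indicator)
    also have "\<dots> = ennreal (\<integral>s. f s \<partial>lborel)"
      by (rule nn_integral_eq_integral[OF f_int]) (auto simp: f_nn)
    finally show ?thesis unfolding exp_functional_def by (simp add: ennreal_mult' f_nn)
  qed
  then show "exp_functional (\<lambda>t\<in>{0..}. x t) < \<infinity>" by simp
  assume mod: "\<And>k s. k < T * j \<Longrightarrow> real k / real j \<le> s \<Longrightarrow> s < (real k + 1) / real j \<Longrightarrow> \<bar>x s - x (real k / real j)\<bar> \<le> \<eta>"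
    and \<eta>: "0 \<le> \<eta>"
  \<comment> \<open>the integrand of the Riemann sum, a step function on the cells of the grid\<close>
  define h where "h s = (\<Sum>k<T * j. exp (- 2 * x (real k / real j)) * indicator {real k / real j..<(real k + 1) / real j} s)" for s
  have sumk: "(\<Sum>i<k. x (real (Suc i) / real j) - x (real i / real j)) = x (real k / real j)" for k
    using sum_lessThan_telescope[of "\<lambda>i. x (real i / real j)" k] x0 by simp
  have len: "measure lborel {real k / real j..<(real k + 1) / real j} = 1 / real j" for k :: nat
    using j by (simp add: divide_right_mono diff_divide_distrib[symmetric])
  have h_int: "integrable lborel h" unfolding h_def
    by (intro Bochner_Integration.integrable_sum integrable_mult_right integrable_real_indicator) (use j in \<open>auto simp: divide_right_mono\<close>)
  have h_eq: "(\<integral>s. h s \<partial>lborel) = (\<Sum>k<T * j. exp (- 2 * x (real k / real j)) * (1 / real j))"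
    unfolding h_def
    by (subst Bochner_Integration.integral_sum)
      (use j in \<open>auto simp: divide_right_mono len intro!: integrable_mult_right integrable_real_indicator simp del: measure_lborel_Ico\<close>)
  have J: "riemann_functional j T (\<lambda>i. x (real (Suc i) / real j) - x (real i / real j)) = 2 * (\<integral>s. h s \<partial>lborel)"
    unfolding riemann_functional_def sumk h_eq by (simp add: sum_distrib_left sum_divide_distrib)
  have diff: "\<bar>f s - h s\<bar> \<le> 2 * \<eta> * exp (2 * C) * indicator {0..<real T} s + exp (2 * C) * (exp (- m * s) * indicator {real T..} s)" for s
  proof (cases "0 \<le> s \<and> s < real T")
    case True
    define k where "k = nat \<lfloor>s * real j\<rfloor>"
    have kr: "real k = real_of_int \<lfloor>s * real j\<rfloor>" using True by (simp add: k_def of_nat_floor)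
    have ks: "real k / real j \<le> s" "s < (real k + 1) / real j"
      unfolding kr using j floor_correct[of "s * real j"] by (auto simp: pos_divide_le_eq pos_less_divide_eq)
    have "real k \<le> s * real j" unfolding kr using floor_correct by blast
    also have "\<dots> < real (T * j)" using True j by simp
    finally have kT: "k < T * j" by linarith
    have uniq: "i = k" if "real i / real j \<le> s" "s < (real i + 1) / real j" for i
    proof -
      have "real i \<le> s * real j" "s * real j < real i + 1" using that j by (auto simp: pos_divide_le_eq pos_less_divide_eq)
      then have "\<lfloor>s * real j\<rfloor> = int i" by linarith
      then show ?thesis by (simp add: k_def)
    qed
    have "h s = (\<Sum>i<T * j. if i = k then exp (- 2 * x (real k / real j)) else 0)"
      unfolding h_def
    proof (intro sum.cong refl)
      fix i assume "i \<in> {..<T * j}"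
      have "real i / real j \<le> s \<and> s < (real i + 1) / real j \<longleftrightarrow> i = k" using uniq[of i] ks by metis
      then have "indicator {real i / real j..<(real i + 1) / real j} s = (if i = k then 1 else (0::real))"
        unfolding indicator_def atLeastLessThan_iff by simp
      then show "exp (- 2 * x (real i / real j)) * indicator {real i / real j..<(real i + 1) / real j} s =
          (if i = k then exp (- 2 * x (real k / real j)) else 0)" by simp
    qed
    then have hs: "h s = exp (- 2 * x (real k / real j))" using kT by simp
    have exp_lip: "\<bar>exp (- 2 * a) - exp (- 2 * b)\<bar> \<le> 2 * exp (2 * C) * \<bar>a - b\<bar>" if "- C \<le> a" "- C \<le> b" for a b
    proof -
      have *: "exp (- 2 * a) - exp (- 2 * b) \<le> 2 * exp (2 * C) * (b - a)" if "a \<le> b" "- C \<le> a" for a b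
      proof -
        have "exp (- 2 * a) - exp (- 2 * b) = exp (- 2 * a) * (1 - exp (- 2 * (b - a)))"
          by (simp add: right_diff_distrib exp_add[symmetric])
        also have "\<dots> \<le> exp (- 2 * a) * (2 * (b - a))"
        proof (intro mult_left_mono)
          show "1 - exp (- 2 * (b - a)) \<le> 2 * (b - a)"
            using exp_ge_add_one_self[of "- 2 * (b - a)"] by linarith
        qed auto
        also have "\<dots> \<le> exp (2 * C) * (2 * (b - a))" using that by (intro mult_right_mono) auto
        also have "\<dots> = 2 * exp (2 * C) * (b - a)" by simp
        finally show ?thesis .
      qed
      show ?thesis using *[of a b] *[of b a] that by (cases "a \<le> b") auto
    qed
    have lowC: "- C \<le> x a" if "0 \<le> a" for a
    proof -
      have "0 \<le> m * a / 2" using that m by simp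
      then show ?thesis using low[OF that] by linarith
    qed
    have "\<bar>f s - h s\<bar> \<le> 2 * exp (2 * C) * \<bar>x s - x (real k / real j)\<bar>"
      using True exp_lip[OF lowC[of s] lowC[of "real k / real j"]] by (simp add: f_def hs max_def)
    also have "\<dots> \<le> 2 * exp (2 * C) * \<eta>" using mod[OF kT ks] by (intro mult_left_mono) auto
    finally show ?thesis using True by (simp add: mult_ac)
  next
    case False
    have "h s = 0" unfolding h_def
    proof (intro sum.neutral ballI)
      fix k assume k: "k \<in> {..<T * j}"
      then have "real k + 1 \<le> real T * real j" by (metis Suc_eq_plus1 Suc_leI lessThan_iff of_nat_Suc of_nat_le_iff of_nat_mult add.commute)
      then have "(real k + 1) / real j \<le> real T" using j by (simp add: pos_divide_le_eq)
      moreover have "0 \<le> real k / real j" by simp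
      ultimately have "s \<notin> {real k / real j..<(real k + 1) / real j}"
        using False unfolding atLeastLessThan_iff by linarith
      then show "exp (- 2 * x (real k / real j)) * indicator {real k / real j..<(real k + 1) / real j} s = 0" by simp
    qed
    then show ?thesis using False f_le[of s] f_nn[of s] by (auto split: split_indicator simp: f_def)
  qed
  have ind_int: "integrable lborel (\<lambda>s. 2 * \<eta> * exp (2 * C) * indicator {0..<real T} s)"
    by (intro integrable_mult_right integrable_real_indicator) auto
  have tail_int: "integrable lborel (\<lambda>s. exp (2 * C) * (exp (- m * s) * indicator {real T..} s))"
    by (intro integrable_mult_right integrable.intros[OF tail])
  have "\<bar>(\<integral>s. f s \<partial>lborel) - (\<integral>s. h s \<partial>lborel)\<bar> = \<bar>\<integral>s. f s - h s \<partial>lborel\<bar>"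
    using f_int h_int by simp
  also have "\<dots> \<le> (\<integral>s. \<bar>f s - h s\<bar> \<partial>lborel)" by (rule integral_abs_bound)
  also have "\<dots> \<le> (\<integral>s. 2 * \<eta> * exp (2 * C) * indicator {0..<real T} s + exp (2 * C) * (exp (- m * s) * indicator {real T..} s) \<partial>lborel)"
    using f_int h_int ind_int tail_int by (intro integral_mono diff Bochner_Integration.integrable_add integrable_abs Bochner_Integration.integrable_diff) auto
  also have "\<dots> = 2 * \<eta> * exp (2 * C) * real T + exp (2 * C) * (exp (- m * real T) / m)"
    using ind_int tail_int has_bochner_integral_integral_eq[OF tail[of "real T"]]
    by (subst Bochner_Integration.integral_add) auto
  finally have "\<bar>(\<integral>s. f s \<partial>lborel) - (\<integral>s. h s \<partial>lborel)\<bar> \<le> 2 * \<eta> * exp (2 * C) * real T + exp (2 * C) * (exp (- m * real T) / m)" .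
  moreover have "enn2real (exp_functional (\<lambda>t\<in>{0..}. x t)) = 2 * (\<integral>s. f s \<partial>lborel)"
    unfolding eI by (simp add: f_nn)
  ultimately show "\<bar>enn2real (exp_functional (\<lambda>t\<in>{0..}. x t)) -
       riemann_functional j T (\<lambda>i. x (real (Suc i) / real j) - x (real i / real j))\<bar>
      \<le> 4 * real T * \<eta> * exp (2 * C) + 2 * exp (2 * C) * exp (- m * real T) / m"
    unfolding J by (simp add: abs_le_iff algebra_simps)
qed

section \<open>The functional limit theorem for processes with drift\<close>

definition grid_increments :: "nat \<Rightarrow> (real \<Rightarrow> 'a \<Rightarrow> real) \<Rightarrow> 'a \<Rightarrow> nat \<Rightarrow> real" where
  "grid_increments j X \<omega> i = X (real (Suc i) / real j) \<omega> - X (real i / real j) \<omega>"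

definition path_with_functional :: "(real \<Rightarrow> 'a \<Rightarrow> real) \<Rightarrow> 'a \<Rightarrow> (real \<Rightarrow> real) \<times> real" where
  "path_with_functional X \<omega> = (half_line_path X \<omega>, enn2real (exp_functional (half_line_path X \<omega>)))"

definition discretisation :: "nat \<Rightarrow> nat \<Rightarrow> (nat \<Rightarrow> real) \<Rightarrow> (real \<Rightarrow> real) \<times> real" where
  "discretisation j T u = (step_path j u, riemann_functional j T u)"

text \<open>The second parameter is the variance.\<close>

abbreviation normal_law :: "real \<Rightarrow> real \<Rightarrow> real measure" where
  "normal_law a b \<equiv> density lborel (normal_density a (sqrt b))"

lemma truncated_quartic_nonneg: "0 \<le> min 1 ((x::real) ^ 4)"
  by (intro min.boundedI) auto

lemma truncated_quartic_bound: "\<bar>min 1 ((x::real) ^ 4)\<bar> \<le> 1"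
proof -
  have "min 1 (x ^ 4) \<le> 1" by simp
  then show ?thesis using truncated_quartic_nonneg[of x] by linarith
qed

text \<open>The truncation makes the integrand bounded and continuous, hence a test function for weak
convergence, while it still dominates the indicator of \<open>\<bar>x - a\<bar> \<ge> r\<close>.\<close>

lemma normal_truncated_moment:
  assumes b: "0 < b" and r: "0 < r"
  shows "(\<integral>x. min 1 ((\<bar>x - a\<bar> / r) ^ 4) \<partial>normal_law a b) \<le> 3 * b\<^sup>2 / r ^ 4"
proof -
  have sb: "0 < sqrt b" using b by simp
  have "(\<integral>x. min 1 ((\<bar>x - a\<bar> / r) ^ 4) \<partial>normal_law a b) =
      (\<integral>x. normal_density a (sqrt b) x * min 1 ((\<bar>x - a\<bar> / r) ^ 4) \<partial>lborel)"
    by (subst integral_density) (auto simp: mult.commute)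
  also have "\<dots> \<le> (\<integral>x. (normal_density a (sqrt b) x * (x - a) ^ (2 * 2)) / r ^ 4 \<partial>lborel)"
  proof (rule integral_mono')
    show "integrable lborel (\<lambda>x. normal_density a (sqrt b) x * (x - a) ^ (2 * 2) / r ^ 4)"
      by (intro integrable_divide integrable_normal_moment sb)
    fix x
    have "min 1 ((\<bar>x - a\<bar> / r) ^ 4) \<le> (x - a) ^ (2 * 2) / r ^ 4" by (simp add: power_divide power_even_abs)
    from mult_left_mono[OF this normal_density_nonneg[of a "sqrt b" x]]
    show "normal_density a (sqrt b) x * min 1 ((\<bar>x - a\<bar> / r) ^ 4) \<le> normal_density a (sqrt b) x * (x - a) ^ (2 * 2) / r ^ 4"
      by simp
  qed (use r in \<open>auto intro!: mult_nonneg_nonneg\<close>)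
  also have "\<dots> = (\<integral>x. normal_density a (sqrt b) x * (x - a) ^ (2 * 2) \<partial>lborel) / r ^ 4" by simp
  also have "\<dots> = 3 * b\<^sup>2 / r ^ 4"
    using b by (subst integral_normal_moment_even[OF sb]) (simp add: fact_numeral power_divide)
  finally show ?thesis .
qed

context drift_process
begin

lemma grid_increments_indep:
  assumes j: "0 < j"
  shows "indep_vars (\<lambda>_. borel) (\<lambda>i \<omega>. grid_increments j X \<omega> i) UNIV"
proof (rule indep_vars_nat)
  fix n
  have "strict_mono_on {..n} (\<lambda>i. real i / real j)"
    using j by (intro strict_mono_onI) (simp add: divide_strict_right_mono)
  then show "indep_vars (\<lambda>_. borel) (\<lambda>i \<omega>. grid_increments j X \<omega> i) {..<n}"
    using indep_incr unfolding indep_increments_def grid_increments_def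
    by (elim allE[of _ n] allE[of _ "\<lambda>i. real i / real j"]) simp
qed

lemma grid_increment_measurable: "(\<lambda>\<omega>. grid_increments j X \<omega> i) \<in> borel_measurable M"
  unfolding grid_increments_def by (intro borel_measurable_diff X_measurable) auto

text \<open>The exceptional event collects the failure of the linear lower bound and, for each cell of the grid
before time \<open>T\<close>, an oscillation of the centred process by more than \<open>\<eta> / 2\<close>. By the maximal inequality the latter costs
twice the probability that the increment over the cell deviates by \<open>\<eta> / 8\<close>, which is
bounded by a truncated fourth moment. The condition on \<open>v / j\<close> is the one of the maximal
inequality; the one on \<open>\<mu> / j\<close> makes the drift within a cell negligible.\<close>

lemma path_with_functional_close:
  assumes \<mu>: "0 < \<mu>" "\<mu> / 2 \<le> m" "m \<le> 2 * \<mu>" and j: "0 < j" and \<eta>: "0 < \<eta>"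
    and j_mu: "\<mu> / real j \<le> \<eta> / 8" and j_v: "2 * v / real j \<le> (\<eta> / 4)\<^sup>2" and C: "0 < C"
  obtains E where "E \<in> sets M"
    "prob E \<le> (8 + 512 / \<mu>\<^sup>2) * v / C +
      (\<Sum>k<T * j. 2 * expectation (\<lambda>\<omega>. min 1 ((\<bar>grid_increments j X \<omega> k - \<mu> / real j\<bar> / (\<eta> / 8)) ^ 4)))"
    "\<And>\<omega>. \<omega> \<in> space M \<Longrightarrow> \<omega> \<notin> E \<Longrightarrow>
      prod_dist loc_unif_dist dist (path_with_functional X \<omega>) (discretisation j T (grid_increments j X \<omega>))
      \<le> (1 + 4 * real T * exp (2 * C)) * \<eta> + ((1/2) ^ (T - 1) + 4 * exp (2 * C) / \<mu> * exp (- (\<mu> / 2) * real T))"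
proof -
  have mpos: "0 < m" using \<mu> by linarith
  obtain L where L: "L \<in> sets M" "prob L \<le> (8 + 128 / m\<^sup>2) * v / C"
    "\<And>\<omega> s. \<omega> \<in> space M \<Longrightarrow> \<omega> \<notin> L \<Longrightarrow> 0 \<le> s \<Longrightarrow> m * s / 2 - C \<le> X s \<omega>"
    using linear_lower_bound[OF mpos C] by blast
  define F where "F k = {\<omega>\<in>space M. \<exists>s\<in>{real k / real j..real k / real j + 1 / real j}. \<bar>centred s \<omega> - centred (real k / real j) \<omega>\<bar> > 2 * (\<eta> / 4)}" for k :: nat
  have max_prem: "0 \<le> real k / real j" "0 < 1 / real j" "0 < \<eta> / 4" "2 * v * (1 / real j) \<le> (\<eta> / 4)\<^sup>2" for k :: nat
    using j \<eta> j_v by auto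
  have F_sets: "F k \<in> sets M" for k unfolding F_def by (rule centred_maximal(1)[OF max_prem])
  have mj: "\<bar>m - \<mu>\<bar> / real j \<le> \<eta> / 8" "m / real j \<le> \<eta> / 4"
  proof -
    have "\<bar>m - \<mu>\<bar> \<le> \<mu>" using \<mu> by linarith
    then have "\<bar>m - \<mu>\<bar> / real j \<le> \<mu> / real j" by (intro divide_right_mono) auto
    then show "\<bar>m - \<mu>\<bar> / real j \<le> \<eta> / 8" using j_mu by linarith
    have "m / real j \<le> 2 * \<mu> / real j" using \<mu> by (intro divide_right_mono) auto
    then show "m / real j \<le> \<eta> / 4" using j_mu by linarith
  qed
  \<comment> \<open>Centring with \<open>m\<close> instead of the limit \<open>\<mu>\<close> costs \<open>\<eta> / 8\<close>, which leaves \<open>\<eta> / 8\<close> of the deviation \<open>\<eta> / 4\<close>.\<close>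
  have F_prob: "prob (F k) \<le> 2 * expectation (\<lambda>\<omega>. min 1 ((\<bar>grid_increments j X \<omega> k - \<mu> / real j\<bar> / (\<eta> / 8)) ^ 4))" for k
  proof -
    let ?h = "\<lambda>\<omega>. min 1 ((\<bar>grid_increments j X \<omega> k - \<mu> / real j\<bar> / (\<eta> / 8)) ^ 4)"
    let ?S = "{\<omega>\<in>space M. \<bar>centred (real k / real j + 1 / real j) \<omega> - centred (real k / real j) \<omega>\<bar> > \<eta> / 4}"
    note [measurable] = grid_increment_measurable
    have S: "?S \<in> sets M"
    proof -
      have [measurable]: "centred (real k / real j + 1 / real j) \<in> borel_measurable M" "centred (real k / real j) \<in> borel_measurable M"
        using j by (auto intro!: centred_measurable)
      show ?thesis by measurable
    qed
    have h_int: "integrable M ?h"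
      by (rule integrable_const_bound[of _ 1]) (simp_all only: real_norm_def truncated_quartic_bound AE_I2, measurable)
    have "prob (F k) \<le> 2 * prob ?S" unfolding F_def by (rule centred_maximal(2)[OF max_prem])
    also have "prob ?S = expectation (indicator ?S)" using S by simp
    also have "\<dots> \<le> expectation ?h"
    proof (rule integral_mono)
      show "integrable M (indicator ?S :: _ \<Rightarrow> real)" using S by (intro integrable_real_indicator) (auto simp: emeasure_eq_measure)
      fix \<omega> assume w: "\<omega> \<in> space M"
      show "indicator ?S \<omega> \<le> ?h \<omega>"
      proof (cases "\<omega> \<in> ?S")
        case True
        have "real k / real j + 1 / real j = real (Suc k) / real j" by (simp add: add_divide_distrib)
        then have "centred (real k / real j + 1 / real j) \<omega> - centred (real k / real j) \<omega> = grid_increments j X \<omega> k - m / real j"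
          by (simp add: centred_def grid_increments_def add_divide_distrib distrib_left add.commute)
        then have "\<eta> / 4 < \<bar>grid_increments j X \<omega> k - m / real j\<bar>" using True by simp
        moreover have "\<bar>\<mu> / real j - m / real j\<bar> \<le> \<eta> / 8" using mj(1) j by (simp add: diff_divide_distrib[symmetric] abs_minus_commute)
        ultimately have "\<eta> / 8 \<le> \<bar>grid_increments j X \<omega> k - \<mu> / real j\<bar>" by linarith
        then have "1 \<le> \<bar>grid_increments j X \<omega> k - \<mu> / real j\<bar> / (\<eta> / 8)" using \<eta> by (subst pos_le_divide_eq) auto
        then have "1 \<le> (\<bar>grid_increments j X \<omega> k - \<mu> / real j\<bar> / (\<eta> / 8)) ^ 4" by (rule one_le_power)
        then show ?thesis by (simp add: indicator_def)
      next
        case False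
        then have "indicator ?S \<omega> = (0::real)" by (rule indicator_simps)
        then show ?thesis using truncated_quartic_nonneg by simp
      qed
    qed (rule h_int)
    finally show ?thesis by simp
  qed
  have "prob (L \<union> (\<Union>k\<in>{..<T * j}. F k)) \<le> prob L + prob (\<Union>k\<in>{..<T * j}. F k)"
    using L(1) F_sets by (intro measure_Un_le) auto
  also have "prob L \<le> (8 + 512 / \<mu>\<^sup>2) * v / C"
  proof -
    have "(\<mu> / 2)\<^sup>2 \<le> m\<^sup>2" using \<mu> by (intro power_mono) auto
    then have "128 / m\<^sup>2 \<le> 128 / (\<mu> / 2)\<^sup>2" using \<mu> mpos by (intro divide_left_mono mult_pos_pos) auto
    then have "(8 + 128 / m\<^sup>2) * v / C \<le> (8 + 512 / \<mu>\<^sup>2) * v / C"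
      using v_nonneg C by (intro divide_right_mono mult_right_mono) (auto simp: power_divide)
    then show ?thesis using L(2) by linarith
  qed
  also have "prob (\<Union>k\<in>{..<T * j}. F k) \<le> (\<Sum>k<T * j. prob (F k))"
    using F_sets by (intro finite_measure_subadditive_finite) auto
  also have "\<dots> \<le> (\<Sum>k<T * j. 2 * expectation (\<lambda>\<omega>. min 1 ((\<bar>grid_increments j X \<omega> k - \<mu> / real j\<bar> / (\<eta> / 8)) ^ 4)))"
    by (intro sum_mono F_prob)
  finally have P: "prob (L \<union> (\<Union>k\<in>{..<T * j}. F k)) \<le> (8 + 512 / \<mu>\<^sup>2) * v / C +
      (\<Sum>k<T * j. 2 * expectation (\<lambda>\<omega>. min 1 ((\<bar>grid_increments j X \<omega> k - \<mu> / real j\<bar> / (\<eta> / 8)) ^ 4)))" by simp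
  show ?thesis
  proof (rule that[OF _ P])
    show "L \<union> (\<Union>k\<in>{..<T * j}. F k) \<in> sets M" using L(1) F_sets by auto
    fix \<omega> assume w: "\<omega> \<in> space M" "\<omega> \<notin> L \<union> (\<Union>k\<in>{..<T * j}. F k)"
    have mod: "\<bar>X s \<omega> - X (real k / real j) \<omega>\<bar> \<le> \<eta>"
      if k: "k < T * j" "real k / real j \<le> s" "s < (real k + 1) / real j" for k s
    proof -
      have "\<omega> \<notin> F k" using w k by auto
      then have "\<bar>centred s \<omega> - centred (real k / real j) \<omega>\<bar> \<le> 2 * (\<eta> / 4)"
        unfolding F_def using w(1) k by (force simp: add_divide_distrib)
      moreover have "X s \<omega> - X (real k / real j) \<omega> = centred s \<omega> - centred (real k / real j) \<omega> + m * (s - real k / real j)"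
        by (simp add: centred_def algebra_simps)
      moreover have "\<bar>m * (s - real k / real j)\<bar> \<le> \<eta> / 4"
      proof -
        have "m * (s - real k / real j) \<le> m * (1 / real j)"
          using k mpos by (intro mult_left_mono) (auto simp: add_divide_distrib)
        moreover have "0 \<le> m * (s - real k / real j)" using k mpos by simp
        moreover have "m * (1 / real j) = m / real j" by simp
        ultimately show ?thesis using mj(2) by linarith
      qed
      ultimately show ?thesis using \<eta> by linarith
    qed
    have low: "(\<mu> / 2) * s / 2 - C \<le> X s \<omega>" if "0 \<le> s" for s
    proof -
      have "(\<mu> / 2) * s / 2 \<le> m * s / 2" using \<mu> that by (intro divide_right_mono mult_right_mono) auto
      then show ?thesis using L(3)[OF w(1) _ that] w(2) by force
    qed
    have "loc_unif_dist (half_line_path X \<omega>) (step_path j (grid_increments j X \<omega>)) \<le> \<eta> + (1/2) ^ (T - 1)"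
    proof (rule loc_unif_dist_le)
      fix t assume t: "0 \<le> t" "t < real T"
      define k where "k = nat \<lfloor>t * real j\<rfloor>"
      have kr: "real k = real_of_int \<lfloor>t * real j\<rfloor>" using t by (simp add: k_def of_nat_floor)
      have ks: "real k / real j \<le> t" "t < (real k + 1) / real j"
        unfolding kr using j floor_correct[of "t * real j"] by (auto simp: pos_divide_le_eq pos_less_divide_eq)
      have "real k \<le> t * real j" unfolding kr using floor_correct by blast
      also have "\<dots> < real (T * j)" using t j by simp
      finally have kT: "k < T * j" by linarith
      have "step_path j (grid_increments j X \<omega>) t = X (real k / real j) \<omega>"
        using t sum_lessThan_telescope[of "\<lambda>i. X (real i / real j) \<omega>" k] X_0[OF w(1)]
        by (simp add: step_path_def grid_increments_def k_def[symmetric])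
      then show "\<bar>half_line_path X \<omega> t - step_path j (grid_increments j X \<omega>) t\<bar> \<le> \<eta>"
        using mod[OF kT ks] t by (simp add: half_line_path_def)
    qed (use \<eta> in auto)
    moreover have "dist (enn2real (exp_functional (half_line_path X \<omega>))) (riemann_functional j T (grid_increments j X \<omega>))
        \<le> 4 * real T * \<eta> * exp (2 * C) + 2 * exp (2 * C) * exp (- (\<mu> / 2) * real T) / (\<mu> / 2)"
      using exp_functional_approx(2)[of "\<lambda>s. X s \<omega>", OF right_cont[OF w(1)] X_0[OF w(1)] _ low j mod less_imp_le[OF \<eta>]] \<mu>
      unfolding dist_real_def half_line_path_def grid_increments_def by simp
    moreover have "prod_dist loc_unif_dist dist (path_with_functional X \<omega>) (discretisation j T (grid_increments j X \<omega>))
      \<le> loc_unif_dist (half_line_path X \<omega>) (step_path j (grid_increments j X \<omega>)) +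
        dist (enn2real (exp_functional (half_line_path X \<omega>))) (riemann_functional j T (grid_increments j X \<omega>))"
      unfolding path_with_functional_def discretisation_def prod_dist_def by (simp add: sqrt_sum_squares_le_sum)
    ultimately show "prod_dist loc_unif_dist dist (path_with_functional X \<omega>) (discretisation j T (grid_increments j X \<omega>))
      \<le> (1 + 4 * real T * exp (2 * C)) * \<eta> + ((1/2) ^ (T - 1) + 4 * exp (2 * C) / \<mu> * exp (- (\<mu> / 2) * real T))"
      by (simp add: algebra_simps)
  qed
qed

text \<open>Outside of events of probability of order \<open>1 / n\<close> the path lies above \<open>m s / 2 - n\<close>.\<close>

lemma exp_functional_finite:
  assumes m: "0 < m"
  shows "AE \<omega> in M. exp_functional (half_line_path X \<omega>) < \<infinity>"
proof -
  have "\<exists>E. E \<in> sets M \<and> prob E \<le> (8 + 128 / m\<^sup>2) * v / real (Suc n) \<and>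
      (\<forall>\<omega>\<in>space M - E. exp_functional (half_line_path X \<omega>) < \<infinity>)" for n :: nat
  proof -
    have C: "0 < real (Suc n)" by simp
    obtain E where E: "E \<in> sets M" "prob E \<le> (8 + 128 / m\<^sup>2) * v / real (Suc n)"
      "\<And>\<omega> s. \<omega> \<in> space M \<Longrightarrow> \<omega> \<notin> E \<Longrightarrow> 0 \<le> s \<Longrightarrow> m * s / 2 - real (Suc n) \<le> X s \<omega>"
      using linear_lower_bound[OF m C] by blast
    have "exp_functional (half_line_path X \<omega>) < \<infinity>" if "\<omega> \<in> space M" "\<omega> \<notin> E" for \<omega>
      unfolding half_line_path_def
      by (rule exp_functional_approx(1)[of "\<lambda>s. X s \<omega>", OF right_cont X_0 m E(3), where j=1]) (use that in auto)
    then show ?thesis using E by blast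
  qed
  then obtain E where E: "\<And>n. E n \<in> sets M" "\<And>n. prob (E n) \<le> (8 + 128 / m\<^sup>2) * v / real (Suc n)"
    "\<And>n \<omega>. \<omega> \<in> space M - E n \<Longrightarrow> exp_functional (half_line_path X \<omega>) < \<infinity>" by metis
  have "(\<lambda>n. (8 + 128 / m\<^sup>2) * v * inverse (real (Suc n))) \<longlonglongrightarrow> (8 + 128 / m\<^sup>2) * v * 0"
    by (intro tendsto_intros LIMSEQ_inverse_real_of_nat)
  then have lim: "(\<lambda>n. (8 + 128 / m\<^sup>2) * v / real (Suc n)) \<longlonglongrightarrow> 0" by (simp add: divide_inverse)
  have "prob (\<Inter>n. E n) \<le> (8 + 128 / m\<^sup>2) * v / real (Suc n)" for n
  proof -
    have "prob (\<Inter>n. E n) \<le> prob (E n)" using E(1) by (intro finite_measure_mono) auto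
    then show ?thesis using E(2)[of n] by linarith
  qed
  then have "prob (\<Inter>n. E n) \<le> 0" by (intro LIMSEQ_le_const[OF lim]) auto
  then have "(\<Inter>n. E n) \<in> null_sets M" using E(1) by (intro null_setsI) (auto simp: emeasure_eq_measure measure_le_0_iff)
  then show ?thesis
    by (rule AE_I') (use E(3) in fastforce)
qed

end

text \<open>The constants are chosen in the order \<open>C\<close> (for the probability of the linear lower bound), \<open>T\<close>
(for the mass of the functional and the weight of the metric beyond \<open>T\<close>), \<open>\<eta>\<close> (which may depend on
both), \<open>j\<close> and finally the index \<open>n\<close> of the process. That the bound holds for all large \<open>T\<close> and \<open>j\<close>
allows the same discretisation to be used for the limit process, for which the lemma is
applied to a constant sequence.\<close>

lemma discretisation_close:
  fixes P :: "nat \<Rightarrow> 'w measure" and X :: "nat \<Rightarrow> real \<Rightarrow> 'w \<Rightarrow> real"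
  assumes dp: "\<And>n. drift_process (P n) (X n) (m n) v" and m: "m \<longlonglongrightarrow> \<mu>" and \<mu>: "0 < \<mu>"
    and wc: "\<And>j i. 0 < j \<Longrightarrow> weak_conv_m (\<lambda>n. distr (P n) borel (\<lambda>\<omega>. grid_increments j (X n) \<omega> i))
        (normal_law (\<mu> / real j) (1 / real j))"
    and \<epsilon>: "0 < \<epsilon>"
  shows "\<exists>T0::nat. \<forall>T\<ge>T0. \<exists>j0::nat. \<forall>j\<ge>j0. 0 < j \<longrightarrow> (\<forall>\<^sub>F n in sequentially.
      \<exists>E\<in>sets (P n). measure (P n) E \<le> \<epsilon> \<and> (\<forall>\<omega>\<in>space (P n) - E.
        prod_dist loc_unif_dist dist (path_with_functional (X n) \<omega>) (discretisation j T (grid_increments j (X n) \<omega>)) \<le> \<epsilon>))"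
proof -
  have v: "0 \<le> v" by (rule drift_process.v_nonneg[OF dp])
  define C where "C = 2 * (8 + 512 / \<mu>\<^sup>2) * (v + 1) / \<epsilon>"
  have C: "0 < C" unfolding C_def using v \<epsilon> by (intro divide_pos_pos mult_pos_pos) (auto intro!: add_pos_nonneg)
  have C_le: "(8 + 512 / \<mu>\<^sup>2) * v / C \<le> \<epsilon> / 2"
  proof -
    have p: "0 < 8 + 512 / \<mu>\<^sup>2" by (intro add_pos_nonneg) auto
    have "(8 + 512 / \<mu>\<^sup>2) * v / C = \<epsilon> / 2 * (v / (v + 1))"
      unfolding C_def using p v \<epsilon> by (simp add: divide_simps)
    also have "\<dots> \<le> \<epsilon> / 2 * 1" using v \<epsilon> by (intro mult_left_mono) auto
    finally show ?thesis by simp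
  qed
  have "(\<lambda>T. (1/2::real) ^ (T - 1) + 4 * exp (2 * C) / \<mu> * exp (- (\<mu> / 2) * real T)) \<longlonglongrightarrow> 0 + 4 * exp (2 * C) / \<mu> * 0"
  proof (intro tendsto_intros)
    have "(\<lambda>T. (1/2::real) ^ T) \<longlonglongrightarrow> 0" by (rule LIMSEQ_power_zero) simp
    then show "(\<lambda>T. (1/2::real) ^ (T - 1)) \<longlonglongrightarrow> 0" by (subst filterlim_sequentially_Suc[symmetric]) simp
    show "(\<lambda>T. exp (- (\<mu> / 2) * real T)) \<longlonglongrightarrow> 0" using \<mu> by real_asymp
  qed
  then have "eventually (\<lambda>T. (1/2::real) ^ (T - 1) + 4 * exp (2 * C) / \<mu> * exp (- (\<mu> / 2) * real T) < \<epsilon> / 2) sequentially"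
    using \<epsilon> by (intro order_tendstoD(2)[where y=0]) auto
  then obtain T0 where T0: "\<And>T. T0 \<le> T \<Longrightarrow> (1/2::real) ^ (T - 1) + 4 * exp (2 * C) / \<mu> * exp (- (\<mu> / 2) * real T) < \<epsilon> / 2"
    by (auto simp: eventually_sequentially)
  show ?thesis
  proof (rule exI[of _ T0], intro allI impI)
    fix T assume T: "T0 \<le> T"
    define K where "K = 1 + 4 * real T * exp (2 * C)"
    have K: "0 < K" unfolding K_def by (intro add_pos_nonneg) auto
    define \<eta> where "\<eta> = \<epsilon> / (2 * K)"
    have \<eta>: "0 < \<eta>" unfolding \<eta>_def using K \<epsilon> by simp
    \<comment> \<open>In the limit the \<open>T j\<close> cells contribute at most \<open>T j c / j\<^sup>2\<close>; \<open>c + 1\<close> leaves room for a finite \<open>n\<close>.\<close>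
    define c where "c = 6 / (\<eta> / 8) ^ 4"
    have c: "0 \<le> c" using \<eta> by (simp add: c_def)
    have e1: "eventually (\<lambda>j::nat. \<mu> / real j \<le> \<eta> / 8) sequentially"
      "eventually (\<lambda>j::nat. 2 * v / real j \<le> (\<eta> / 4)\<^sup>2) sequentially"
      "eventually (\<lambda>j::nat. real T * (c + 1) / real j \<le> \<epsilon> / 2) sequentially"
    proof -
      have z: "eventually (\<lambda>j::nat. a / real j \<le> b) sequentially" if "0 < b" for a b :: real
      proof -
        have "(\<lambda>j. a / real j) \<longlonglongrightarrow> 0" by (rule lim_const_over_n)
        then show ?thesis using order_tendstoD(2)[of _ 0 sequentially b] that by (force elim: eventually_mono)
      qed
      show "eventually (\<lambda>j::nat. \<mu> / real j \<le> \<eta> / 8) sequentially"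
        "eventually (\<lambda>j::nat. 2 * v / real j \<le> (\<eta> / 4)\<^sup>2) sequentially"
        "eventually (\<lambda>j::nat. real T * (c + 1) / real j \<le> \<epsilon> / 2) sequentially"
        using \<eta> \<epsilon> by (intro z; simp)+
    qed
    then have "eventually (\<lambda>j::nat. \<mu> / real j \<le> \<eta> / 8 \<and> 2 * v / real j \<le> (\<eta> / 4)\<^sup>2 \<and> real T * (c + 1) / real j \<le> \<epsilon> / 2) sequentially"
      by eventually_elim simp
    then obtain j0 where j0: "\<And>j. j0 \<le> j \<Longrightarrow> \<mu> / real j \<le> \<eta> / 8 \<and> 2 * v / real j \<le> (\<eta> / 4)\<^sup>2 \<and> real T * (c + 1) / real j \<le> \<epsilon> / 2"
      unfolding eventually_sequentially by blast
    show "\<exists>j0::nat. \<forall>j\<ge>j0. 0 < j \<longrightarrow> (\<forall>\<^sub>F n in sequentially.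
      \<exists>E\<in>sets (P n). measure (P n) E \<le> \<epsilon> \<and> (\<forall>\<omega>\<in>space (P n) - E.
        prod_dist loc_unif_dist dist (path_with_functional (X n) \<omega>) (discretisation j T (grid_increments j (X n) \<omega>)) \<le> \<epsilon>))"
    proof (intro exI[of _ j0] allI impI)
      fix j assume jj: "j0 \<le> j" and j: "0 < j"
      let ?h = "\<lambda>x. min 1 ((\<bar>x - \<mu> / real j\<bar> / (\<eta> / 8)) ^ 4)"
      have h_lim: "(\<lambda>n. \<integral>\<omega>. ?h (grid_increments j (X n) \<omega> k) \<partial>P n) \<longlonglongrightarrow> (\<integral>x. ?h x \<partial>normal_law (\<mu> / real j) (1 / real j))" for k
      proof -
        have gm: "(\<lambda>\<omega>. grid_increments j (X n) \<omega> k) \<in> borel_measurable (P n)" for n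
          by (rule drift_process.grid_increment_measurable[OF dp])
        have "(\<lambda>n. integral\<^sup>L (distr (P n) borel (\<lambda>\<omega>. grid_increments j (X n) \<omega> k)) ?h) \<longlonglongrightarrow>
            integral\<^sup>L (normal_law (\<mu> / real j) (1 / real j)) ?h"
        proof (rule weak_conv_imp_integral_bdd_continuous_conv[OF _ _ wc[OF j], where B=1])
          show "real_distribution (distr (P n) borel (\<lambda>\<omega>. grid_increments j (X n) \<omega> k))" for n
            by (intro prob_space.real_distribution_distr drift_process.axioms(1)[OF dp] gm)
          show "real_distribution (normal_law (\<mu> / real j) (1 / real j))"
            unfolding real_distribution_def real_distribution_axioms_def using j
            by (auto intro!: prob_space_normal_density)
          show "isCont ?h x" for x using \<eta> by (intro continuous_intros) auto
          show "norm (?h x) \<le> 1" for x unfolding real_norm_def by (rule truncated_quartic_bound)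
        qed
        then show ?thesis by (simp add: integral_distr[OF gm])
      qed
      have "eventually (\<lambda>n. (\<integral>\<omega>. ?h (grid_increments j (X n) \<omega> k) \<partial>P n) < (c / 2 + 1 / 2) / (real j)\<^sup>2) sequentially" for k
      proof (rule order_tendstoD(2)[OF h_lim])
        have "(\<integral>x. ?h x \<partial>normal_law (\<mu> / real j) (1 / real j)) \<le> 3 * (1 / real j)\<^sup>2 / (\<eta> / 8) ^ 4"
          using j \<eta> by (intro normal_truncated_moment) auto
        also have "\<dots> = (c / 2) / (real j)\<^sup>2" unfolding c_def by (simp add: power_divide)
        also have "\<dots> < (c / 2 + 1 / 2) / (real j)\<^sup>2" using j by (intro divide_strict_right_mono) auto
        finally show "(\<integral>x. ?h x \<partial>normal_law (\<mu> / real j) (1 / real j)) < (c / 2 + 1 / 2) / (real j)\<^sup>2" .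
      qed
      then have "eventually (\<lambda>n. \<forall>k\<in>{..<T * j}. (\<integral>\<omega>. ?h (grid_increments j (X n) \<omega> k) \<partial>P n) < (c / 2 + 1 / 2) / (real j)\<^sup>2) sequentially"
        by (intro eventually_ball_finite) auto
      moreover have "eventually (\<lambda>n. \<mu> / 2 < m n) sequentially" "eventually (\<lambda>n. m n < 2 * \<mu>) sequentially"
        using \<mu> by (intro order_tendstoD[OF m]; simp)+
      ultimately show "\<forall>\<^sub>F n in sequentially. \<exists>E\<in>sets (P n). measure (P n) E \<le> \<epsilon> \<and> (\<forall>\<omega>\<in>space (P n) - E.
        prod_dist loc_unif_dist dist (path_with_functional (X n) \<omega>) (discretisation j T (grid_increments j (X n) \<omega>)) \<le> \<epsilon>)"
      proof eventually_elim
        case (elim n)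
        interpret drift_process "P n" "X n" "m n" v by (rule dp)
        obtain E where E: "E \<in> sets (P n)"
          "prob E \<le> (8 + 512 / \<mu>\<^sup>2) * v / C + (\<Sum>k<T * j. 2 * expectation (\<lambda>\<omega>. ?h (grid_increments j (X n) \<omega> k)))"
          "\<And>\<omega>. \<omega> \<in> space (P n) \<Longrightarrow> \<omega> \<notin> E \<Longrightarrow>
            prod_dist loc_unif_dist dist (path_with_functional (X n) \<omega>) (discretisation j T (grid_increments j (X n) \<omega>))
            \<le> (1 + 4 * real T * exp (2 * C)) * \<eta> + ((1/2) ^ (T - 1) + 4 * exp (2 * C) / \<mu> * exp (- (\<mu> / 2) * real T))"
          using path_with_functional_close[of \<mu> j \<eta> C T] \<mu> elim j \<eta> j0[OF jj] C by (metis less_imp_le)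
        have "(\<Sum>k<T * j. 2 * expectation (\<lambda>\<omega>. ?h (grid_increments j (X n) \<omega> k))) \<le> (\<Sum>k<T * j. 2 * ((c / 2 + 1 / 2) / (real j)\<^sup>2))"
          using elim(1) by (intro sum_mono mult_left_mono) (auto intro: less_imp_le)
        also have "\<dots> = real T * (c + 1) / real j" using j by (simp add: field_simps power2_eq_square)
        also have "\<dots> \<le> \<epsilon> / 2" using j0[OF jj] by blast
        finally have "prob E \<le> \<epsilon>" using E(2) C_le by linarith
        moreover have "(1 + 4 * real T * exp (2 * C)) * \<eta> = \<epsilon> / 2"
          unfolding K_def[symmetric] \<eta>_def using K by simp
        then have "prod_dist loc_unif_dist dist (path_with_functional (X n) \<omega>) (discretisation j T (grid_increments j (X n) \<omega>)) \<le> \<epsilon>"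
          if "\<omega> \<in> space (P n)" "\<omega> \<notin> E" for \<omega> using E(3)[OF that] T0[OF T] by linarith
        ultimately show ?case using E(1) by blast
      qed
    qed
  qed
qed

lemma path_with_functional_measurable:
  assumes "drift_process M X m v"
  shows "path_with_functional X \<in> measurable M (cadlag_ball_sigma \<Otimes>\<^sub>M restrict_space borel {0..})"
proof -
  interpret drift_process M X m v by (rule assms)
  have "half_line_path X \<in> measurable M cadlag_ball_sigma"
    by (rule measurable_cadlag_path[OF X_measurable path_cadlag])
  moreover have "(\<lambda>\<omega>. enn2real (exp_functional (half_line_path X \<omega>))) \<in> measurable M (restrict_space borel {0..})"
    by (intro measurable_restrict_space2 measurable_compose[OF exp_functional_measurable[OF X_measurable right_cont]]) auto
  ultimately show ?thesis unfolding path_with_functional_def by (rule measurable_Pair)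
qed

lemma discretisation_in_space:
  assumes "0 < j" shows "discretisation j T u \<in> cadlag_space \<times> {0..}"
  using step_path_cadlag[OF assms] unfolding discretisation_def riemann_functional_def
  by (auto intro!: divide_nonneg_nonneg mult_nonneg_nonneg sum_nonneg)

text \<open>Discretised pairs are continuous functions of the grid increments, so their laws converge. For each
\<open>k\<close> one choice of \<open>T\<close> and \<open>j\<close> makes them \<open>(1/2)^k\<close>-approximations both of the pairs along the sequence
and of the limit, as the approximation principle for expectations requires.\<close>

theorem drift_process_expectation_tendsto:
  fixes P :: "nat \<Rightarrow> 'w measure" and X :: "nat \<Rightarrow> real \<Rightarrow> 'w \<Rightarrow> real" and P' :: "'v measure"
  assumes dp: "\<And>n. drift_process (P n) (X n) (m n) v" and m: "m \<longlonglongrightarrow> \<mu>" and \<mu>: "0 < \<mu>"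
    and wc: "\<And>j i. 0 < j \<Longrightarrow> weak_conv_m (\<lambda>n. distr (P n) borel (\<lambda>\<omega>. grid_increments j (X n) \<omega> i))
        (normal_law (\<mu> / real j) (1 / real j))"
    and dp': "drift_process P' W \<mu> v'"
    and normal: "\<And>j i. 0 < j \<Longrightarrow> distr P' borel (\<lambda>\<omega>. grid_increments j W \<omega> i) = normal_law (\<mu> / real j) (1 / real j)"
    and f: "continuous_map (prod_topology cadlag.mtopology (top_of_set {0..})) euclideanreal f"
    and fm: "f \<in> borel_measurable (cadlag_ball_sigma \<Otimes>\<^sub>M restrict_space borel {0..})"
    and fb: "bounded (f ` (cadlag_space \<times> {0..}))"
  shows "(\<lambda>n. \<integral>\<omega>. f (path_with_functional (X n) \<omega>) \<partial>P n) \<longlonglongrightarrow> (\<integral>\<omega>. f (path_with_functional W \<omega>) \<partial>P')"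
proof -
  let ?near = "\<lambda>Q Z T j \<epsilon>. \<exists>E\<in>sets Q. measure Q E \<le> \<epsilon> \<and> (\<forall>\<omega>\<in>space Q - E.
        prod_dist loc_unif_dist dist (path_with_functional Z \<omega>) (discretisation j T (grid_increments j Z \<omega>)) \<le> \<epsilon>)"
  have pwf: "path_with_functional Z \<omega> \<in> cadlag_space \<times> {0..}" if "drift_process Q Z a b" "\<omega> \<in> space Q" for Q Z a b \<omega>
    using drift_process.path_cadlag[OF that] by (simp add: path_with_functional_def)
  define good where "good k T j \<longleftrightarrow>
    0 < j \<and> (\<forall>\<^sub>F n in sequentially. ?near (P n) (X n) T j ((1/2)^k)) \<and> ?near P' W T j ((1/2)^k)" for k T j
  have "\<exists>T j. good k T j" for k :: nat
  proof -
    have e: "0 < (1/2::real)^k" by simp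
    obtain T1 :: nat where T1: "\<And>T. T1 \<le> T \<Longrightarrow> \<exists>j0. \<forall>j\<ge>j0. 0 < j \<longrightarrow> (\<forall>\<^sub>F n in sequentially. ?near (P n) (X n) T j ((1/2)^k))"
      using discretisation_close[OF dp m \<mu> wc e] by blast
    have wc': "weak_conv_m (\<lambda>n::nat. distr P' borel (\<lambda>\<omega>. grid_increments j W \<omega> i)) (normal_law (\<mu> / real j) (1 / real j))"
      if "0 < j" for j i
      unfolding normal[OF that] weak_conv_m_def weak_conv_def by simp
    obtain T2 :: nat where T2: "\<And>T. T2 \<le> T \<Longrightarrow> \<exists>j0. \<forall>j\<ge>j0. 0 < j \<longrightarrow> (\<forall>\<^sub>F n in sequentially. ?near P' W T j ((1/2)^k))"
      using discretisation_close[of "\<lambda>_. P'" "\<lambda>_. W" "\<lambda>_. \<mu>" v' \<mu>, OF dp' tendsto_const \<mu> wc' e] by blast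
    obtain j1 where j1: "\<And>j. j1 \<le> j \<Longrightarrow> 0 < j \<Longrightarrow> (\<forall>\<^sub>F n in sequentially. ?near (P n) (X n) (max T1 T2) j ((1/2)^k))"
      using T1[of "max T1 T2"] by auto
    obtain j2 where j2: "\<And>j. j2 \<le> j \<Longrightarrow> 0 < j \<Longrightarrow> (\<forall>\<^sub>F n::nat in sequentially. ?near P' W (max T1 T2) j ((1/2)^k))"
      using T2[of "max T1 T2"] by auto
    have "?near P' W (max T1 T2) (Suc (max j1 j2)) ((1/2)^k)" using j2[of "Suc (max j1 j2)"] by simp
    then show ?thesis unfolding good_def using j1[of "Suc (max j1 j2)"]
      by (intro exI[of _ "max T1 T2"] exI[of _ "Suc (max j1 j2)"]) simp
  qed
  then obtain T j where "\<And>k. good k (T k) (j k)" by metis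
  then have j: "\<And>k. 0 < j k" and near: "\<And>k. \<forall>\<^sub>F n in sequentially. ?near (P n) (X n) (T k) (j k) ((1/2)^k)"
    and near': "\<And>k. ?near P' W (T k) (j k) ((1/2)^k)" unfolding good_def by blast+
  show ?thesis
  proof (rule cadlag_half_line.Prod_metric.expectation_tendsto_by_approximation
      [where P=P and P'=P' and A="\<lambda>k n \<omega>. discretisation (j k) (T k) (grid_increments (j k) (X n) \<omega>)"
        and A'="\<lambda>k \<omega>. discretisation (j k) (T k) (grid_increments (j k) W \<omega>)"])
    show "prob_space (P n)" for n by (rule drift_process.axioms(1)[OF dp])
    show "prob_space P'" by (rule drift_process.axioms(1)[OF dp'])
    show "path_with_functional (X n) \<omega> \<in> cadlag_space \<times> {0..}" if "\<omega> \<in> space (P n)" for n \<omega> by (rule pwf[OF dp that])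
    show "path_with_functional W \<omega> \<in> cadlag_space \<times> {0..}" if "\<omega> \<in> space P'" for \<omega> by (rule pwf[OF dp' that])
    show "discretisation (j k) (T k) u \<in> cadlag_space \<times> {0..}" for k u by (rule discretisation_in_space[OF j])
    then show "discretisation (j k) (T k) u \<in> cadlag_space \<times> {0..}" for k u .
    show "continuous_map cadlag_half_line.Prod_metric.mtopology euclideanreal f" unfolding mtopology_cadlag_half_line by (rule f)
    show "(\<lambda>\<omega>. f (path_with_functional (X n) \<omega>)) \<in> borel_measurable (P n)" for n
      by (rule measurable_compose[OF path_with_functional_measurable[OF dp] fm])
    show "(\<lambda>\<omega>. f (path_with_functional W \<omega>)) \<in> borel_measurable P'"
      by (rule measurable_compose[OF path_with_functional_measurable[OF dp'] fm])
    show "bounded (f ` (cadlag_space \<times> {0..}))" by (rule fb)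
    show "\<forall>\<^sub>F n in sequentially. ?near (P n) (X n) (T k) (j k) ((1/2)^k)" for k by (rule near)
    show "?near P' W (T k) (j k) ((1/2)^k)" for k by (rule near')
  next
    fix k and g :: "(real \<Rightarrow> real) \<times> real \<Rightarrow> real" and L B
    assume gL: "\<And>x y. x \<in> cadlag_space \<times> {0..} \<Longrightarrow> y \<in> cadlag_space \<times> {0..} \<Longrightarrow> \<bar>g x - g y\<bar> \<le> L * prod_dist loc_unif_dist dist x y"
      and gB: "\<And>x. x \<in> cadlag_space \<times> {0..} \<Longrightarrow> \<bar>g x\<bar> \<le> B"
    let ?G = "\<lambda>u. g (discretisation (j k) (T k) u)"
    have G: "continuous_on UNIV ?G"
      unfolding discretisation_def by (rule lipschitz_step_continuous[OF j gL])
    have Gm: "?G \<in> borel_measurable borel" by (rule borel_measurable_continuous_onI[OF G])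
    have meas: "(\<lambda>\<omega>. ?G (grid_increments (j k) Z \<omega>)) \<in> borel_measurable Q" if "drift_process Q Z a b" for Q Z a b
      by (rule measurable_compose[OF measurable_coordinatewise_then_product Gm])
        (rule drift_process.grid_increment_measurable[OF that])
    have "(\<lambda>n. \<integral>\<omega>. ?G (\<lambda>i. grid_increments (j k) (X n) \<omega> i) \<partial>P n) \<longlonglongrightarrow> (\<integral>\<omega>. ?G (\<lambda>i. grid_increments (j k) W \<omega> i) \<partial>P')"
    proof (rule indep_sequence_weak_limit[where U="\<lambda>n i \<omega>. grid_increments (j k) (X n) \<omega> i"
          and U'="\<lambda>i \<omega>. grid_increments (j k) W \<omega> i" and g="?G" and B=B])
      show "prob_space (P n)" for n by (rule drift_process.axioms(1)[OF dp])
      show "prob_space P'" by (rule drift_process.axioms(1)[OF dp'])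
      show "prob_space.indep_vars (P n) (\<lambda>_. borel) (\<lambda>i \<omega>. grid_increments (j k) (X n) \<omega> i) UNIV" for n
        by (rule drift_process.grid_increments_indep[OF dp j])
      show "prob_space.indep_vars P' (\<lambda>_. borel) (\<lambda>i \<omega>. grid_increments (j k) W \<omega> i) UNIV"
        by (rule drift_process.grid_increments_indep[OF dp' j])
      show "weak_conv_m (\<lambda>n. distr (P n) borel (\<lambda>\<omega>. grid_increments (j k) (X n) \<omega> i)) (distr P' borel (\<lambda>\<omega>. grid_increments (j k) W \<omega> i))" for i
        unfolding normal[OF j] by (rule wc[OF j])
      show "\<bar>?G u\<bar> \<le> B" for u by (rule gB[OF discretisation_in_space[OF j]])
    qed (rule G)
    then show "(\<forall>n. (\<lambda>\<omega>. ?G (grid_increments (j k) (X n) \<omega>)) \<in> borel_measurable (P n)) \<and>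
      (\<lambda>\<omega>. ?G (grid_increments (j k) W \<omega>)) \<in> borel_measurable P' \<and>
      (\<lambda>n. \<integral>\<omega>. ?G (grid_increments (j k) (X n) \<omega>) \<partial>P n) \<longlonglongrightarrow> (\<integral>\<omega>. ?G (grid_increments (j k) W \<omega>) \<partial>P')"
      using meas[OF dp] meas[OF dp'] by simp
  qed
qed

section \<open>Poisson and normal laws, and Brownian motion\<close>

lemma poisson_has_integral:
  fixes g :: "nat \<Rightarrow> 'b::{banach, second_countable_topology}"
  assumes l: "0 < l" and S: "summable (\<lambda>k. norm ((l ^ k / fact k * exp (- l)) *\<^sub>R g k))"
    and s: "(\<lambda>k. (l ^ k / fact k * exp (- l)) *\<^sub>R g k) sums c"
  shows "has_bochner_integral (measure_pmf (poisson_pmf l)) g c"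
  unfolding measure_pmf_eq_density
proof (rule has_bochner_integral_density)
  have "integrable (count_space UNIV) (\<lambda>k. pmf (poisson_pmf l) k *\<^sub>R g k)"
    using S l by (simp add: integrable_count_space_nat_iff)
  moreover from sums_integral_count_space_nat[OF this] s l
  have "integral\<^sup>L (count_space UNIV) (\<lambda>k. pmf (poisson_pmf l) k *\<^sub>R g k) = c"
    by (simp add: sums_iff)
  ultimately show "has_bochner_integral (count_space UNIV) (\<lambda>k. pmf (poisson_pmf l) k *\<^sub>R g k) c"
    by (simp add: has_bochner_integral_iff)
qed auto

text \<open>From \<open>k p(k) = l p(k - 1)\<close> for the weights \<open>p\<close> one gets the first and second factorial
moments \<open>l\<close> and \<open>l\<^sup>2\<close>.\<close>

lemma poisson_variance:
  assumes l: "0 < l"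
  shows "has_bochner_integral (measure_pmf (poisson_pmf l)) (\<lambda>k. (real k - l)\<^sup>2) l"
proof -
  let ?h = "\<lambda>k. l ^ k / fact k * exp (- l)"
  have h0: "?h sums 1"
    using sums_mult2[OF exp_converges[of l], of "exp (- l)"] by (simp add: exp_minus divide_inverse mult_ac)
  have step: "real (Suc k) * ?h (Suc k) = l * ?h k" for k
    by (simp add: field_simps del: of_nat_Suc)
  have h1: "(\<lambda>k. real k * ?h k) sums l"
  proof -
    have "(\<lambda>k. real (Suc k) * ?h (Suc k)) sums (l * 1)" unfolding step by (rule sums_mult[OF h0])
    from sums_Suc[OF this] show ?thesis by simp
  qed
  have h2: "(\<lambda>k. (real k * (real k - 1)) * ?h k) sums (l * l)"
  proof -
    have eq: "(real (Suc k) * (real (Suc k) - 1)) * ?h (Suc k) = l * (real k * ?h k)" for k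
    proof -
      have "(real (Suc k) * (real (Suc k) - 1)) * ?h (Suc k) = real k * (real (Suc k) * ?h (Suc k))" by simp
      also have "\<dots> = l * (real k * ?h k)" unfolding step by simp
      finally show ?thesis .
    qed
    have "(\<lambda>k. (real (Suc k) * (real (Suc k) - 1)) * ?h (Suc k)) sums (l * l)"
      unfolding eq by (rule sums_mult[OF h1])
    from sums_Suc[OF this] show ?thesis by simp
  qed
  have "(\<lambda>k. (real k * (real k - 1)) * ?h k + (1 - 2 * l) * (real k * ?h k) + l\<^sup>2 * ?h k) sums (l * l + (1 - 2 * l) * l + l\<^sup>2 * 1)"
    by (intro sums_add sums_mult h0 h1 h2)
  also have "(\<lambda>k. (real k * (real k - 1)) * ?h k + (1 - 2 * l) * (real k * ?h k) + l\<^sup>2 * ?h k) = (\<lambda>k. ?h k *\<^sub>R (real k - l)\<^sup>2)"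
  proof
    fix k
    have "x * (x - 1) * h + (1 - 2 * l) * (x * h) + l\<^sup>2 * h = h * (x - l)\<^sup>2" for x h :: real
      by (simp add: power2_eq_square algebra_simps)
    then show "(real k * (real k - 1)) * ?h k + (1 - 2 * l) * (real k * ?h k) + l\<^sup>2 * ?h k = ?h k *\<^sub>R (real k - l)\<^sup>2"
      unfolding real_scaleR_def .
  qed
  also have "l * l + (1 - 2 * l) * l + l\<^sup>2 * 1 = l" by (simp add: power2_eq_square algebra_simps)
  finally have s: "(\<lambda>k. ?h k *\<^sub>R (real k - l)\<^sup>2) sums l" .
  show ?thesis
    using l sums_summable[OF s] by (intro poisson_has_integral s) simp_all
qed

lemma poisson_char:
  assumes l: "0 < l"
  shows "has_bochner_integral (measure_pmf (poisson_pmf l)) (\<lambda>k. iexp (\<theta> * real k)) (exp (of_real l * (iexp \<theta> - 1)))"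
proof (rule poisson_has_integral[OF l])
  let ?h = "\<lambda>k. l ^ k / fact k * exp (- l)"
  have "?h sums 1"
    using sums_mult2[OF exp_converges[of l], of "exp (- l)"] by (simp add: exp_minus divide_inverse mult_ac)
  then show "summable (\<lambda>k. norm (?h k *\<^sub>R iexp (\<theta> * real k)))"
    using l by (simp add: sums_iff)
  have "(\<lambda>k. exp (- of_real l) * ((of_real l * iexp \<theta>) ^ k /\<^sub>R fact k)) sums (exp (- of_real l) * exp (of_real l * iexp \<theta>))"
    by (intro sums_mult exp_converges)
  also have "(\<lambda>k. exp (- of_real l) * ((of_real l * iexp \<theta>) ^ k /\<^sub>R fact k)) = (\<lambda>k. ?h k *\<^sub>R iexp (\<theta> * real k))"
  proof
    fix k
    have "iexp (\<theta> * real k) = iexp \<theta> ^ k" by (simp add: exp_of_nat_mult[symmetric] mult_ac)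
    then show "exp (- of_real l) * ((of_real l * iexp \<theta>) ^ k /\<^sub>R fact k) = ?h k *\<^sub>R iexp (\<theta> * real k)"
      by (simp add: scaleR_conv_of_real power_mult_distrib exp_of_real divide_inverse mult_ac flip: of_real_minus)
  qed
  also have "exp (- of_real l) * exp (of_real l * iexp \<theta>) = exp (of_real l * (iexp \<theta> - 1))"
    by (simp add: exp_add[symmetric] algebra_simps)
  finally show "(\<lambda>k. ?h k *\<^sub>R iexp (\<theta> * real k)) sums exp (of_real l * (iexp \<theta> - 1))" .
qed

lemma normal_law_prob: "0 < b \<Longrightarrow> prob_space (normal_law a b)"
  by (intro prob_space_normal_density) simp

lemma normal_law_real_distribution: "0 < b \<Longrightarrow> real_distribution (normal_law a b)"
  unfolding real_distribution_def real_distribution_axioms_def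
  by (auto intro!: normal_law_prob)

lemma char_normal_law:
  assumes b: "0 < b"
  shows "char (normal_law a b) \<theta> = exp (\<i> * of_real (\<theta> * a) - of_real (b * \<theta>\<^sup>2 / 2))"
proof -
  interpret N: prob_space "normal_law a b" by (rule normal_law_prob[OF b])
  have "distributed (normal_law a b) lborel (\<lambda>x. x) (normal_density a (sqrt b))"
    unfolding distributed_def by (auto simp: distr_id2)
  then have std: "distributed (normal_law a b) lborel (\<lambda>x. (x - a) / sqrt b) std_normal_density"
    using b by (subst (asm) N.normal_standard_normal_convert) auto
  have "char std_normal_distribution (\<theta> * sqrt b) = (CLINT x|distr (normal_law a b) lborel (\<lambda>x. (x - a) / sqrt b). iexp (\<theta> * sqrt b * x))"
    unfolding char_def distributed_distr_eq_density[OF std] by simp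
  also have "\<dots> = (CLINT x|normal_law a b. iexp (\<theta> * sqrt b * ((x - a) / sqrt b)))"
    by (subst integral_distr) auto
  also have "\<dots> = (CLINT x|normal_law a b. iexp (- \<theta> * a) * iexp (\<theta> * x))"
  proof (intro Bochner_Integration.integral_cong refl)
    fix x
    have "\<theta> * sqrt b * ((x - a) / sqrt b) = - \<theta> * a + \<theta> * x" using b by (simp add: field_simps)
    then show "iexp (\<theta> * sqrt b * ((x - a) / sqrt b)) = iexp (- \<theta> * a) * iexp (\<theta> * x)"
      by (simp only: of_real_add distrib_left exp_add)
  qed
  also have "\<dots> = iexp (- \<theta> * a) * char (normal_law a b) \<theta>" unfolding char_def by simp
  finally have "iexp (\<theta> * a) * char std_normal_distribution (\<theta> * sqrt b) = char (normal_law a b) \<theta>"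
    by (simp add: mult.assoc[symmetric] exp_add[symmetric])
  then have "char (normal_law a b) \<theta> = iexp (\<theta> * a) * of_real (exp (- (b * \<theta>\<^sup>2) / 2))"
    using b by (simp add: char_std_normal_distribution power_mult_distrib mult.commute)
  also have "\<dots> = exp (\<i> * of_real (\<theta> * a) - of_real (b * \<theta>\<^sup>2 / 2))"
    unfolding exp_of_real[symmetric] exp_add[symmetric] by (rule arg_cong[where f=exp]) simp
  finally show ?thesis .
qed

text \<open>The events \<open>{U i \<in> A, V i \<in> B}\<close> form intersection-stable families, for which independence
in \<open>i\<close> factorises: first between the two families, then within each. The difference
\<open>U i - V i\<close> is measurable for the sigma-field that they generate.\<close>

lemma (in prob_space) indep_vars_diff:
  fixes U V :: "'i \<Rightarrow> 'a \<Rightarrow> real"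
  assumes I: "finite I" and U: "indep_vars (\<lambda>_. borel) U I" and V: "indep_vars (\<lambda>_. borel) V I"
    and UV: "indep_var (Pi\<^sub>M I (\<lambda>_. borel)) (\<lambda>\<omega>. \<lambda>i\<in>I. U i \<omega>) (Pi\<^sub>M I (\<lambda>_. borel)) (\<lambda>\<omega>. \<lambda>i\<in>I. V i \<omega>)"
  shows "indep_vars (\<lambda>_. borel) (\<lambda>i \<omega>. U i \<omega> - V i \<omega>) I"
proof -
  define G where "G i = {(U i -` A \<inter> space M) \<inter> (V i -` B \<inter> space M) | A B. A \<in> sets borel \<and> B \<in> sets borel}" for i
  have GI: "(U i -` A \<inter> space M) \<inter> (V i -` B \<inter> space M) \<in> G i"
    if "A \<in> sets borel" "B \<in> sets borel" for i A B
    unfolding G_def mem_Collect_eq using that by (intro exI[of _ A] exI[of _ B] conjI refl)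
  have Um: "U i \<in> borel_measurable M" and Vm: "V i \<in> borel_measurable M" if "i \<in> I" for i
    using U V that unfolding indep_vars_def2 by auto
  have cross: "prob (\<Inter>j\<in>J. (U j -` a j \<inter> space M) \<inter> (V j -` b j \<inter> space M)) =
      prob (\<Inter>j\<in>J. U j -` a j \<inter> space M) * prob (\<Inter>j\<in>J. V j -` b j \<inter> space M)"
    if J: "J \<subseteq> I" "J \<noteq> {}" and ab: "\<And>j. j \<in> J \<Longrightarrow> a j \<in> sets borel" "\<And>j. j \<in> J \<Longrightarrow> b j \<in> sets borel" for J a b
  proof -
    have fJ: "finite J" using J(1) I by (rule finite_subset)
    define E where "E c = {x \<in> space (Pi\<^sub>M I (\<lambda>_. borel :: real measure)). \<forall>j\<in>J. x j \<in> c j}" for c :: "'i \<Rightarrow> real set"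
    have E: "E c \<in> sets (Pi\<^sub>M I (\<lambda>_. borel))" if c: "\<And>j. j \<in> J \<Longrightarrow> c j \<in> sets borel" for c
      unfolding E_def
    proof (rule sets.sets_Collect_finite_All[OF _ fJ])
      fix j assume j: "j \<in> J"
      have [measurable]: "c j \<in> sets borel" by (rule c[OF j])
      have [measurable]: "(\<lambda>x. x j) \<in> borel_measurable (Pi\<^sub>M I (\<lambda>_. borel :: real measure))"
        using j J(1) by (intro measurable_component_singleton) auto
      show "{x \<in> space (Pi\<^sub>M I (\<lambda>_. borel :: real measure)). x j \<in> c j} \<in> sets (Pi\<^sub>M I (\<lambda>_. borel))" by measurable
    qed
    have pre: "(\<lambda>\<omega>. \<lambda>i\<in>I. Z i \<omega>) -` E c \<inter> space M = (\<Inter>j\<in>J. Z j -` c j \<inter> space M)" for Z :: "'i \<Rightarrow> 'a \<Rightarrow> real" and c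
      using J unfolding E_def by (auto simp: space_PiM)
    have "(\<lambda>\<omega>. (\<lambda>i\<in>I. U i \<omega>, \<lambda>i\<in>I. V i \<omega>)) -` (E a \<times> E b) \<inter> space M =
        ((\<lambda>\<omega>. \<lambda>i\<in>I. U i \<omega>) -` E a \<inter> space M) \<inter> ((\<lambda>\<omega>. \<lambda>i\<in>I. V i \<omega>) -` E b \<inter> space M)" by auto
    also have "\<dots> = (\<Inter>j\<in>J. (U j -` a j \<inter> space M) \<inter> (V j -` b j \<inter> space M))" unfolding pre using J(2) by auto
    finally have eq: "(\<lambda>\<omega>. (\<lambda>i\<in>I. U i \<omega>, \<lambda>i\<in>I. V i \<omega>)) -` (E a \<times> E b) \<inter> space M =
        (\<Inter>j\<in>J. (U j -` a j \<inter> space M) \<inter> (V j -` b j \<inter> space M))" .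
    have "E a \<in> sets (Pi\<^sub>M I (\<lambda>_. borel))" "E b \<in> sets (Pi\<^sub>M I (\<lambda>_. borel))" using E ab by auto
    from indep_varD[OF UV this] show ?thesis unfolding eq pre .
  qed
  have G: "indep_sets G I"
  proof (rule indep_setsI)
    fix i assume "i \<in> I" then show "G i \<subseteq> events" using Um Vm unfolding G_def by (auto intro!: sets.Int measurable_sets)
  next
    fix A J assume J: "J \<noteq> {}" "J \<subseteq> I" "finite J" and A: "\<forall>j\<in>J. A j \<in> G j"
    from A have "\<forall>j\<in>J. \<exists>a b. A j = (U j -` a \<inter> space M) \<inter> (V j -` b \<inter> space M) \<and> a \<in> sets borel \<and> b \<in> sets borel"
      by (simp only: G_def mem_Collect_eq)
    then obtain a b where ab: "\<And>j. j \<in> J \<Longrightarrow> a j \<in> sets borel" "\<And>j. j \<in> J \<Longrightarrow> b j \<in> sets borel"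
      "\<And>j. j \<in> J \<Longrightarrow> A j = (U j -` a j \<inter> space M) \<inter> (V j -` b j \<inter> space M)" by metis
    have single: "prob (A j) = prob (U j -` a j \<inter> space M) * prob (V j -` b j \<inter> space M)" if j: "j \<in> J" for j
      using cross[of "{j}" a b] j J ab by auto
    have "prob (\<Inter>j\<in>J. A j) = prob (\<Inter>j\<in>J. (U j -` a j \<inter> space M) \<inter> (V j -` b j \<inter> space M))"
      using ab(3) by (intro arg_cong[where f=prob] INF_cong) auto
    also have "\<dots> = prob (\<Inter>j\<in>J. U j -` a j \<inter> space M) * prob (\<Inter>j\<in>J. V j -` b j \<inter> space M)"
      by (rule cross[OF J(2,1) ab(1,2)])
    also have "prob (\<Inter>j\<in>J. U j -` a j \<inter> space M) = (\<Prod>j\<in>J. prob (U j -` a j \<inter> space M))"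
      using U J ab(1) unfolding indep_vars_def2 by (intro indep_setsD) auto
    also have "prob (\<Inter>j\<in>J. V j -` b j \<inter> space M) = (\<Prod>j\<in>J. prob (V j -` b j \<inter> space M))"
      using V J ab(2) unfolding indep_vars_def2 by (intro indep_setsD) auto
    also have "(\<Prod>j\<in>J. prob (U j -` a j \<inter> space M)) * (\<Prod>j\<in>J. prob (V j -` b j \<inter> space M)) = (\<Prod>j\<in>J. prob (A j))"
      using single by (simp add: prod.distrib)
    finally show "prob (\<Inter>j\<in>J. A j) = (\<Prod>j\<in>J. prob (A j))" .
  qed
  have stable: "Int_stable (G i)" for i
    unfolding Int_stable_def
  proof (intro ballI)
    fix x y assume "x \<in> G i" "y \<in> G i"
    then obtain A B A' B' where s: "A \<in> sets borel" "B \<in> sets borel" "A' \<in> sets borel" "B' \<in> sets borel"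
      and xy: "x = (U i -` A \<inter> space M) \<inter> (V i -` B \<inter> space M)" "y = (U i -` A' \<inter> space M) \<inter> (V i -` B' \<inter> space M)"
      unfolding G_def by blast
    have "x \<inter> y = (U i -` (A \<inter> A') \<inter> space M) \<inter> (V i -` (B \<inter> B') \<inter> space M)" unfolding xy by auto
    moreover have "A \<inter> A' \<in> sets borel" "B \<inter> B' \<in> sets borel" using s by auto
    ultimately show "x \<inter> y \<in> G i" by (simp only: GI)
  qed
  have "indep_sets (\<lambda>i. {(\<lambda>\<omega>. U i \<omega> - V i \<omega>) -` A \<inter> space M | A. A \<in> sets borel}) I"
  proof (rule indep_sets_mono_sets[OF indep_sets_sigma[OF G stable]])
    fix i assume "i \<in> I"
    define S where "S = sigma (space M) (G i)"
    have GP: "G i \<subseteq> Pow (space M)" unfolding G_def by auto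
    have sp: "space S = space M" and st: "sets S = sigma_sets (space M) (G i)"
      unfolding S_def using GP by (auto simp: sets_measure_of space_measure_of)
    have [measurable]: "U i \<in> borel_measurable S"
    proof (rule measurableI)
      fix A :: "real set" assume "A \<in> sets borel"
      then have "(U i -` A \<inter> space M) \<inter> (V i -` UNIV \<inter> space M) \<in> G i" by (intro GI) auto
      then show "U i -` A \<inter> space S \<in> sets S" unfolding sp st by (simp add: Int_absorb2)
    qed simp
    have [measurable]: "V i \<in> borel_measurable S"
    proof (rule measurableI)
      fix B :: "real set" assume "B \<in> sets borel"
      then have "(U i -` UNIV \<inter> space M) \<inter> (V i -` B \<inter> space M) \<in> G i" by (intro GI) auto
      moreover have "(U i -` UNIV \<inter> space M) \<inter> (V i -` B \<inter> space M) = V i -` B \<inter> space M" by auto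
      ultimately show "V i -` B \<inter> space S \<in> sets S" unfolding sp st by simp
    qed simp
    have D: "(\<lambda>\<omega>. U i \<omega> - V i \<omega>) \<in> borel_measurable S" by measurable
    show "{(\<lambda>\<omega>. U i \<omega> - V i \<omega>) -` A \<inter> space M | A. A \<in> sets borel} \<subseteq> sigma_sets (space M) (G i)"
    proof
      fix x assume "x \<in> {(\<lambda>\<omega>. U i \<omega> - V i \<omega>) -` A \<inter> space M | A. A \<in> sets borel}"
      then obtain A where "x = (\<lambda>\<omega>. U i \<omega> - V i \<omega>) -` A \<inter> space M" "A \<in> sets borel" by (simp only: mem_Collect_eq) metis
      then show "x \<in> sigma_sets (space M) (G i)" using measurable_sets[OF D, of A] unfolding sp st by simp
    qed
  qed
  then show ?thesis unfolding indep_vars_def2 using Um Vm by auto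
qed

lemma brownian_drift_process:
  assumes "standard_brownian_motion N B"
  shows "drift_process N (\<lambda>t \<omega>. B t \<omega> + \<mu> * t) \<mu> 1"
    and "0 < j \<Longrightarrow> distr N borel (\<lambda>\<omega>. grid_increments j (\<lambda>t \<omega>. B t \<omega> + \<mu> * t) \<omega> i) = normal_law (\<mu> / real j) (1 / real j)"
proof -
  interpret prob_space N using assms unfolding standard_brownian_motion_def by blast
  have meas: "\<And>t. 0 \<le> t \<Longrightarrow> B t \<in> borel_measurable N"
    and B0: "\<And>\<omega>. \<omega> \<in> space N \<Longrightarrow> B 0 \<omega> = 0"
    and cont: "\<And>\<omega>. \<omega> \<in> space N \<Longrightarrow> continuous_on {0..} (\<lambda>t. B t \<omega>)"
    and ind: "indep_increments N B"
    and dist: "\<And>s t. 0 \<le> s \<Longrightarrow> s < t \<Longrightarrow> distributed N lborel (\<lambda>\<omega>. B t \<omega> - B s \<omega>) (normal_density 0 (sqrt (t - s)))"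
    using assms unfolding standard_brownian_motion_def by blast+
  show "drift_process N (\<lambda>t \<omega>. B t \<omega> + \<mu> * t) \<mu> 1"
  proof (unfold_locales)
    show "(\<lambda>\<omega>. B t \<omega> + \<mu> * t) \<in> borel_measurable N" if "0 \<le> t" for t using meas[OF that] by measurable
    show "B 0 \<omega> + \<mu> * 0 = 0" if "\<omega> \<in> space N" for \<omega> using B0[OF that] by simp
    show "half_line_path (\<lambda>t \<omega>. B t \<omega> + \<mu> * t) \<omega> \<in> cadlag_space" if w: "\<omega> \<in> space N" for \<omega>
    proof -
      have within: "((\<lambda>t. B t \<omega>) \<longlongrightarrow> B t \<omega>) (at t within {0..})" if "0 \<le> t" for t
        using cont[OF w] that by (auto simp: continuous_on_def)
      have r: "((\<lambda>t. B t \<omega>) \<longlongrightarrow> B t \<omega>) (at_right t)" if "0 \<le> t" for t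
        by (rule tendsto_within_subset[OF within]) (use that in auto)
      have l: "((\<lambda>t. B t \<omega>) \<longlongrightarrow> B t \<omega>) (at_left t)" if "0 < t" for t
      proof -
        have "at t within {0..} = at t" using that by (intro at_within_interior) simp
        then have "((\<lambda>t. B t \<omega>) \<longlongrightarrow> B t \<omega>) (at t)" using within[of t] that by simp
        then show ?thesis by (simp add: filterlim_at_split)
      qed
      show ?thesis unfolding half_line_path_cadlag_iff by (auto intro!: tendsto_intros r exI l)
    qed
    show "indep_increments N (\<lambda>t \<omega>. B t \<omega> + \<mu> * t)"
      unfolding indep_increments_def
    proof (intro allI impI)
      fix n and t :: "nat \<Rightarrow> real" assume "0 \<le> t 0" "strict_mono_on {..n} t"
      then have "indep_vars (\<lambda>_. borel) (\<lambda>i \<omega>. B (t (Suc i)) \<omega> - B (t i) \<omega>) {..<n}"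
        using ind unfolding indep_increments_def by blast
      from indep_vars_compose2[OF this, of "\<lambda>i x. x + \<mu> * (t (Suc i) - t i)" "\<lambda>_. borel"]
      show "indep_vars (\<lambda>_. borel) (\<lambda>i \<omega>. (B (t (Suc i)) \<omega> + \<mu> * t (Suc i)) - (B (t i) \<omega> + \<mu> * t i)) {..<n}"
        by (simp add: algebra_simps)
    qed
    fix s t :: real assume st: "0 \<le> s" "s < t"
    have pos: "0 < sqrt (t - s)" using st by simp
    have eq: "(B t \<omega> + \<mu> * t) - (B s \<omega> + \<mu> * s) - \<mu> * (t - s) = B t \<omega> - B s \<omega>" for \<omega> by (simp add: algebra_simps)
    have "has_bochner_integral lborel (\<lambda>x. normal_density 0 (sqrt (t - s)) x * x\<^sup>2) (t - s)"
    proof -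
      have "fact (2 * 1) / ((2 / (sqrt (t - s))\<^sup>2) ^ 1 * fact 1) = t - s" using st by (simp add: fact_numeral field_simps)
      moreover have "(x - 0) ^ (2 * 1) = x\<^sup>2" for x :: real by simp
      ultimately show ?thesis using normal_moment_even[OF pos, of 0 1] by (simp only:)
    qed
    then show "integrable N (\<lambda>\<omega>. ((B t \<omega> + \<mu> * t) - (B s \<omega> + \<mu> * s) - \<mu> * (t - s))\<^sup>2)"
      "expectation (\<lambda>\<omega>. ((B t \<omega> + \<mu> * t) - (B s \<omega> + \<mu> * s) - \<mu> * (t - s))\<^sup>2) \<le> 1 * (t - s)"
      unfolding eq using distributed_integrable[OF dist[OF st], of "\<lambda>x. x\<^sup>2"] distributed_integral[OF dist[OF st], of "\<lambda>x. x\<^sup>2"]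
      by (auto simp: has_bochner_integral_iff)
  qed
  assume j: "0 < j"
  have st: "0 \<le> real i / real j" "real i / real j < real (Suc i) / real j" using j by (auto simp: divide_strict_right_mono)
  have len: "real (Suc i) / real j - real i / real j = 1 / real j" by (simp add: diff_divide_distrib[symmetric])
  have "distributed N lborel (\<lambda>\<omega>. \<mu> / real j + 1 * (B (real (Suc i) / real j) \<omega> - B (real i / real j) \<omega>))
      (normal_density (\<mu> / real j + 1 * 0) (\<bar>1\<bar> * sqrt (1 / real j)))"
    using dist[OF st] j unfolding len by (intro normal_density_affine) auto
  moreover have "\<mu> / real j + 1 * (B (real (Suc i) / real j) \<omega> - B (real i / real j) \<omega>) = grid_increments j (\<lambda>t \<omega>. B t \<omega> + \<mu> * t) \<omega> i" for \<omega>
    unfolding grid_increments_def using len[symmetric] by (simp add: add_divide_distrib algebra_simps)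
  ultimately have "distributed N lborel (\<lambda>\<omega>. grid_increments j (\<lambda>t \<omega>. B t \<omega> + \<mu> * t) \<omega> i) (normal_density (\<mu> / real j) (sqrt (1 / real j)))"
    by simp
  from distributed_distr_eq_density[OF this]
  have "distr N lborel (\<lambda>\<omega>. grid_increments j (\<lambda>t \<omega>. B t \<omega> + \<mu> * t) \<omega> i) = normal_law (\<mu> / real j) (1 / real j)" .
  moreover have "distr N lborel f = distr N borel f" for f :: "_ \<Rightarrow> real" by (rule distr_cong) simp_all
  ultimately show "distr N borel (\<lambda>\<omega>. grid_increments j (\<lambda>t \<omega>. B t \<omega> + \<mu> * t) \<omega> i) = normal_law (\<mu> / real j) (1 / real j)"
    by simp
qed

section \<open>The rescaled difference of two Poisson processes\<close>

definition scaled_zeta :: "real \<Rightarrow> (real \<Rightarrow> 'a \<Rightarrow> nat) \<Rightarrow> (real \<Rightarrow> 'a \<Rightarrow> nat) \<Rightarrow> real \<Rightarrow> 'a \<Rightarrow> real" where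
  "scaled_zeta q P Q t \<omega> = - ln q / 2 * zeta P Q \<omega> (2 * t / (1 - q)\<^sup>2)"

lemma W_q_eq: "W_q q (zeta P Q \<omega>) = half_line_path (scaled_zeta q P Q) \<omega>"
  by (simp add: W_q_def half_line_path_def scaled_zeta_def)

lemma W_drift_eq: "W_drift \<mu> B \<omega> = half_line_path (\<lambda>t \<omega>. B t \<omega> + \<mu> * t) \<omega>"
  by (simp add: W_drift_def half_line_path_def)

text \<open>The substitution \<open>s = 2 t / (1 - q)\<^sup>2\<close> turns \<open>q powr \<zeta> s\<close> into \<open>exp (- 2 W t)\<close>; the factor
2 of the exponential functional is absorbed by the Jacobian.\<close>

lemma exp_functional_W_q:
  assumes q: "0 < q" "q < 1"
    and rc: "\<And>t. 0 \<le> t \<Longrightarrow> (\<zeta> \<longlongrightarrow> \<zeta> t) (at_right t)"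
  shows "ennreal ((1 - q)\<^sup>2) * I_q q \<zeta> = exp_functional (W_q q \<zeta>)"
proof -
  define c where "c = 2 / (1 - q)\<^sup>2"
  have c: "0 < c" using q by (simp add: c_def)
  note [measurable] = right_cont_path_measurable[OF rc]
  define F where "F s = ennreal (exp (ln q * \<zeta> (max 0 s))) * indicator {0..} s" for s
  have Fm: "F \<in> borel_measurable borel" unfolding F_def by measurable
  have "I_q q \<zeta> = (\<integral>\<^sup>+s. F s \<partial>lborel)"
    unfolding I_q_def F_def using q by (intro nn_integral_cong) (auto simp: powr_def mult.commute split: split_indicator)
  also have "\<dots> = ennreal \<bar>c\<bar> * (\<integral>\<^sup>+t. F (0 + c * t) \<partial>lborel)"
    by (rule nn_integral_real_affine[OF Fm]) (use c in simp)
  also have "(\<integral>\<^sup>+t. F (0 + c * t) \<partial>lborel) = (\<integral>\<^sup>+t\<in>{0..}. ennreal (exp (- 2 * W_q q \<zeta> t)) \<partial>lborel)"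
  proof (rule nn_integral_cong)
    fix t
    show "F (0 + c * t) = ennreal (exp (- 2 * W_q q \<zeta> t)) * indicator {0..} t"
    proof (cases "0 \<le> t")
      case True
      then have "0 \<le> c * t" using c by simp
      moreover have "2 * t / (1 - q)\<^sup>2 = c * t" by (simp add: c_def)
      ultimately show ?thesis using True by (simp add: F_def W_q_def)
    next
      case False
      then have "\<not> 0 \<le> c * t" using c by (simp add: zero_le_mult_iff)
      then show ?thesis using False by (simp add: F_def)
    qed
  qed
  finally have "ennreal ((1 - q)\<^sup>2) * I_q q \<zeta> =
      (ennreal ((1 - q)\<^sup>2) * ennreal c) * (\<integral>\<^sup>+t\<in>{0..}. ennreal (exp (- 2 * W_q q \<zeta> t)) \<partial>lborel)"
    using c by (simp add: mult.assoc)
  also have "ennreal ((1 - q)\<^sup>2) * ennreal c = 2"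
    using q by (simp add: c_def flip: ennreal_mult)
  finally show ?thesis by (simp add: exp_functional_def)
qed

lemma mono_left_limit:
  fixes f :: "real \<Rightarrow> real"
  assumes mono: "mono_on {0..} f" and t: "0 < t"
  shows "\<exists>l. (f \<longlongrightarrow> l) (at_left t)"
proof -
  have "(f \<longlongrightarrow> Sup (f ` ({..<t} \<inter> {0..}))) (at t within ({..<t} \<inter> {0..}))"
    by (rule Lim_left_bound[where K="f t"]) (use mono t in \<open>auto simp: mono_on_def\<close>)
  moreover have "at t within ({..<t} \<inter> {0..}) = at_left t"
    by (rule at_within_nhd[of t "{0<..}"]) (use t in auto)
  ultimately show ?thesis by auto
qed

lemma filterlim_scale_right:
  fixes c :: real assumes "0 < c" shows "filterlim (\<lambda>s. c * s) (at_right (c * t)) (at_right t)"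
  using assms by (auto simp: filterlim_at eventually_at_right_field intro!: tendsto_intros exI[of _ "t + 1"])

lemma filterlim_scale_left:
  fixes c :: real assumes "0 < c" shows "filterlim (\<lambda>s. c * s) (at_left (c * t)) (at_left t)"
  using assms by (auto simp: filterlim_at eventually_at_left_field intro!: tendsto_intros exI[of _ "t - 1"])

lemma poisson_processD:
  assumes "poisson_process M r R"
  shows "0 \<le> t \<Longrightarrow> R t \<in> measurable M (count_space UNIV)"
    and "\<omega> \<in> space M \<Longrightarrow> R 0 \<omega> = 0"
    and "\<omega> \<in> space M \<Longrightarrow> mono_on {0..} (\<lambda>t. R t \<omega>)"
    and "\<omega> \<in> space M \<Longrightarrow> 0 \<le> t \<Longrightarrow> ((\<lambda>s. real (R s \<omega>)) \<longlongrightarrow> real (R t \<omega>)) (at_right t)"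
    and "indep_increments M (\<lambda>t \<omega>. real (R t \<omega>))"
    and "0 \<le> s \<Longrightarrow> s < t \<Longrightarrow> distr M (count_space UNIV) (\<lambda>\<omega>. R t \<omega> - R s \<omega>) = measure_pmf (poisson_pmf (r * (t - s)))"
  using assms unfolding poisson_process_def by blast+

text \<open>The law of an increment is given for the truncated difference of natural numbers, which is the true
difference because the paths are nondecreasing.\<close>

lemma poisson_increment_has_integral:
  fixes g :: "real \<Rightarrow> 'b::{banach, second_countable_topology}"
  assumes R: "poisson_process M r R" and st: "0 \<le> s" "s < t" and g[measurable]: "g \<in> borel_measurable borel"
    and int: "has_bochner_integral (measure_pmf (poisson_pmf (r * (t - s)))) (\<lambda>k. g (real k)) x"
  shows "has_bochner_integral M (\<lambda>\<omega>. g (real (R t \<omega>) - real (R s \<omega>))) x"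
proof -
  note [measurable] = poisson_processD(1)[OF R]
  have m: "(\<lambda>\<omega>. R t \<omega> - R s \<omega>) \<in> measurable M (count_space UNIV)"
    using st poisson_processD(1)[OF R, of t] poisson_processD(1)[OF R, of s] by simp
  have "has_bochner_integral (distr M (count_space UNIV) (\<lambda>\<omega>. R t \<omega> - R s \<omega>)) (\<lambda>k. g (real k)) x"
    unfolding poisson_processD(6)[OF R st] by (rule int)
  then have "has_bochner_integral M (\<lambda>\<omega>. g (real (R t \<omega> - R s \<omega>))) x"
    unfolding has_bochner_integral_iff by (simp add: integrable_distr_eq[OF m] integral_distr[OF m])
  also have "?this \<longleftrightarrow> ?thesis"
  proof (rule has_bochner_integral_cong[OF refl _ refl])
    fix \<omega> assume "\<omega> \<in> space M"
    then have "R s \<omega> \<le> R t \<omega>" using poisson_processD(3)[OF R] st by (auto simp: mono_on_def)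
    then show "g (real (R t \<omega> - R s \<omega>)) = g (real (R t \<omega>) - real (R s \<omega>))" by (simp add: of_nat_diff)
  qed
  finally show ?thesis .
qed

locale zeta_process =
  fixes M :: "'a measure" and P Q :: "real \<Rightarrow> 'a \<Rightarrow> nat" and q \<mu> :: real
  assumes q: "0 < q" "q < 1" and \<mu>: "0 < \<mu>"
    and P: "poisson_process M 1 P" and Q: "poisson_process M (q powr \<mu>) Q"
    and PQ: "indep_counting_processes M P Q"
begin

sublocale prob_space M using P by (simp add: poisson_process_def)

abbreviation "X \<equiv> scaled_zeta q P Q"
abbreviation "a \<equiv> - ln q / 2"
abbreviation "c \<equiv> 2 / (1 - q)\<^sup>2"
abbreviation "z \<equiv> q powr \<mu>"

lemma constants_pos: "0 < a" "0 < c" "0 < z" "z < 1"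
  using q \<mu> powr_less_mono2[of \<mu> q 1] by auto

lemma zeta_right_cont:
  assumes "\<omega> \<in> space M" "0 \<le> t" shows "(zeta P Q \<omega> \<longlongrightarrow> zeta P Q \<omega> t) (at_right t)"
  unfolding zeta_def[abs_def] using assms by (intro tendsto_intros poisson_processD(4)[OF P] poisson_processD(4)[OF Q])

lemma zeta_left_limit:
  assumes w: "\<omega> \<in> space M" and t: "0 < t" shows "\<exists>l. (zeta P Q \<omega> \<longlongrightarrow> l) (at_left t)"
proof -
  have "mono_on {0..} (\<lambda>t. real (P t \<omega>))" "mono_on {0..} (\<lambda>t. real (Q t \<omega>))"
    using poisson_processD(3)[OF P w] poisson_processD(3)[OF Q w] by (auto simp: mono_on_def)
  from this[THEN mono_left_limit[OF _ t]] obtain l l' where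
    "((\<lambda>t. real (P t \<omega>)) \<longlongrightarrow> l) (at_left t)" "((\<lambda>t. real (Q t \<omega>)) \<longlongrightarrow> l') (at_left t)" by blast
  then have "(zeta P Q \<omega> \<longlongrightarrow> l - l') (at_left t)" unfolding zeta_def[abs_def] by (intro tendsto_intros)
  then show ?thesis by blast
qed

lemma X_eq: "X t \<omega> = a * zeta P Q \<omega> (c * t)"
  by (simp add: scaled_zeta_def)

lemma X_measurable:
  assumes "0 \<le> t" shows "X t \<in> borel_measurable M"
proof -
  have ct: "0 \<le> c * t" using assms constants_pos by simp
  have [measurable]: "P (c * t) \<in> measurable M (count_space UNIV)" "Q (c * t) \<in> measurable M (count_space UNIV)"
    by (rule poisson_processD(1)[OF P ct], rule poisson_processD(1)[OF Q ct])
  show ?thesis unfolding X_eq[abs_def] zeta_def by measurable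
qed

lemma X_cadlag:
  assumes w: "\<omega> \<in> space M" shows "half_line_path X \<omega> \<in> cadlag_space"
  unfolding half_line_path_cadlag_iff
proof (intro conjI allI impI)
  fix t :: real assume t: "0 \<le> t"
  then have "0 \<le> c * t" using constants_pos by simp
  from filterlim_compose[OF zeta_right_cont[OF w this] filterlim_scale_right[OF constants_pos(2)]]
  show "((\<lambda>s. X s \<omega>) \<longlongrightarrow> X t \<omega>) (at_right t)" unfolding X_eq by (intro tendsto_intros)
next
  fix t :: real assume t: "0 < t"
  then have "0 < c * t" using constants_pos by simp
  then obtain l where "(zeta P Q \<omega> \<longlongrightarrow> l) (at_left (c * t))" using zeta_left_limit[OF w] by blast
  from filterlim_compose[OF this filterlim_scale_left[OF constants_pos(2)]]
  have "((\<lambda>s. X s \<omega>) \<longlongrightarrow> a * l) (at_left t)" unfolding X_eq by (intro tendsto_intros)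
  then show "\<exists>l. ((\<lambda>s. X s \<omega>) \<longlongrightarrow> l) (at_left t)" by blast
qed

lemma indep_var_functionals:
  assumes "f \<in> measurable (Pi\<^sub>M {0..} (\<lambda>_. count_space UNIV)) S" "g \<in> measurable (Pi\<^sub>M {0..} (\<lambda>_. count_space UNIV)) T"
  shows "indep_var S (\<lambda>\<omega>. f (\<lambda>t\<in>{0::real..}. P t \<omega>)) T (\<lambda>\<omega>. g (\<lambda>t\<in>{0::real..}. Q t \<omega>))"
  using indep_var_compose[OF PQ[unfolded indep_counting_processes_def] assms] by (simp add: comp_def)

lemma increment_functional_measurable:
  assumes "0 \<le> s" "0 \<le> t"
  shows "(\<lambda>f. real (f t) - real (f s)) \<in> borel_measurable (Pi\<^sub>M {0::real..} (\<lambda>_. count_space (UNIV :: nat set)))"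
proof -
  have "(\<lambda>f. f u) \<in> measurable (Pi\<^sub>M {0::real..} (\<lambda>_. count_space (UNIV :: nat set))) (count_space UNIV)" if "0 \<le> u" for u
    using that by (intro measurable_component_singleton) auto
  note this[OF assms(1), measurable] this[OF assms(2), measurable]
  show ?thesis by measurable
qed

lemma increments_indep_var:
  assumes st: "0 \<le> s" "0 \<le> t"
  shows "indep_var borel (\<lambda>\<omega>. real (P t \<omega>) - real (P s \<omega>)) borel (\<lambda>\<omega>. real (Q t \<omega>) - real (Q s \<omega>))"
  using indep_var_functionals[OF increment_functional_measurable[OF st] increment_functional_measurable[OF st]] st by simp

lemma zeta_indep_increments:
  assumes t: "0 \<le> t (0::nat)" "strict_mono_on {..n} t"
  shows "indep_vars (\<lambda>_. borel) (\<lambda>i \<omega>. zeta P Q \<omega> (t (Suc i)) - zeta P Q \<omega> (t i)) {..<n}"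
proof -
  have t0: "0 \<le> t i" if "i \<le> n" for i
  proof -
    have "t 0 \<le> t i" using t(2) that by (cases "i = 0") (auto dest!: strict_mono_onD[of _ t 0 i])
    then show ?thesis using t(1) by simp
  qed
  let ?U = "\<lambda>R i \<omega>. real (R (t (Suc i)) \<omega>) - real ((R (t i) \<omega>) :: nat)"
  let ?F = "\<lambda>f. \<lambda>i\<in>{..<n}. real (f (t (Suc i))) - real ((f (t i)) :: nat)"
  have Fm: "?F \<in> measurable (Pi\<^sub>M {0::real..} (\<lambda>_. count_space (UNIV :: nat set))) (Pi\<^sub>M {..<n} (\<lambda>_. borel))"
    by (rule measurable_restrict) (auto intro!: increment_functional_measurable t0)
  have F: "?F (\<lambda>t\<in>{0..}. R t \<omega>) = (\<lambda>i\<in>{..<n}. ?U R i \<omega>)" for R :: "real \<Rightarrow> 'a \<Rightarrow> nat" and \<omega>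
    using t0 by (auto simp: restrict_def fun_eq_iff)
  have "indep_vars (\<lambda>_. borel) (\<lambda>i \<omega>. ?U P i \<omega> - ?U Q i \<omega>) {..<n}"
  proof (rule indep_vars_diff)
    show "indep_vars (\<lambda>_. borel) (?U P) {..<n}" "indep_vars (\<lambda>_. borel) (?U Q) {..<n}"
      using poisson_processD(5)[OF P] poisson_processD(5)[OF Q] t unfolding indep_increments_def by blast+
    show "indep_var (Pi\<^sub>M {..<n} (\<lambda>_. borel)) (\<lambda>\<omega>. \<lambda>i\<in>{..<n}. ?U P i \<omega>) (Pi\<^sub>M {..<n} (\<lambda>_. borel)) (\<lambda>\<omega>. \<lambda>i\<in>{..<n}. ?U Q i \<omega>)"
      using indep_var_functionals[OF Fm Fm] unfolding F .
  qed simp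
  also have "(\<lambda>i \<omega>. ?U P i \<omega> - ?U Q i \<omega>) = (\<lambda>i \<omega>. zeta P Q \<omega> (t (Suc i)) - zeta P Q \<omega> (t i))"
    by (simp add: zeta_def fun_eq_iff)
  finally show ?thesis .
qed

lemma X_increment:
  "X t \<omega> - X s \<omega> = a * (real (P (c * t) \<omega>) - real (P (c * s) \<omega>)) + (- a) * (real (Q (c * t) \<omega>) - real (Q (c * s) \<omega>))"
  unfolding X_eq zeta_def by (simp add: algebra_simps)

text \<open>The variance is bounded through \<open>(x - y)\<^sup>2 \<le> 2 (x\<^sup>2 + y\<^sup>2)\<close>. This loses a factor 2
against the exact value \<open>a\<^sup>2 c (1 + z)\<close>, but the bound still has a finite limit as \<open>q\<close> tends to 1.\<close>

lemma scaled_zeta_drift_process: "drift_process M X (a * c * (1 - z)) (2 * a\<^sup>2 * c * (1 + z))"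
proof
  show "X t \<in> borel_measurable M" if "0 \<le> t" for t by (rule X_measurable[OF that])
  show "X 0 \<omega> = 0" if "\<omega> \<in> space M" for \<omega>
    using poisson_processD(2)[OF P that] poisson_processD(2)[OF Q that] by (simp add: scaled_zeta_def zeta_def)
  show "half_line_path X \<omega> \<in> cadlag_space" if "\<omega> \<in> space M" for \<omega> by (rule X_cadlag[OF that])
  show "indep_increments M X"
    unfolding indep_increments_def
  proof (intro allI impI)
    fix n and t :: "nat \<Rightarrow> real" assume t: "0 \<le> t 0" "strict_mono_on {..n} t"
    have "0 \<le> c * t 0" using t constants_pos by simp
    moreover have "strict_mono_on {..n} (\<lambda>i. c * t i)"
      using t(2) constants_pos(2) unfolding strict_mono_on_def by (simp only: mult_less_cancel_left_pos) 
    ultimately have "indep_vars (\<lambda>_. borel) (\<lambda>i \<omega>. zeta P Q \<omega> (c * t (Suc i)) - zeta P Q \<omega> (c * t i)) {..<n}"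
      by (rule zeta_indep_increments)
    from indep_vars_compose2[OF this, of "\<lambda>i x. a * x" "\<lambda>_. borel"]
    show "indep_vars (\<lambda>_. borel) (\<lambda>i \<omega>. X (t (Suc i)) \<omega> - X (t i) \<omega>) {..<n}"
      unfolding X_eq right_diff_distrib by simp
  qed
  fix s t :: real assume st: "0 \<le> s" "s < t"
  have cst: "0 \<le> c * s" "c * s < c * t"
    using st(1) constants_pos(2) mult_strict_left_mono[OF st(2) constants_pos(2)] by simp_all
  define l where "l = c * t - c * s"
  have l: "0 < l" using cst by (simp add: l_def)
  let ?dP = "\<lambda>\<omega>. real (P (c * t) \<omega>) - real (P (c * s) \<omega>)" and ?dQ = "\<lambda>\<omega>. real (Q (c * t) \<omega>) - real (Q (c * s) \<omega>)"
  have vP: "has_bochner_integral M (\<lambda>\<omega>. (?dP \<omega> - l)\<^sup>2) l"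
    by (rule poisson_increment_has_integral[OF P cst, where g="\<lambda>x. (x - l)\<^sup>2"])
      (use poisson_variance[OF l] in \<open>simp_all add: l_def\<close>)
  have vQ: "has_bochner_integral M (\<lambda>\<omega>. (?dQ \<omega> - z * l)\<^sup>2) (z * l)"
    by (rule poisson_increment_has_integral[OF Q cst, where g="\<lambda>x. (x - z * l)\<^sup>2"])
      (use poisson_variance[of "z * l"] l constants_pos in \<open>simp_all add: l_def\<close>)
  let ?D = "\<lambda>\<omega>. (X t \<omega> - X s \<omega> - a * c * (1 - z) * (t - s))\<^sup>2"
  let ?B = "\<lambda>\<omega>. 2 * a\<^sup>2 * ((?dP \<omega> - l)\<^sup>2 + (?dQ \<omega> - z * l)\<^sup>2)"
  have B: "has_bochner_integral M ?B (2 * a\<^sup>2 * (l + z * l))"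
    by (intro has_bochner_integral_mult_right has_bochner_integral_add vP vQ)
  have le: "?D \<omega> \<le> ?B \<omega>" for \<omega>
  proof -
    have "a * c * (1 - z) * (t - s) = a * l - a * (z * l)" unfolding l_def by algebra
    then have "X t \<omega> - X s \<omega> - a * c * (1 - z) * (t - s) = a * ((?dP \<omega> - l) - (?dQ \<omega> - z * l))"
      unfolding X_increment by algebra
    then have "?D \<omega> = a\<^sup>2 * ((?dP \<omega> - l) - (?dQ \<omega> - z * l))\<^sup>2" by (simp only: power_mult_distrib)
    also have "\<dots> \<le> a\<^sup>2 * (2 * ((?dP \<omega> - l)\<^sup>2 + (?dQ \<omega> - z * l)\<^sup>2))"
    proof (rule mult_left_mono)
      have "(x - y)\<^sup>2 \<le> 2 * (x\<^sup>2 + y\<^sup>2)" for x y :: real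
        using zero_le_power2[of "x + y"] by (simp add: power2_eq_square algebra_simps)
      then show "((?dP \<omega> - l) - (?dQ \<omega> - z * l))\<^sup>2 \<le> 2 * ((?dP \<omega> - l)\<^sup>2 + (?dQ \<omega> - z * l)\<^sup>2)" .
    qed simp
    also have "\<dots> = ?B \<omega>" by (simp only: mult_ac)
    finally show ?thesis .
  qed
  show int: "integrable M ?D"
  proof (rule Bochner_Integration.integrable_bound[OF integrable.intros[OF B]])
    have [measurable]: "X s \<in> borel_measurable M" "X t \<in> borel_measurable M" using X_measurable st by auto
    show "?D \<in> borel_measurable M" by measurable
    show "AE \<omega> in M. norm (?D \<omega>) \<le> norm (?B \<omega>)"
      using le by (intro AE_I2) (simp only: real_norm_def, smt (verit) zero_le_power2)
  qed
  have "expectation ?D \<le> expectation ?B"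
    by (intro integral_mono int integrable.intros[OF B] le)
  also have "\<dots> = 2 * a\<^sup>2 * (l + z * l)" by (rule has_bochner_integral_integral_eq[OF B])
  also have "\<dots> = 2 * a\<^sup>2 * c * (1 + z) * (t - s)" unfolding l_def by algebra
  finally show "expectation ?D \<le> 2 * a\<^sup>2 * c * (1 + z) * (t - s)" .
qed

lemma char_scaled_zeta_increment:
  assumes j: "0 < j"
  shows "char (distr M borel (\<lambda>\<omega>. grid_increments j X \<omega> i)) \<theta> =
    exp (of_real (c / real j * (1 + z) * (cos (\<theta> * a) - 1)) + \<i> * of_real (c / real j * (1 - z) * sin (\<theta> * a)))"
proof -
  let ?s = "c * (real i / real j)" and ?t = "c * (real (Suc i) / real j)"
  have st: "0 \<le> ?s" "?s < ?t" "0 \<le> ?t" using constants_pos(2) j by (auto simp: divide_strict_right_mono)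
  have l: "?t - ?s = c / real j"
  proof -
    have "?t - ?s = c * (real (Suc i) / real j - real i / real j)" by (simp only: right_diff_distrib)
    also have "real (Suc i) / real j - real i / real j = 1 / real j" by (simp add: diff_divide_distrib[symmetric])
    finally show ?thesis by simp
  qed
  have lpos: "0 < c / real j" using constants_pos j by simp
  let ?dP = "\<lambda>\<omega>. real (P ?t \<omega>) - real (P ?s \<omega>)" and ?dQ = "\<lambda>\<omega>. real (Q ?t \<omega>) - real (Q ?s \<omega>)"
  have ind: "indep_var borel (\<lambda>\<omega>. a * ?dP \<omega>) borel (\<lambda>\<omega>. (- a) * ?dQ \<omega>)"
    using indep_var_compose[OF increments_indep_var[OF st(1,3)], of "\<lambda>x. a * x" borel "\<lambda>x. (- a) * x" borel]
    by (simp add: comp_def)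
  have chr: "char (distr M borel (\<lambda>\<omega>. b * (real (R ?t \<omega>) - real (R ?s \<omega>)))) \<theta> = exp (of_real (r * (c / real j)) * (iexp (\<theta> * b) - 1))"
    if R: "poisson_process M r R" and r: "0 < r" for R r b
  proof -
    have m: "(\<lambda>\<omega>. b * (real (R ?t \<omega>) - real (R ?s \<omega>))) \<in> borel_measurable M"
      using poisson_processD(1)[OF R st(1)] poisson_processD(1)[OF R st(3)] by measurable
    have "has_bochner_integral M (\<lambda>\<omega>. iexp (\<theta> * b * (real (R ?t \<omega>) - real (R ?s \<omega>))))
        (exp (of_real (r * (c / real j)) * (iexp (\<theta> * b) - 1)))"
      by (rule poisson_increment_has_integral[OF R st(1,2), where g="\<lambda>x. iexp (\<theta> * b * x)"])
        (use poisson_char[of "r * (c / real j)" "\<theta> * b"] r lpos l in simp_all)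
    then show ?thesis unfolding char_def
      by (subst integral_distr[OF m]) (simp_all add: has_bochner_integral_iff mult.assoc)
  qed
  have "(\<lambda>\<omega>. grid_increments j X \<omega> i) = (\<lambda>\<omega>. a * ?dP \<omega> + (- a) * ?dQ \<omega>)"
    unfolding grid_increments_def X_increment by (rule refl)
  then have "char (distr M borel (\<lambda>\<omega>. grid_increments j X \<omega> i)) \<theta> =
      exp (of_real (1 * (c / real j)) * (iexp (\<theta> * a) - 1)) * exp (of_real (z * (c / real j)) * (iexp (\<theta> * (- a)) - 1))"
    using char_distr_add[OF ind] chr[OF P, of a] chr[OF Q, of "- a"] constants_pos by simp
  also have "\<dots> = exp (of_real (c / real j * (1 + z) * (cos (\<theta> * a) - 1)) + \<i> * of_real (c / real j * (1 - z) * sin (\<theta> * a)))"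
  proof -
    have cis: "iexp (\<theta> * b) = of_real (cos (\<theta> * b)) + \<i> * of_real (sin (\<theta> * b))" for b
      by (simp only: exp_Euler cos_of_real sin_of_real)
    have neg: "iexp (\<theta> * (- a)) = of_real (cos (\<theta> * a)) - \<i> * of_real (sin (\<theta> * a))"
      using cis[of "- a"] by (simp only: mult_minus_right cos_minus sin_minus of_real_minus add_uminus_conv_diff)
    have "of_real (1 * k) * (of_real C + \<i> * of_real S - 1) + of_real (z * k) * (of_real C - \<i> * of_real S - 1) =
        of_real (k * (1 + z) * (C - 1)) + \<i> * of_real (k * (1 - z) * S)" for k C S :: real
      by (simp add: algebra_simps)
    then show ?thesis unfolding exp_add[symmetric] neg unfolding cis[of a] by (simp only:)
  qed
  finally show ?thesis .
qed

end

section \<open>The limit as \<open>q\<close> tends to 1\<close>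

lemma drift_process_mono:
  assumes "drift_process M X m v" "v \<le> w" shows "drift_process M X m w"
proof -
  interpret drift_process M X m v by (rule assms(1))
  show ?thesis
  proof
    fix s t :: real assume st: "0 \<le> s" "s < t"
    have "v * (t - s) \<le> w * (t - s)" using assms(2) st by (intro mult_right_mono) auto
    then show "expectation (\<lambda>\<omega>. (X t \<omega> - X s \<omega> - m * (t - s))\<^sup>2) \<le> w * (t - s)"
      using sq_le[OF st] by linarith
  qed (fact X_measurable X_0 path_cadlag indep_incr sq_integrable)+
qed

lemma drift_limit:
  fixes \<mu> :: real
  assumes "0 < \<mu>"
  shows "((\<lambda>q. - ln q / 2 * (2 / (1 - q)\<^sup>2) * (1 - q powr \<mu>)) \<longlongrightarrow> \<mu>) (at_left 1)"
  using assms by real_asymp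

lemma variance_limit:
  fixes \<mu> :: real
  assumes "0 < \<mu>"
  shows "((\<lambda>q. 2 * (- ln q / 2)\<^sup>2 * (2 / (1 - q)\<^sup>2) * (1 + q powr \<mu>)) \<longlongrightarrow> 2) (at_left 1)"
  using assms by (real_asymp simp: power2_eq_square)

text \<open>With \<open>b = j\<close> these are the real and imaginary parts of the exponent in the characteristic function
of a grid increment.\<close>

lemma char_exponent_limits:
  fixes \<mu> \<theta> b :: real
  assumes "0 < \<mu>" "0 < b"
  shows "((\<lambda>q. 2 / (1 - q)\<^sup>2 / b * (1 + q powr \<mu>) * (cos (\<theta> * (- ln q / 2)) - 1)) \<longlongrightarrow> - (1 / b * \<theta>\<^sup>2 / 2)) (at_left 1)"
    and "((\<lambda>q. 2 / (1 - q)\<^sup>2 / b * (1 - q powr \<mu>) * sin (\<theta> * (- ln q / 2))) \<longlongrightarrow> \<theta> * (\<mu> / b)) (at_left 1)"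
proof -
  \<comment> \<open>the asymptotic expansions need the sign of the coefficient \<open>\<theta>\<close>\<close>
  consider "\<theta> = 0" | "\<theta> > 0" | "\<theta> < 0" by linarith
  note cases = this
  show "((\<lambda>q. 2 / (1 - q)\<^sup>2 / b * (1 + q powr \<mu>) * (cos (\<theta> * (- ln q / 2)) - 1)) \<longlongrightarrow> - (1 / b * \<theta>\<^sup>2 / 2)) (at_left 1)"
    using cases by (cases; use assms in \<open>simp; fail | real_asymp simp: field_simps power2_eq_square\<close>)
  show "((\<lambda>q. 2 / (1 - q)\<^sup>2 / b * (1 - q powr \<mu>) * sin (\<theta> * (- ln q / 2))) \<longlongrightarrow> \<theta> * (\<mu> / b)) (at_left 1)"
    using cases by (cases; use assms in \<open>simp; fail | real_asymp simp: field_simps power2_eq_square\<close>)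
qed

lemma scaled_zeta_weak_limit:
  fixes M :: "nat \<Rightarrow> 'a measure"
  assumes zp: "\<And>n. zeta_process (M n) (P n) (Q n) (q n) \<mu>" and q: "filterlim q (at_left 1) sequentially" and j: "0 < j"
  shows "weak_conv_m (\<lambda>n. distr (M n) borel (\<lambda>\<omega>. grid_increments j (scaled_zeta (q n) (P n) (Q n)) \<omega> i))
    (normal_law (\<mu> / real j) (1 / real j))"
proof (rule levy_continuity)
  have \<mu>: "0 < \<mu>" using zp[of 0] by (simp add: zeta_process_def)
  show "real_distribution (distr (M n) borel (\<lambda>\<omega>. grid_increments j (scaled_zeta (q n) (P n) (Q n)) \<omega> i))" for n
  proof -
    interpret zeta_process "M n" "P n" "Q n" "q n" \<mu> by (rule zp)
    show ?thesis
      by (intro real_distribution_distr drift_process.grid_increment_measurable[OF scaled_zeta_drift_process])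
  qed
  show "real_distribution (normal_law (\<mu> / real j) (1 / real j))"
    using j by (intro normal_law_real_distribution) simp
  fix \<theta>
  have "(\<lambda>n. exp (of_real (2 / (1 - q n)\<^sup>2 / real j * (1 + q n powr \<mu>) * (cos (\<theta> * (- ln (q n) / 2)) - 1)) +
        \<i> * of_real (2 / (1 - q n)\<^sup>2 / real j * (1 - q n powr \<mu>) * sin (\<theta> * (- ln (q n) / 2)))))
      \<longlonglongrightarrow> exp (of_real (- (1 / real j * \<theta>\<^sup>2 / 2)) + \<i> * of_real (\<theta> * (\<mu> / real j)))"
    using j by (intro tendsto_intros filterlim_compose[OF char_exponent_limits(1) q] filterlim_compose[OF char_exponent_limits(2) q] \<mu>) auto
  also have "exp (of_real (- (1 / real j * \<theta>\<^sup>2 / 2)) + \<i> * of_real (\<theta> * (\<mu> / real j))) = char (normal_law (\<mu> / real j) (1 / real j)) \<theta>"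
    using j by (subst char_normal_law) (simp_all add: add.commute)
  finally show "(\<lambda>n. char (distr (M n) borel (\<lambda>\<omega>. grid_increments j (scaled_zeta (q n) (P n) (Q n)) \<omega> i)) \<theta>)
      \<longlonglongrightarrow> char (normal_law (\<mu> / real j) (1 / real j)) \<theta>"
    by (simp only: zeta_process.char_scaled_zeta_increment[OF zp j])
qed

theorem proposition2p4:
  fixes \<mu> :: real
    and M :: "real \<Rightarrow> 'a measure"
    and P Q :: "real \<Rightarrow> real \<Rightarrow> 'a \<Rightarrow> nat"
    and N :: "'b measure"
    and B :: "real \<Rightarrow> 'b \<Rightarrow> real"
  assumes "\<mu> > 0"
    and "\<And>q. 0 < q \<Longrightarrow> q < 1 \<Longrightarrow> poisson_process (M q) 1 (P q)"
    and "\<And>q. 0 < q \<Longrightarrow> q < 1 \<Longrightarrow> poisson_process (M q) (q powr \<mu>) (Q q)"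
    and "\<And>q. 0 < q \<Longrightarrow> q < 1 \<Longrightarrow> indep_counting_processes (M q) (P q) (Q q)"
    and "standard_brownian_motion N B"
  shows "(\<forall>q\<in>{0<..<1}. \<forall>\<omega>\<in>space (M q).
            ennreal ((1 - q)\<^sup>2) * I_q q (zeta (P q) (Q q) \<omega>) =
              exp_functional (W_q q (zeta (P q) (Q q) \<omega>))) \<and>
         (\<forall>q\<in>{0<..<1}. AE \<omega> in M q. exp_functional (W_q q (zeta (P q) (Q q) \<omega>)) < \<infinity>) \<and>
         (AE \<omega> in N. exp_functional (W_drift \<mu> B \<omega>) < \<infinity>) \<and>
         weakly_converges
           (prod_topology cadlag.mtopology (top_of_set {0..}))
           (cadlag_ball_sigma \<Otimes>\<^sub>M restrict_space borel {0..})
           M (\<lambda>q \<omega>. (W_q q (zeta (P q) (Q q) \<omega>),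
                     enn2real (exp_functional (W_q q (zeta (P q) (Q q) \<omega>)))))
           (at_left 1)
           N (\<lambda>\<omega>. (W_drift \<mu> B \<omega>, enn2real (exp_functional (W_drift \<mu> B \<omega>))))"
proof (intro conjI)
  have zp: "zeta_process (M q) (P q) (Q q) q \<mu>" if "0 < q" "q < 1" for q
    using assms that by unfold_locales auto
  note dp = zeta_process.scaled_zeta_drift_process[OF zp]
  note bm = brownian_drift_process[OF assms(5), where \<mu>=\<mu>]
  show "\<forall>q\<in>{0<..<1}. \<forall>\<omega>\<in>space (M q). ennreal ((1 - q)\<^sup>2) * I_q q (zeta (P q) (Q q) \<omega>) =
      exp_functional (W_q q (zeta (P q) (Q q) \<omega>))"
    by (intro ballI exp_functional_W_q zeta_process.zeta_right_cont[OF zp]) auto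
  show "\<forall>q\<in>{0<..<1}. AE \<omega> in M q. exp_functional (W_q q (zeta (P q) (Q q) \<omega>)) < \<infinity>"
  proof
    fix q :: real assume "q \<in> {0<..<1}"
    then have q: "0 < q" "q < 1" by auto
    have "0 < - ln q / 2 * (2 / (1 - q)\<^sup>2) * (1 - q powr \<mu>)"
      using zeta_process.constants_pos[OF zp[OF q]] by (intro mult_pos_pos) auto
    from drift_process.exp_functional_finite[OF dp[OF q] this]
    show "AE \<omega> in M q. exp_functional (W_q q (zeta (P q) (Q q) \<omega>)) < \<infinity>" unfolding W_q_eq .
  qed
  show "AE \<omega> in N. exp_functional (W_drift \<mu> B \<omega>) < \<infinity>"
    unfolding W_drift_eq by (rule drift_process.exp_functional_finite[OF bm(1) assms(1)])
  have spc: "space (cadlag_ball_sigma \<Otimes>\<^sub>M restrict_space borel {0::real..}) = cadlag_space \<times> {0..}"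
    unfolding space_pair_measure space_restrict_space cadlag_ball_sigma_def
    by (subst space_measure_of) (auto simp: cadlag.in_mball)
  show "weakly_converges
           (prod_topology cadlag.mtopology (top_of_set {0..}))
           (cadlag_ball_sigma \<Otimes>\<^sub>M restrict_space borel {0..})
           M (\<lambda>q \<omega>. (W_q q (zeta (P q) (Q q) \<omega>),
                     enn2real (exp_functional (W_q q (zeta (P q) (Q q) \<omega>)))))
           (at_left 1)
           N (\<lambda>\<omega>. (W_drift \<mu> B \<omega>, enn2real (exp_functional (W_drift \<mu> B \<omega>))))"
    unfolding weakly_converges_def W_q_eq W_drift_eq path_with_functional_def[symmetric]
  proof (intro conjI allI impI)
    have "eventually (\<lambda>q::real. 0 < q \<and> q < 1) (at_left 1)"
      unfolding eventually_at_left_field by (intro exI[of _ 0]) auto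
    then show "\<forall>\<^sub>F q in at_left 1. prob_space (M q) \<and> path_with_functional (scaled_zeta q (P q) (Q q)) \<in>
        measurable (M q) (cadlag_ball_sigma \<Otimes>\<^sub>M restrict_space borel {0..})"
      by eventually_elim (auto intro: path_with_functional_measurable dp drift_process.axioms(1)[OF dp])
    show "prob_space N" by (rule drift_process.axioms(1)[OF bm(1)])
    show "path_with_functional (\<lambda>t \<omega>. B t \<omega> + \<mu> * t) \<in> measurable N (cadlag_ball_sigma \<Otimes>\<^sub>M restrict_space borel {0..})"
      by (rule path_with_functional_measurable[OF bm(1)])
  next
    fix f :: "(real \<Rightarrow> real) \<times> real \<Rightarrow> real"
    assume f: "continuous_map (prod_topology cadlag.mtopology (top_of_set {0..})) euclideanreal f"
      "f \<in> borel_measurable (cadlag_ball_sigma \<Otimes>\<^sub>M restrict_space borel {0..})"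
      "bounded (f ` space (cadlag_ball_sigma \<Otimes>\<^sub>M restrict_space borel {0..}))"
    \<comment> \<open>near 1 all the processes share the variance bound 3, as the limit of the bounds is 2\<close>
    have "eventually (\<lambda>q. 2 * (- ln q / 2)\<^sup>2 * (2 / (1 - q)\<^sup>2) * (1 + q powr \<mu>) < 3 \<and> 0 < q) (at_left 1)"
    proof (rule eventually_conj)
      show "eventually (\<lambda>q. 2 * (- ln q / 2)\<^sup>2 * (2 / (1 - q)\<^sup>2) * (1 + q powr \<mu>) < 3) (at_left 1)"
        by (rule order_tendstoD(2)[OF variance_limit[OF assms(1)]]) simp
      show "eventually (\<lambda>q::real. 0 < q) (at_left 1)" unfolding eventually_at_left_field by (intro exI[of _ 0]) auto
    qed
    then obtain b where b: "b < 1"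
      "\<And>q. b < q \<Longrightarrow> q < 1 \<Longrightarrow> 2 * (- ln q / 2)\<^sup>2 * (2 / (1 - q)\<^sup>2) * (1 + q powr \<mu>) < 3 \<and> 0 < q"
      unfolding eventually_at_left_field by blast
    show "((\<lambda>q. \<integral>\<omega>. f (path_with_functional (scaled_zeta q (P q) (Q q)) \<omega>) \<partial>M q) \<longlongrightarrow>
        (\<integral>\<omega>. f (path_with_functional (\<lambda>t \<omega>. B t \<omega> + \<mu> * t) \<omega>) \<partial>N)) (at_left 1)"
    proof (rule tendsto_at_left_sequentially[OF b(1)])
      fix q :: "nat \<Rightarrow> real" assume q: "\<And>n. q n < 1" "\<And>n. b < q n" "q \<longlonglongrightarrow> 1"
      have q0: "0 < q n" for n using b(2)[OF q(2,1)] by blast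
      have qf: "filterlim q (at_left 1) sequentially"
        using q unfolding filterlim_at by (auto intro!: always_eventually simp: less_imp_neq)
      show "(\<lambda>n. \<integral>\<omega>. f (path_with_functional (scaled_zeta (q n) (P (q n)) (Q (q n))) \<omega>) \<partial>M (q n)) \<longlonglongrightarrow>
          (\<integral>\<omega>. f (path_with_functional (\<lambda>t \<omega>. B t \<omega> + \<mu> * t) \<omega>) \<partial>N)"
      proof (rule drift_process_expectation_tendsto)
        show "drift_process (M (q n)) (scaled_zeta (q n) (P (q n)) (Q (q n)))
            (- ln (q n) / 2 * (2 / (1 - q n)\<^sup>2) * (1 - q n powr \<mu>)) 3" for n
          using b(2)[OF q(2,1)] by (intro drift_process_mono[OF dp] q0 q less_imp_le) blast
        show "(\<lambda>n. - ln (q n) / 2 * (2 / (1 - q n)\<^sup>2) * (1 - q n powr \<mu>)) \<longlonglongrightarrow> \<mu>"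
          by (rule filterlim_compose[OF drift_limit[OF assms(1)] qf])
        show "0 < \<mu>" by (rule assms(1))
        show "weak_conv_m (\<lambda>n. distr (M (q n)) borel (\<lambda>\<omega>. grid_increments j (scaled_zeta (q n) (P (q n)) (Q (q n))) \<omega> i))
            (normal_law (\<mu> / real j) (1 / real j))" if "0 < j" for j i
          by (rule scaled_zeta_weak_limit[OF zp[OF q0 q(1)] qf that])
        show "drift_process N (\<lambda>t \<omega>. B t \<omega> + \<mu> * t) \<mu> 1" by (rule bm(1))
        show "distr N borel (\<lambda>\<omega>. grid_increments j (\<lambda>t \<omega>. B t \<omega> + \<mu> * t) \<omega> i) = normal_law (\<mu> / real j) (1 / real j)"
          if "0 < j" for j i by (rule bm(2)[OF that])
        show "bounded (f ` (cadlag_space \<times> {0..}))" using f(3) unfolding spc .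
      qed (rule f)+
    qed
  qed
qed

end
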